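(* Let $\alpha\ge0$. A set $K\subset L^2_\alpha$ is precompact (totally bounded) in $L^2_\alpha$ if and only if the following two conditions hold. (i) $K$ satisfies $\mathbf{P_b}$: for every $\varepsilon>0$ and $M_0>0$ there is a $\delta>0$ such that for all $0\le t\le M_0$, $0\le h\le\delta$ and $f\in K$ $$\left(\int_0^\infty\left|\left(T^\alpha_{t+h}f(x)-T^\alpha_tf(x)\right)e^{-\frac x2}\right|^2x^\alpha\,dx\right)^{\frac12}<\varepsilon .$$ (ii) The set $\hat K=\{\hat f: f\in K\}$ of sequences is pointwise bounded: for every $n\in\mathbb{N}$ there is an $M(n)$ such that $|\hat f(n)|\le M(n)$ for all $f\in K$.
   Context: For $\alpha>-1$, $L^2_\alpha$ is the space of measurable $f:\mathbb{R}_+\to\mathbb{R}$ with $\|f\|_{2,\alpha}=\left(\int_0^\infty|f(x)e^{-x/2}|^2x^\alpha dx\right)^{1/2}<\infty$. For $\alpha>-\frac12$, $t,x\ge0$, the Laguerre translation is $$T_t^\alpha f(x)=c_\alpha\int_0^\pi f\left(x+t+2\sqrt{xt}\cos\vartheta\right)e^{-\sqrt{xt}\cos\vartheta}\,j_{\alpha-\frac12}\left(\sqrt{xt}\sin\vartheta\right)\sin^{2\alpha}\vartheta\,d\vartheta,\qquad c_\alpha=\frac{\Gamma(\alpha+1)}{\Gamma(\alpha+\frac12)\Gamma(\frac12)},$$ where $j_\beta(z)=\sum_{k=0}^\infty\frac{(-1)^k\Gamma(\beta+1)}{\Gamma(k+1)\Gamma(k+\beta+1)}\left(\frac z2\right)^{2k}$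 for $\beta>-1$ (entire Bessel function). $L_n^\alpha$ is the $n$-th Laguerre polynomial, with $\int_0^\infty L_n^\alpha L_k^\alpha e^{-x}x^\alpha dx=\Gamma(\alpha+1)\binom{n+\alpha}{n}\delta_{n,k}$ and $L_n^\alpha(0)=\binom{n+\alpha}{n}$; $R_n^\alpha=L_n^\alpha/\binom{n+\alpha}{n}$. For $f\in L^2_\alpha$, $\hat f$ is the sequence $$\hat f(n)=\int_0^\infty f(x)R_n^\alpha(x)e^{-x}x^\alpha\,dx,\qquad n\in\mathbb{N}=\{0,1,2,\dots\}.$$ *)

theory Defs
  imports "HOL-Analysis.Analysis"
begin

text \<open>
  Functions on the half line $[0,\infty)$ are represented by functions of type
  \<open>real \<Rightarrow> real\<close> whose values on the negative reals are irrelevant. Functions that agree almost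
  everywhere are not identified, so the norm below is only a seminorm. Measurability is
  Lebesgue measurability. Since \<open>0 powr a = 0\<close> also for \<open>a = 0\<close>, the weights
  \<open>x powr \<alpha>\<close> and \<open>sin \<theta> powr (2 * \<alpha>)\<close> may differ from the usual ones at the endpoints,
  a null set.
\<close>

definition laguerre_L2 :: "real \<Rightarrow> (real \<Rightarrow> real) set" where
  "laguerre_L2 \<alpha> = {f \<in> borel_measurable (lebesgue_on {0..}).
     integrable (lebesgue_on {0..}) (\<lambda>x. \<bar>f x * exp (- x / 2)\<bar>\<^sup>2 * x powr \<alpha>)}"

text \<open>The norm is meaningful only on \<open>laguerre_L2 \<alpha>\<close>: the Bochner integral of a
  non-integrable function is 0.\<close>

definition laguerre_norm :: "real \<Rightarrow> (real \<Rightarrow> real) \<Rightarrow> real" where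
  "laguerre_norm \<alpha> f =
     sqrt (LINT x|lebesgue_on {0..}. \<bar>f x * exp (- x / 2)\<bar>\<^sup>2 * x powr \<alpha>)"

definition laguerre_totally_bounded :: "real \<Rightarrow> (real \<Rightarrow> real) set \<Rightarrow> bool" where
  "laguerre_totally_bounded \<alpha> K \<longleftrightarrow>
     (\<forall>\<epsilon>>0. \<exists>F. finite F \<and> F \<subseteq> laguerre_L2 \<alpha> \<and>
        (\<forall>f\<in>K. \<exists>g\<in>F. laguerre_norm \<alpha> (\<lambda>x. f x - g x) < \<epsilon>))"

definition entire_bessel :: "real \<Rightarrow> real \<Rightarrow> real" where
  "entire_bessel \<beta> z =
     (\<Sum>k. (- 1) ^ k * Gamma (\<beta> + 1) / (Gamma (real k + 1) * Gamma (real k + \<beta> + 1))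
            * (z / 2) ^ (2 * k))"

definition laguerre_translation :: "real \<Rightarrow> real \<Rightarrow> (real \<Rightarrow> real) \<Rightarrow> real \<Rightarrow> real" where
  "laguerre_translation \<alpha> t f x =
     Gamma (\<alpha> + 1) / (Gamma (\<alpha> + 1 / 2) * Gamma (1 / 2)) *
     (LINT \<theta>|lebesgue_on {0..pi}.
        f (x + t + 2 * sqrt (x * t) * cos \<theta>) * exp (- (sqrt (x * t) * cos \<theta>))
        * entire_bessel (\<alpha> - 1 / 2) (sqrt (x * t) * sin \<theta>) * sin \<theta> powr (2 * \<alpha>))"

text \<open>The explicit form of the polynomials that are orthogonal for the weight
  $e^{-x}x^\alpha$ on the half line and take the value $\binom{n+\alpha}{n}$ at 0.\<close>

definition laguerre_poly :: "nat \<Rightarrow> real \<Rightarrow> real \<Rightarrow> real" where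
  "laguerre_poly n \<alpha> x =
     (\<Sum>k\<le>n. (- 1) ^ k * ((real n + \<alpha>) gchoose (n - k)) * x ^ k / fact k)"

lemma laguerre_poly_0: "laguerre_poly n \<alpha> 0 = (real n + \<alpha>) gchoose n"
proof -
  have "laguerre_poly n \<alpha> 0 = (\<Sum>k\<le>n. if k = 0 then (real n + \<alpha>) gchoose n else 0)"
    unfolding laguerre_poly_def by (intro sum.cong) auto
  then show ?thesis by simp
qed

definition laguerre_poly_normalized :: "nat \<Rightarrow> real \<Rightarrow> real \<Rightarrow> real" where
  "laguerre_poly_normalized n \<alpha> x = laguerre_poly n \<alpha> x / ((real n + \<alpha>) gchoose n)"

definition laguerre_coeff :: "real \<Rightarrow> (real \<Rightarrow> real) \<Rightarrow> nat \<Rightarrow> real" where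
  "laguerre_coeff \<alpha> f n =
     (LINT x|lebesgue_on {0..}. f x * laguerre_poly_normalized n \<alpha> x * exp (- x) * x powr \<alpha>)"

text \<open>Membership in \<open>laguerre_L2 \<alpha>\<close> expresses that the integral defining the norm is finite.\<close>

definition property_Pb :: "real \<Rightarrow> (real \<Rightarrow> real) set \<Rightarrow> bool" where
  "property_Pb \<alpha> K \<longleftrightarrow>
     (\<forall>\<epsilon>>0. \<forall>M\<^sub>0>0. \<exists>\<delta>>0. \<forall>t h. \<forall>f\<in>K. 0 \<le> t \<and> t \<le> M\<^sub>0 \<and> 0 \<le> h \<and> h \<le> \<delta> \<longrightarrow>
        (\<lambda>x. laguerre_translation \<alpha> (t + h) f x - laguerre_translation \<alpha> t f x)
          \<in> laguerre_L2 \<alpha> \<and>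
        laguerre_norm \<alpha>
          (\<lambda>x. laguerre_translation \<alpha> (t + h) f x - laguerre_translation \<alpha> t f x) < \<epsilon>)"

definition pointwise_bounded :: "(nat \<Rightarrow> real) set \<Rightarrow> bool" where
  "pointwise_bounded S \<longleftrightarrow> (\<forall>n. \<exists>M. \<forall>s\<in>S. \<bar>s n\<bar> \<le> M)"

end

theory Submission
  imports Defs
begin

text \<open>
  The normalized Laguerre polynomials $R_n=R_n^\alpha$ diagonalize the translations: the Fourier-Laguerre
  coefficients of $T_tf$ are $R_n(t)\hat f(n)$ (\<open>coefficient_translation\<close>). Since the Laguerre functions
  form a complete orthonormal family in $L^2_\alpha$ (\<open>laguerre_complete\<close>), norms and total boundedness can be
  read off the coefficients: a set is totally bounded as soon as each coefficient is bounded on it and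
  the tails of the coefficient sequences are uniformly small
  (\<open>small_tails_bounded_coeffs_imp_totally_bounded\<close>).

  The operators. Put $y=x+t+2\sqrt{xt}\cos\theta$. Up to a constant, the law of $(x,y)$ under
  $x^\alpha dx\,\sin^{2\alpha}\theta\,d\theta$ has the density
  $D^{\alpha-1/2}$ with $D=4xt-(y-x-t)^2$, and $D$ is symmetric in $x$ and $y$. Moreover
  $\sqrt{xt}\sin\theta=\sqrt D/2$. For $\alpha\ge0$ an energy argument gives $|j_{\alpha-1/2}|\le1$
  (\<open>abs_entire_bessel_le_1\<close>). These facts make $T_t$ a self-adjoint operator of norm
  at most $e^{t/2}$ (\<open>translation_selfadjoint\<close>, \<open>square_integrable_translation\<close>).

  The eigenfunctions. A generating function shows that $T_t$ maps polynomials of degree at most $n$ to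
  polynomials of degree at most $n$ (\<open>translation_poly\<close>). A self-adjoint operator with this property is diagonal on
  the orthogonal polynomials, and evaluation at $x=0$ gives the eigenvalue $R_n(t)$. This is the product
  formula \<open>translation_laguerre\<close>; with the norm bound it yields $|R_n(t)|\le e^{t/2}$.

  Completeness. The exponentials $e^{-lx}$, $l\ge0$, satisfy Parseval's identity by an explicit
  computation, so they lie in the closed span of the Laguerre functions. By the Weierstrass theorem in the variable
  $e^{-x}$ so do the continuous functions of bounded support, and these are dense.

  The equivalence. If $K$ is totally bounded, $\mathbf{P_b}$ holds because it holds for each
  single function and the $T_t$ are bounded uniformly for $t\le M_0+1$. Conversely let $\mathbf{P_b}$ hold. It bounds
  $\sum_n(R_n(h)-1)^2\,|a_n|^2$ uniformly over $f\in K$ and $0\le h\le\delta$, where $a_n$ are the orthonormal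
  coefficients of $f$. By orthogonality $R_n$ has small mean over
  $[0,\delta]$ for large $n$, so the mean of $(R_n-1)^2$ is at least $\frac14$ there. Averaging
  over $h$ makes the tails uniformly small (\<open>uniform_tails\<close>).
\<close>

section \<open>Bessel functions as power series\<close>

lemma entire_bessel_eq:
  assumes "\<beta> > -1"
  shows "entire_bessel \<beta> z = (\<Sum>k. (- (z\<^sup>2) / 4) ^ k / (fact k * pochhammer (\<beta> + 1) k))"
proof -
  have G: "Gamma (\<beta> + 1) / (Gamma (real k + 1) * Gamma (real k + \<beta> + 1))
      = 1 / (fact k * pochhammer (\<beta> + 1) k)" for k
  proof -
    have *: "pochhammer (\<beta> + 1) k = Gamma (\<beta> + 1 + of_nat k) / Gamma (\<beta> + 1)"
      using assms by (intro pochhammer_Gamma) (auto simp: nonpos_Ints_def)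
    have "Gamma (\<beta> + 1) > 0" using assms by (intro Gamma_real_pos) auto
    moreover have "Gamma (\<beta> + 1 + real k) > 0" using assms by (intro Gamma_real_pos) auto
    moreover have "Gamma (real k + 1) = fact k" using Gamma_fact[of k] by (simp add: add_ac)
    ultimately show ?thesis unfolding * by (simp add: field_simps add_ac)
  qed
  have "(- 1) ^ k * Gamma (\<beta> + 1) / (Gamma (real k + 1) * Gamma (real k + \<beta> + 1)) * (z / 2) ^ (2 * k)
      = (- (z\<^sup>2) / 4) ^ k / (fact k * pochhammer (\<beta> + 1) k)" for k
  proof -
    have "(- 1) * (z / 2)\<^sup>2 = - (z\<^sup>2) / 4" by (simp add: power_divide)
    then have "(- 1) ^ k * (z / 2) ^ (2 * k) = (- (z\<^sup>2) / 4) ^ k"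
      by (metis power_mult power_mult_distrib)
    then show ?thesis
      using G[of k] by (metis (no_types, lifting) mult.commute mult.right_neutral times_divide_eq_left times_divide_eq_right)
  qed
  then show ?thesis unfolding entire_bessel_def by simp
qed

lemma summable_bessel_series:
  fixes b w :: real
  assumes "b > 0"
  shows "summable (\<lambda>k. w ^ k / (fact k * pochhammer b k))"
proof (rule summable_ratio_test[of "1/2" "nat \<lceil>2 * \<bar>w\<bar> / b\<rceil>"])
    fix n assume n: "nat \<lceil>2 * \<bar>w\<bar> / b\<rceil> \<le> n"
    have pn: "pochhammer b n > 0" using assms by (intro pochhammer_pos)
    have "2 * \<bar>w\<bar> / b \<le> real n" using n by linarith
    then have "2 * \<bar>w\<bar> \<le> real n * b" using assms by (simp add: field_simps)
    also have "\<dots> \<le> (1 + real n) * (b + real n)" using assms by (simp add: algebra_simps)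
    finally have "\<bar>w\<bar> / ((1 + real n) * (b + real n)) \<le> 1/2"
      using assms by (subst pos_divide_le_eq) (auto intro!: mult_pos_pos add_pos_nonneg)
    moreover have "norm (w ^ Suc n / (fact (Suc n) * pochhammer b (Suc n)))
       = \<bar>w\<bar> / ((1 + real n) * (b + real n)) * norm (w ^ n / (fact n * pochhammer b n))"
      using assms pn by (simp add: pochhammer_Suc abs_mult power_abs)
    ultimately show "norm (w ^ Suc n / (fact (Suc n) * pochhammer b (Suc n)))
       \<le> 1/2 * norm (w ^ n / (fact n * pochhammer b n))"
      by (simp only: mult_right_mono norm_ge_zero)
qed simp

text \<open>
  The hypergeometric series ${}_0F_1(b;w)$. The entire Bessel function of index $b-1$ at $z$ is its
  value at $-z^2/4$, and \<open>cosh z\<close> is the case $b=\frac12$ at $z^2/4$, so a single series serves for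
  both factors of the kernel of the translation.
\<close>

definition bessel_series :: "real \<Rightarrow> real \<Rightarrow> real" where
  "bessel_series b w = (\<Sum>k. w ^ k / (fact k * pochhammer b k))"

lemma bessel_series_sums:
  assumes "b > 0"
  shows "(\<lambda>k. w ^ k / (fact k * pochhammer b k)) sums bessel_series b w"
  unfolding bessel_series_def using summable_bessel_series[OF assms] by (rule summable_sums)

lemma bessel_series_0 [simp]: "b > 0 \<Longrightarrow> bessel_series b 0 = 1"
  using sums_unique[OF powser_sums_zero[of "\<lambda>k. 1 / (fact k * pochhammer b k)"]]
  unfolding bessel_series_def by simp

lemma entire_bessel_conv_series:
  "\<beta> > -1 \<Longrightarrow> entire_bessel \<beta> z = bessel_series (\<beta> + 1) (- (z\<^sup>2) / 4)"
  by (simp add: entire_bessel_eq bessel_series_def)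

lemma has_derivative_bessel_series:
  assumes "b > 0"
  shows "(bessel_series b has_real_derivative bessel_series (b + 1) w / b) (at w)"
proof -
  define c where "c k = 1 / (fact k * pochhammer b k)" for k
  have c: "bessel_series b = (\<lambda>w. \<Sum>k. c k * w ^ k)"
    by (simp add: fun_eq_iff bessel_series_def c_def)
  have "((\<lambda>x. \<Sum>n. c n * x^n) has_field_derivative (\<Sum>n. diffs c n * w^n)) (at w)"
    using summable_bessel_series[OF assms]
    by (intro termdiffs_strong_converges_everywhere) (simp add: c_def)
  moreover have "diffs c n * w ^ n = w ^ n / (fact n * pochhammer (b + 1) n) / b" for n
    unfolding diffs_def c_def by (simp add: pochhammer_rec)
  moreover have "(\<Sum>n. w ^ n / (fact n * pochhammer (b + 1) n) / b) = bessel_series (b + 1) w / b"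
    unfolding bessel_series_def using assms
    by (intro suminf_divide summable_bessel_series) auto
  ultimately show ?thesis unfolding c by simp
qed

text \<open>
  Together with the derivative formula this contiguity relation is Bessel's differential equation
  in the variable $w$, without a singular point at $0$.
\<close>

lemma bessel_series_contiguous:
  assumes "b > 0"
  shows "w * bessel_series (b + 2) w / (b * (b + 1)) + bessel_series (b + 1) w = bessel_series b w"
proof -
  have "(\<lambda>k. (w ^ k / (fact k * pochhammer b k) - w ^ k / (fact k * pochhammer (b + 1) k)))
          sums (bessel_series b w - bessel_series (b + 1) w)"
    using assms by (intro sums_diff bessel_series_sums) auto
  then have "(\<lambda>k. w ^ Suc k / (fact (Suc k) * pochhammer b (Suc k)) - w ^ Suc k / (fact (Suc k) * pochhammer (b + 1) (Suc k)))
          sums (bessel_series b w - bessel_series (b + 1) w)"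
    by (subst sums_Suc_iff) simp
  moreover have "w ^ Suc k / (fact (Suc k) * pochhammer b (Suc k)) - w ^ Suc k / (fact (Suc k) * pochhammer (b + 1) (Suc k))
     = w / (b * (b + 1)) * (w ^ k / (fact k * pochhammer (b + 2) k))" for k
  proof -
    have 1: "pochhammer b (Suc k) * (b + 1 + real k) = b * pochhammer (b + 1) (Suc k)"
      using pochhammer_Suc[of "b + 1" k] by (simp add: pochhammer_rec[of b] del: pochhammer_Suc)
    have 2: "pochhammer (b + 1) (Suc k) = (b + 1) * pochhammer (b + 2) k"
      by (simp add: pochhammer_rec add_ac)
    have p: "pochhammer (b + 2) k > 0" "pochhammer b (Suc k) > 0" "pochhammer (b+1) (Suc k) > 0"
      using assms by (auto intro!: pochhammer_pos)
    have "1 / pochhammer b (Suc k) = (b + 1 + real k) / (b * pochhammer (b + 1) (Suc k))"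
      unfolding 1[symmetric] using p assms by (simp add: add_pos_nonneg less_imp_neq[symmetric] del: pochhammer_Suc)
    then have "1 / pochhammer b (Suc k) - 1 / pochhammer (b + 1) (Suc k)
       = (b + 1 + real k) / (b * pochhammer (b + 1) (Suc k)) - b / (b * pochhammer (b + 1) (Suc k))"
      using assms by (simp del: pochhammer_Suc)
    also have "\<dots> = (1 + real k) / (b * pochhammer (b + 1) (Suc k))"
      unfolding diff_divide_distrib[symmetric] by simp
    also have "\<dots> = (1 + real k) / (b * (b + 1) * pochhammer (b + 2) k)" unfolding 2 by simp
    finally have *: "1 / pochhammer b (Suc k) - 1 / pochhammer (b + 1) (Suc k) = \<dots>" .
    have "w ^ Suc k / (fact (Suc k) * pochhammer b (Suc k)) - w ^ Suc k / (fact (Suc k) * pochhammer (b + 1) (Suc k))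
      = w ^ Suc k / fact (Suc k) * (1 / pochhammer b (Suc k) - 1 / pochhammer (b + 1) (Suc k))"
      by (simp add: right_diff_distrib del: fact_Suc)
    also have "\<dots> = w / (b * (b + 1)) * (w ^ k / (fact k * pochhammer (b + 2) k))"
      unfolding * by (simp add: add_ac del: pochhammer_Suc)
    finally show ?thesis .
  qed
  moreover have "(\<lambda>k. w / (b * (b + 1)) * (w ^ k / (fact k * pochhammer (b + 2) k)))
      sums (w / (b * (b + 1)) * bessel_series (b + 2) w)"
    using assms by (intro sums_mult bessel_series_sums) auto
  ultimately show ?thesis using sums_unique2 by fastforce
qed

text \<open>
  The left hand side is the energy $j^2+j'^2$ of the Bessel equation, written in the variable
  $w=z^2/4$. Its derivative is $(1-2b)$ times a square, so for $b\ge\frac12$ it never exceeds its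
  value $1$ at the origin.
\<close>

lemma bessel_energy_le_1:
  assumes b: "b \<ge> 1/2" and w: "w \<ge> 0"
  shows "(bessel_series b (-w))\<^sup>2 + w * (bessel_series (b + 1) (-w) / b)\<^sup>2 \<le> 1"
proof -
  define E where "E w = (bessel_series b (-w))\<^sup>2 + w * (bessel_series (b + 1) (-w) / b)\<^sup>2" for w
  have "E w \<le> E 0"
  proof (rule DERIV_nonpos_imp_nonincreasing[OF w])
    fix x :: real assume x: "0 \<le> x" "x \<le> w"
    define F where "F = bessel_series b (-x)"
    define G where "G = bessel_series (b + 1) (-x)"
    define H where "H = bessel_series (b + 2) (-x)"
    have d0: "(bessel_series b has_real_derivative G / b) (at (-x))"
      using has_derivative_bessel_series[of b "-x"] b by (simp add: G_def)
    have d1: "(bessel_series (b+1) has_real_derivative H / (b+1)) (at (-x))"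
      using has_derivative_bessel_series[of "b+1" "-x"] b by (simp add: H_def add_ac)
    have d0': "((\<lambda>x. bessel_series b (-x)) has_real_derivative - (G / b)) (at x)"
      using DERIV_chain2[where f = "bessel_series b" and g = uminus and x = x, OF d0, of "-1" UNIV]
      by (auto simp: DERIV_minus[OF DERIV_ident])
    have d1': "((\<lambda>x. bessel_series (b + 1) (-x)) has_real_derivative - (H / (b + 1))) (at x)"
      using DERIV_chain2[where f = "bessel_series (b + 1)" and g = uminus and x = x, OF d1, of "-1" UNIV]
      by (auto simp: DERIV_minus[OF DERIV_ident])
    have D: "(E has_real_derivative (2 * F * (- (G / b)) + ((G / b)\<^sup>2 + x * (2 * (G / b) * (- (H / (b+1)) / b))))) (at x)"
      unfolding E_def F_def G_def
      using DERIV_add[OF DERIV_power[OF d0', of 2] DERIV_mult[OF DERIV_ident DERIV_power[OF DERIV_cdivide[OF d1', of b], of 2]]]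
      by (simp add: G_def mult_ac add_ac)
    have ode: "- x * H / (b * (b + 1)) + G = F"
      using bessel_series_contiguous[of b "-x"] b by (simp add: F_def G_def H_def)
    have "x * (2 * (G / b) * (- (H / (b+1)) / b)) = 2 * (G / b) * (- x * H / (b * (b+1)))"
      by (simp add: mult_ac)
    also have "\<dots> = 2 * (G / b) * (F - G)" by (simp add: ode[symmetric])
    \<comment> \<open>The second derivative is eliminated by the differential equation.\<close>
    finally have e: "x * (2 * (G / b) * (- (H / (b+1)) / b)) = 2 * (G / b) * (F - G)" .
    have "2 * F * (- (G / b)) + ((G / b)\<^sup>2 + x * (2 * (G / b) * (- (H / (b+1)) / b)))
      = (G / b)\<^sup>2 * (1 - 2 * b)"
      unfolding e using b by (simp add: field_simps power2_eq_square)
    also have "\<dots> \<le> 0" using b by (intro mult_nonneg_nonpos) auto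
    finally show "\<exists>y. (E has_real_derivative y) (at x) \<and> y \<le> 0" using D by auto
  qed
  then show ?thesis using b by (simp add: E_def)
qed

lemma abs_entire_bessel_le_1:
  assumes "\<beta> \<ge> - 1/2"
  shows "\<bar>entire_bessel \<beta> z\<bar> \<le> 1"
proof -
  have "(bessel_series (\<beta> + 1) (-(z\<^sup>2 / 4)))\<^sup>2 \<le> (bessel_series (\<beta> + 1) (-(z\<^sup>2 / 4)))\<^sup>2
      + z\<^sup>2 / 4 * (bessel_series (\<beta> + 1 + 1) (-(z\<^sup>2 / 4)) / (\<beta> + 1))\<^sup>2" by simp
  also have "\<dots> \<le> 1" using bessel_energy_le_1[of "\<beta> + 1" "z\<^sup>2/4"] assms by simp
  finally show ?thesis using assms by (simp add: entire_bessel_conv_series abs_square_le_1)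
qed

lemma continuous_on_entire_bessel:
  assumes "\<beta> > -1"
  shows "continuous_on A (entire_bessel \<beta>)"
proof -
  have "continuous_on UNIV (bessel_series (\<beta> + 1))"
    using has_derivative_bessel_series[of "\<beta> + 1"] assms
    by (intro continuous_at_imp_continuous_on ballI DERIV_isCont) auto
  then have "continuous_on A (\<lambda>z. bessel_series (\<beta> + 1) (- (z\<^sup>2) / 4))"
    by (rule continuous_on_compose2) (auto intro!: continuous_intros)
  then show ?thesis using entire_bessel_conv_series[OF assms] by (simp cong: continuous_on_cong)
qed

lemma bessel_series_norm_summable:
  "b > 0 \<Longrightarrow> summable (\<lambda>k. norm (w ^ k / (fact k * pochhammer b k)))" for b w :: real
  using summable_bessel_series[of b "\<bar>w\<bar>"]
  by (simp add: abs_mult power_abs pochhammer_pos less_imp_le abs_of_pos)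

text \<open>
  Only the even part of $e^{-A\cos\theta}$ survives integration over the angle; this puts it into
  the same form as the Bessel factor.
\<close>

lemma cosh_eq_bessel_series: "cosh z = bessel_series (1/2) (z\<^sup>2 / 4)" for z :: real
proof -
  have "(\<lambda>n. if even n then z ^ n /\<^sub>R fact n else 0) sums cosh z"
    by (rule cosh_converges)
  then have "(\<lambda>n. (\<lambda>n. if even n then z ^ n /\<^sub>R fact n else 0) (2 * n)) sums cosh z"
    by (subst sums_mono_reindex) (auto simp: strict_mono_def elim!: evenE)
  then have "(\<lambda>n. z ^ (2 * n) / fact (2 * n)) sums cosh z"
    by (simp add: divide_inverse_commute)
  moreover have "z ^ (2 * n) / fact (2 * n) = (z\<^sup>2 / 4) ^ n / (fact n * pochhammer (1/2) n)" for n
  proof -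
    have "fact (2 * n) = (4 ^ n * pochhammer (1 / 2) n * fact n :: real)"
      by (simp add: fact_double power_mult)
    then show ?thesis by (simp add: power_mult power_divide)
  qed
  ultimately show ?thesis
    using bessel_series_sums[of "1/2" "z\<^sup>2/4"] sums_unique2 by auto
qed

section \<open>Square integrable functions and orthonormal families\<close>

definition square_integrable :: "'a measure \<Rightarrow> ('a \<Rightarrow> real) \<Rightarrow> bool" where
  "square_integrable M f \<longleftrightarrow> f \<in> borel_measurable M \<and> integrable M (\<lambda>x. (f x)\<^sup>2)"

definition L2_norm_on :: "'a measure \<Rightarrow> ('a \<Rightarrow> real) \<Rightarrow> real" where
  "L2_norm_on M f = sqrt (LINT x|M. (f x)\<^sup>2)"

lemma L2_norm_on_nonneg [simp]: "0 \<le> L2_norm_on M f"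
  by (simp add: L2_norm_on_def)

lemma L2_norm_on_squared: "(L2_norm_on M f)\<^sup>2 = (LINT x|M. (f x)\<^sup>2)"
  by (simp add: L2_norm_on_def)

lemma square_integrable_mult_integrable:
  assumes "square_integrable M f" "square_integrable M g"
  shows "integrable M (\<lambda>x. f x * g x)"
proof (rule Bochner_Integration.integrable_bound)
  show "integrable M (\<lambda>x. (f x)\<^sup>2 + (g x)\<^sup>2)" using assms by (auto simp: square_integrable_def)
  show "(\<lambda>x. f x * g x) \<in> borel_measurable M" using assms by (auto simp: square_integrable_def)
  have "\<bar>a * b\<bar> \<le> a\<^sup>2 + b\<^sup>2" for a b :: real
  proof -
    have "2 * \<bar>a * b\<bar> \<le> a\<^sup>2 + b\<^sup>2"
      using zero_le_power2[of "abs a - abs b"] by (simp add: power2_diff abs_mult)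
    then show ?thesis using zero_le_power2[of a] zero_le_power2[of b] by linarith
  qed
  then show "AE x in M. norm (f x * g x) \<le> norm ((f x)\<^sup>2 + (g x)\<^sup>2)" by auto
qed

lemma square_integrable_lincomb:
  assumes f: "square_integrable M f" and g: "square_integrable M g"
  shows "square_integrable M (\<lambda>x. a * f x + b * g x)"
proof -
  have "(\<lambda>x. (a * f x + b * g x)\<^sup>2) = (\<lambda>x. a\<^sup>2 * (f x)\<^sup>2 + 2 * a * b * (f x * g x) + b\<^sup>2 * (g x)\<^sup>2)"
    by (simp add: power2_eq_square algebra_simps fun_eq_iff)
  then show ?thesis using f g square_integrable_mult_integrable[OF f g]
    by (auto simp: square_integrable_def)
qed

lemma square_integrable_add: "square_integrable M f \<Longrightarrow> square_integrable M g \<Longrightarrow> square_integrable M (\<lambda>x. f x + g x)"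
  using square_integrable_lincomb[of M f g 1 1] by simp

lemma square_integrable_diff: "square_integrable M f \<Longrightarrow> square_integrable M g \<Longrightarrow> square_integrable M (\<lambda>x. f x - g x)"
  using square_integrable_lincomb[of M f g 1 "-1"] by simp

lemma square_integrable_cmult: "square_integrable M f \<Longrightarrow> square_integrable M (\<lambda>x. c * f x)"
  using square_integrable_lincomb[of M f f c 0] by simp

lemma square_integrable_zero: "square_integrable M (\<lambda>x. 0)"
  by (simp add: square_integrable_def)

lemma square_integrable_sum:
  "(\<And>i. i \<in> I \<Longrightarrow> square_integrable M (f i)) \<Longrightarrow> square_integrable M (\<lambda>x. \<Sum>i\<in>I. f i x)"
  by (induction I rule: infinite_finite_induct) (auto intro: square_integrable_add square_integrable_zero)

text \<open>
  The quadratic form $\int(af+bg)^2$ is nonnegative; the case of a vanishing coefficient has to be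
  treated separately.
\<close>

lemma L2_Cauchy_Schwarz:
  assumes f: "square_integrable M f" and g: "square_integrable M g"
  shows "\<bar>LINT x|M. f x * g x\<bar> \<le> L2_norm_on M f * L2_norm_on M g"
proof -
  define A where "A = (LINT x|M. (f x)\<^sup>2)"
  define B where "B = (LINT x|M. f x * g x)"
  define C where "C = (LINT x|M. (g x)\<^sup>2)"
  have nn: "0 \<le> A" "0 \<le> C" by (auto simp: A_def C_def)
  have q: "0 \<le> a\<^sup>2 * A + 2 * a * b * B + b\<^sup>2 * C" for a b
  proof -
    have "0 \<le> (LINT x|M. (a * f x + b * g x)\<^sup>2)" by simp
    also have "(\<lambda>x. (a * f x + b * g x)\<^sup>2) = (\<lambda>x. a\<^sup>2 * (f x)\<^sup>2 + 2 * a * b * (f x * g x) + b\<^sup>2 * (g x)\<^sup>2)"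
      by (simp add: power2_eq_square algebra_simps fun_eq_iff)
    also have "(LINT x|M. a\<^sup>2 * (f x)\<^sup>2 + 2 * a * b * (f x * g x) + b\<^sup>2 * (g x)\<^sup>2) = a\<^sup>2 * A + 2 * a * b * B + b\<^sup>2 * C"
      unfolding A_def B_def C_def using f g square_integrable_mult_integrable[OF f g]
      by (simp add: square_integrable_def)
    finally show ?thesis .
  qed
  have "B\<^sup>2 \<le> A * C"
  proof (cases "C = 0")
    case True
    have "B = 0"
    proof (rule ccontr)
      assume B: "B \<noteq> 0"
      \<comment> \<open>With C = 0 the form is affine in b, and this value of b makes it negative.\<close>
      have "2 * 1 * (- (A + 1) / B) * B = - 2 * (A + 1)" using B by simp
      then show False using q[of 1 "- (A + 1) / B"] nn True by simp
    qed
    then show ?thesis using True by simp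
  next
    case False
    then have "C > 0" using nn by simp
    have "0 \<le> C * (A * C - B\<^sup>2)" using q[of C "- B"] by (simp add: power2_eq_square algebra_simps)
    then show ?thesis using \<open>C > 0\<close> by (simp add: zero_le_mult_iff)
  qed
  then have "sqrt (B\<^sup>2) \<le> sqrt (A * C)" by (rule real_sqrt_le_mono)
  then show ?thesis by (simp add: L2_norm_on_def A_def B_def C_def real_sqrt_mult)
qed

lemma L2_norm_on_triangle:
  assumes f: "square_integrable M f" and g: "square_integrable M g"
  shows "L2_norm_on M (\<lambda>x. f x + g x) \<le> L2_norm_on M f + L2_norm_on M g"
proof (rule power2_le_imp_le)
  have "(L2_norm_on M (\<lambda>x. f x + g x))\<^sup>2 = (LINT x|M. (f x)\<^sup>2 + 2 * (f x * g x) + (g x)\<^sup>2)"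
    unfolding L2_norm_on_squared by (simp add: power2_sum algebra_simps)
  also have "\<dots> = (LINT x|M. (f x)\<^sup>2) + 2 * (LINT x|M. f x * g x) + (LINT x|M. (g x)\<^sup>2)"
    using f g square_integrable_mult_integrable[OF f g] by (simp add: square_integrable_def)
  also have "\<dots> \<le> (L2_norm_on M f)\<^sup>2 + 2 * (L2_norm_on M f * L2_norm_on M g) + (L2_norm_on M g)\<^sup>2"
    using L2_Cauchy_Schwarz[OF f g] unfolding L2_norm_on_squared by simp
  also have "\<dots> = (L2_norm_on M f + L2_norm_on M g)\<^sup>2" by (simp add: power2_sum)
  finally show "(L2_norm_on M (\<lambda>x. f x + g x))\<^sup>2 \<le> (L2_norm_on M f + L2_norm_on M g)\<^sup>2" .
qed simp

lemma L2_norm_on_minus_commute: "L2_norm_on M (\<lambda>x. f x - g x) = L2_norm_on M (\<lambda>x. g x - f x)"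
  by (simp add: L2_norm_on_def power2_commute)

lemma L2_norm_on_triangle3:
  assumes "square_integrable M f" "square_integrable M g" "square_integrable M h"
  shows "L2_norm_on M (\<lambda>x. f x - h x) \<le> L2_norm_on M (\<lambda>x. f x - g x) + L2_norm_on M (\<lambda>x. g x - h x)"
  using L2_norm_on_triangle[of M "\<lambda>x. f x - g x" "\<lambda>x. g x - h x"] assms
  by (simp add: square_integrable_diff)

lemma L2_norm_on_cmult: "L2_norm_on M (\<lambda>x. c * f x) = \<bar>c\<bar> * L2_norm_on M f"
  by (simp add: L2_norm_on_def power_mult_distrib real_sqrt_mult)

lemma L2_norm_on_cong_AE:
  assumes "f \<in> borel_measurable M" "g \<in> borel_measurable M" "AE x in M. f x = g x"
  shows "L2_norm_on M f = L2_norm_on M g"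
  unfolding L2_norm_on_def using assms by (intro arg_cong[where f = sqrt] integral_cong_AE) auto

locale orthonormal_family =
  fixes M :: "'a measure" and \<phi> :: "nat \<Rightarrow> 'a \<Rightarrow> real"
  assumes square_integrable_family: "square_integrable M (\<phi> n)"
    and orthonormal: "(LINT x|M. \<phi> m x * \<phi> n x) = (if m = n then 1 else 0)"
begin

definition coefficient :: "('a \<Rightarrow> real) \<Rightarrow> nat \<Rightarrow> real" where
  "coefficient f n = (LINT x|M. f x * \<phi> n x)"

definition partial_sum :: "nat \<Rightarrow> ('a \<Rightarrow> real) \<Rightarrow> 'a \<Rightarrow> real" where
  "partial_sum N f x = (\<Sum>n<N. coefficient f n * \<phi> n x)"

lemma square_integrable_combination: "square_integrable M (\<lambda>x. \<Sum>n\<in>I. c n * \<phi> n x)"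
  by (intro square_integrable_sum square_integrable_cmult square_integrable_family)

lemma square_integrable_partial_sum: "square_integrable M (partial_sum N f)"
  unfolding partial_sum_def[abs_def] by (rule square_integrable_combination)

lemma coefficient_combination:
  assumes "finite I"
  shows "coefficient (\<lambda>x. \<Sum>m\<in>I. c m * \<phi> m x) n = (if n \<in> I then c n else 0)"
proof -
  have "coefficient (\<lambda>x. \<Sum>m\<in>I. c m * \<phi> m x) n = (LINT x|M. (\<Sum>m\<in>I. c m * (\<phi> m x * \<phi> n x)))"
    unfolding coefficient_def by (simp add: sum_distrib_right mult.assoc)
  also have "\<dots> = (\<Sum>m\<in>I. c m * (LINT x|M. \<phi> m x * \<phi> n x))"
    by (subst Bochner_Integration.integral_sum)
       (auto intro!: integrable_mult_right square_integrable_mult_integrable square_integrable_family)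
  also have "\<dots> = (if n \<in> I then c n else 0)" using assms by (simp add: orthonormal if_distrib[of "\<lambda>z. _ * z"] cong: if_cong)
  finally show ?thesis .
qed

lemma norm_squared_combination:
  assumes "finite I"
  shows "(L2_norm_on M (\<lambda>x. \<Sum>n\<in>I. c n * \<phi> n x))\<^sup>2 = (\<Sum>n\<in>I. (c n)\<^sup>2)"
proof -
  define p where "p x = (\<Sum>n\<in>I. c n * \<phi> n x)" for x
  have sp: "square_integrable M p" unfolding p_def[abs_def] by (rule square_integrable_combination)
  have "(L2_norm_on M p)\<^sup>2 = (LINT x|M. p x * (\<Sum>n\<in>I. c n * \<phi> n x))"
    unfolding L2_norm_on_squared by (simp add: p_def power2_eq_square)
  also have "\<dots> = (LINT x|M. (\<Sum>n\<in>I. c n * (p x * \<phi> n x)))"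
    by (simp add: sum_distrib_left mult_ac)
  also have "\<dots> = (\<Sum>n\<in>I. c n * coefficient p n)"
    unfolding coefficient_def
    by (subst Bochner_Integration.integral_sum)
       (auto intro!: integrable_mult_right square_integrable_mult_integrable square_integrable_family sp)
  also have "\<dots> = (\<Sum>n\<in>I. (c n)\<^sup>2)"
    unfolding p_def[abs_def] using coefficient_combination[OF assms, of c] by (simp add: power2_eq_square)
  finally show ?thesis by (simp add: p_def[abs_def])
qed

text \<open>
  Pythagoras: among all combinations over \<open>I\<close> the Fourier coefficients give the best
  approximation, and the other choices lose exactly the squared distance of the coefficients.
\<close>

lemma norm_diff_combination:
  assumes f: "square_integrable M f" and I: "finite I"
  shows "(L2_norm_on M (\<lambda>x. f x - (\<Sum>n\<in>I. c n * \<phi> n x)))\<^sup>2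
    = (L2_norm_on M f)\<^sup>2 - (\<Sum>n\<in>I. (coefficient f n)\<^sup>2) + (\<Sum>n\<in>I. (c n - coefficient f n)\<^sup>2)"
proof -
  define p where "p x = (\<Sum>n\<in>I. c n * \<phi> n x)" for x
  have sp: "square_integrable M p" unfolding p_def[abs_def] by (rule square_integrable_combination)
  have "(LINT x|M. f x * p x) = (LINT x|M. (\<Sum>n\<in>I. c n * (f x * \<phi> n x)))"
    by (simp add: p_def sum_distrib_left mult_ac)
  also have "\<dots> = (\<Sum>n\<in>I. c n * coefficient f n)"
    unfolding coefficient_def
    by (subst Bochner_Integration.integral_sum)
       (auto intro!: integrable_mult_right square_integrable_mult_integrable square_integrable_family f)
  finally have fp: "(LINT x|M. f x * p x) = (\<Sum>n\<in>I. c n * coefficient f n)" .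
  have "(L2_norm_on M (\<lambda>x. f x - p x))\<^sup>2 = (LINT x|M. (f x)\<^sup>2 - 2 * (f x * p x) + (p x)\<^sup>2)"
    unfolding L2_norm_on_squared by (simp add: power2_diff algebra_simps)
  also have "\<dots> = (L2_norm_on M f)\<^sup>2 - 2 * (LINT x|M. f x * p x) + (L2_norm_on M p)\<^sup>2"
    unfolding L2_norm_on_squared
    using f sp square_integrable_mult_integrable[OF f sp] by (simp add: square_integrable_def)
  also have "(L2_norm_on M p)\<^sup>2 = (\<Sum>n\<in>I. (c n)\<^sup>2)"
    unfolding p_def[abs_def] by (rule norm_squared_combination[OF I])
  also have "(L2_norm_on M f)\<^sup>2 - 2 * (LINT x|M. f x * p x) + (\<Sum>n\<in>I. (c n)\<^sup>2)
    = (L2_norm_on M f)\<^sup>2 - (\<Sum>n\<in>I. (coefficient f n)\<^sup>2) + (\<Sum>n\<in>I. (c n - coefficient f n)\<^sup>2)"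
    unfolding fp by (simp add: power2_diff sum.distrib sum_subtractf sum_distrib_left mult_ac)
  finally show ?thesis by (simp add: p_def)
qed

lemma norm_diff_partial_sum:
  assumes "square_integrable M f"
  shows "(L2_norm_on M (\<lambda>x. f x - partial_sum N f x))\<^sup>2 = (L2_norm_on M f)\<^sup>2 - (\<Sum>n<N. (coefficient f n)\<^sup>2)"
  unfolding partial_sum_def using norm_diff_combination[OF assms, of "{..<N}" "coefficient f"] by simp

lemma bessel_inequality:
  assumes "square_integrable M f" "finite I"
  shows "(\<Sum>n\<in>I. (coefficient f n)\<^sup>2) \<le> (L2_norm_on M f)\<^sup>2"
  using norm_diff_combination[OF assms, of "coefficient f"]
    zero_le_power2[of "L2_norm_on M (\<lambda>x. f x - (\<Sum>n\<in>I. coefficient f n * \<phi> n x))"] by simp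

lemma coefficient_tendsto_0:
  assumes "square_integrable M f"
  shows "coefficient f \<longlonglongrightarrow> 0"
proof -
  have "summable (\<lambda>n. (coefficient f n)\<^sup>2)"
    by (rule summableI_nonneg_bounded[where x = "(L2_norm_on M f)\<^sup>2"]) (auto intro: bessel_inequality assms)
  then have "(\<lambda>n. (coefficient f n)\<^sup>2) \<longlonglongrightarrow> 0" by (rule summable_LIMSEQ_zero)
  then have "(\<lambda>n. sqrt ((coefficient f n)\<^sup>2)) \<longlonglongrightarrow> sqrt 0" by (rule tendsto_real_sqrt)
  then show ?thesis by (simp add: tendsto_rabs_zero_iff)
qed

text \<open>
  Membership in the closed linear span. The function itself is the limit, so the notion makes sense without
  passing to a quotient or a completion.
\<close>

definition in_span_closure :: "('a \<Rightarrow> real) \<Rightarrow> bool" where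
  "in_span_closure f \<longleftrightarrow> square_integrable M f \<and> (\<forall>\<epsilon>>0. \<exists>N c. L2_norm_on M (\<lambda>x. f x - (\<Sum>n<N. c n * \<phi> n x)) < \<epsilon>)"

lemma in_span_closure_square_integrable: "in_span_closure f \<Longrightarrow> square_integrable M f"
  by (simp add: in_span_closure_def)

lemma in_span_closure_partial_sum:
  assumes "in_span_closure f" "\<epsilon> > 0"
  shows "\<exists>N. \<forall>N'\<ge>N. L2_norm_on M (\<lambda>x. f x - partial_sum N' f x) < \<epsilon>"
proof -
  have f: "square_integrable M f" using assms by (simp add: in_span_closure_def)
  obtain N c where N: "L2_norm_on M (\<lambda>x. f x - (\<Sum>n<N. c n * \<phi> n x)) < \<epsilon>"
    using assms unfolding in_span_closure_def by blast
  have "L2_norm_on M (\<lambda>x. f x - partial_sum N' f x) < \<epsilon>" if "N' \<ge> N" for N'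
  proof -
    have "(\<Sum>n<N. (coefficient f n)\<^sup>2) \<le> (\<Sum>n<N'. (coefficient f n)\<^sup>2)"
      using that by (intro sum_mono2) auto
    moreover have "0 \<le> (\<Sum>n<N. (c n - coefficient f n)\<^sup>2)" by (intro sum_nonneg) auto
    ultimately have "(L2_norm_on M (\<lambda>x. f x - partial_sum N' f x))\<^sup>2 \<le> (L2_norm_on M (\<lambda>x. f x - (\<Sum>n<N. c n * \<phi> n x)))\<^sup>2"
      unfolding norm_diff_partial_sum[OF f] norm_diff_combination[OF f finite_lessThan] by simp
    then have "L2_norm_on M (\<lambda>x. f x - partial_sum N' f x) \<le> L2_norm_on M (\<lambda>x. f x - (\<Sum>n<N. c n * \<phi> n x))"
      by (rule power2_le_imp_le) simp
    with N show ?thesis by simp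
  qed
  then show ?thesis by blast
qed

text \<open>
  Parseval's identity for a single function already places it in the closed span; this is how the
  exponentials enter the span of the Laguerre functions.
\<close>

lemma parseval_imp_in_span_closure:
  assumes f: "square_integrable M f" and s: "(\<lambda>n. (coefficient f n)\<^sup>2) sums (L2_norm_on M f)\<^sup>2"
  shows "in_span_closure f"
  unfolding in_span_closure_def
proof (intro conjI allI impI f)
  fix \<epsilon> :: real assume "\<epsilon> > 0"
  have "(\<lambda>N. \<Sum>n<N. (coefficient f n)\<^sup>2) \<longlonglongrightarrow> (L2_norm_on M f)\<^sup>2" using s by (simp add: sums_def)
  then have "\<forall>\<^sub>F N in sequentially. (\<Sum>n<N. (coefficient f n)\<^sup>2) > (L2_norm_on M f)\<^sup>2 - \<epsilon>\<^sup>2"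
    using \<open>\<epsilon> > 0\<close> by (intro order_tendstoD) auto
  then obtain N where "(\<Sum>n<N. (coefficient f n)\<^sup>2) > (L2_norm_on M f)\<^sup>2 - \<epsilon>\<^sup>2"
    by (auto simp: eventually_sequentially)
  then have "(L2_norm_on M (\<lambda>x. f x - partial_sum N f x))\<^sup>2 < \<epsilon>\<^sup>2"
    unfolding norm_diff_partial_sum[OF f] by simp
  then have "L2_norm_on M (\<lambda>x. f x - partial_sum N f x) < \<epsilon>"
    by (rule power2_less_imp_less) (use \<open>\<epsilon> > 0\<close> in simp)
  then show "\<exists>N c. L2_norm_on M (\<lambda>x. f x - (\<Sum>n<N. c n * \<phi> n x)) < \<epsilon>"
    unfolding partial_sum_def by blast
qed

lemma in_span_closure_approx:
  assumes f: "square_integrable M f" and a: "\<And>\<epsilon>. \<epsilon> > 0 \<Longrightarrow> \<exists>g. in_span_closure g \<and> L2_norm_on M (\<lambda>x. f x - g x) < \<epsilon>"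
  shows "in_span_closure f"
  unfolding in_span_closure_def
proof (intro conjI allI impI f)
  fix \<epsilon> :: real assume "\<epsilon> > 0"
  then obtain g where g: "in_span_closure g" "L2_norm_on M (\<lambda>x. f x - g x) < \<epsilon> / 2" using a[of "\<epsilon>/2"] by auto
  then obtain N c where N: "L2_norm_on M (\<lambda>x. g x - (\<Sum>n<N. c n * \<phi> n x)) < \<epsilon> / 2"
    using \<open>\<epsilon> > 0\<close> unfolding in_span_closure_def by (meson half_gt_zero)
  have "L2_norm_on M (\<lambda>x. f x - (\<Sum>n<N. c n * \<phi> n x)) \<le> L2_norm_on M (\<lambda>x. f x - g x) + L2_norm_on M (\<lambda>x. g x - (\<Sum>n<N. c n * \<phi> n x))"
    by (intro L2_norm_on_triangle3 square_integrable_combination f in_span_closure_square_integrable[OF g(1)])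
  with g N have "L2_norm_on M (\<lambda>x. f x - (\<Sum>n<N. c n * \<phi> n x)) < \<epsilon>" by simp
  then show "\<exists>N c. L2_norm_on M (\<lambda>x. f x - (\<Sum>n<N. c n * \<phi> n x)) < \<epsilon>" by blast
qed

lemma in_span_closure_cmult:
  assumes f: "in_span_closure f"
  shows "in_span_closure (\<lambda>x. a * f x)"
  unfolding in_span_closure_def
proof (intro conjI allI impI square_integrable_cmult in_span_closure_square_integrable f)
  fix \<epsilon> :: real assume "\<epsilon> > 0"
  then have "\<epsilon> / (\<bar>a\<bar> + 1) > 0" by (intro divide_pos_pos) auto
  then obtain N c where N: "L2_norm_on M (\<lambda>x. f x - (\<Sum>n<N. c n * \<phi> n x)) < \<epsilon> / (\<bar>a\<bar> + 1)"
    using f unfolding in_span_closure_def by blast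
  have "L2_norm_on M (\<lambda>x. a * f x - (\<Sum>n<N. (a * c n) * \<phi> n x)) = L2_norm_on M (\<lambda>x. a * (f x - (\<Sum>n<N. c n * \<phi> n x)))"
    by (simp add: right_diff_distrib sum_distrib_left mult.assoc)
  also have "\<dots> = \<bar>a\<bar> * L2_norm_on M (\<lambda>x. f x - (\<Sum>n<N. c n * \<phi> n x))" by (rule L2_norm_on_cmult)
  also have "\<dots> \<le> (\<bar>a\<bar> + 1) * L2_norm_on M (\<lambda>x. f x - (\<Sum>n<N. c n * \<phi> n x))" by (intro mult_right_mono) auto
  also have "\<dots> < \<epsilon>" using N by (simp add: field_simps)
  finally have "L2_norm_on M (\<lambda>x. a * f x - (\<Sum>n<N. (a * c n) * \<phi> n x)) < \<epsilon>" .
  then show "\<exists>N c. L2_norm_on M (\<lambda>x. a * f x - (\<Sum>n<N. c n * \<phi> n x)) < \<epsilon>"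
    by (intro exI[of _ N] exI[of _ "\<lambda>n. a * c n"])
qed

lemma in_span_closure_add:
  assumes f: "in_span_closure f" and g: "in_span_closure g"
  shows "in_span_closure (\<lambda>x. f x + g x)"
  unfolding in_span_closure_def
proof (intro conjI allI impI square_integrable_add in_span_closure_square_integrable f g)
  fix \<epsilon> :: real assume "\<epsilon> > 0"
  then have e: "\<epsilon> / 2 > 0" by simp
  obtain N1 where N1: "\<forall>N'\<ge>N1. L2_norm_on M (\<lambda>x. f x - partial_sum N' f x) < \<epsilon> / 2"
    using in_span_closure_partial_sum[OF f e] by blast
  obtain N2 where N2: "\<forall>N'\<ge>N2. L2_norm_on M (\<lambda>x. g x - partial_sum N' g x) < \<epsilon> / 2"
    using in_span_closure_partial_sum[OF g e] by blast
  define N where "N = max N1 N2"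
  have "L2_norm_on M (\<lambda>x. f x + g x - (\<Sum>n<N. (coefficient f n + coefficient g n) * \<phi> n x))
    = L2_norm_on M (\<lambda>x. (f x - partial_sum N f x) + (g x - partial_sum N g x))"
    by (simp add: partial_sum_def distrib_right sum.distrib algebra_simps)
  also have "\<dots> \<le> L2_norm_on M (\<lambda>x. f x - partial_sum N f x) + L2_norm_on M (\<lambda>x. g x - partial_sum N g x)"
    by (intro L2_norm_on_triangle square_integrable_diff square_integrable_partial_sum in_span_closure_square_integrable f g)
  also have "\<dots> < \<epsilon>" using N1[rule_format, of N] N2[rule_format, of N] by (simp add: N_def)
  finally show "\<exists>N c. L2_norm_on M (\<lambda>x. f x + g x - (\<Sum>n<N. c n * \<phi> n x)) < \<epsilon>"
    by (intro exI[of _ N] exI[of _ "\<lambda>n. coefficient f n + coefficient g n"])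
qed

lemma in_span_closure_zero: "in_span_closure (\<lambda>x. 0)"
  unfolding in_span_closure_def
proof (intro conjI allI impI square_integrable_zero)
  fix \<epsilon> :: real assume "\<epsilon> > 0"
  then have "L2_norm_on M (\<lambda>x. 0 - (\<Sum>n<0. 0 * \<phi> n x)) < \<epsilon>" by (simp add: L2_norm_on_def)
  then show "\<exists>N c. L2_norm_on M (\<lambda>x. 0 - (\<Sum>n<N. c n * \<phi> n x)) < \<epsilon>"
    by (intro exI[of _ 0] exI[of _ "\<lambda>_. 0"])
qed

lemma in_span_closure_sum:
  assumes "\<And>i. i \<in> I \<Longrightarrow> in_span_closure (f i)"
  shows "in_span_closure (\<lambda>x. \<Sum>i\<in>I. f i x)"
  using assms
proof (induction I rule: infinite_finite_induct)
  case (insert i I)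
  have "in_span_closure (\<lambda>x. f i x + (\<Sum>i\<in>I. f i x))"
    by (rule in_span_closure_add) (use insert in simp_all)
  then show ?case using insert.hyps by simp
qed (simp_all add: in_span_closure_zero)

lemma in_span_closure_AE_limit:
  assumes f: "square_integrable M f" and g: "\<And>k. in_span_closure (g k)"
    and lim: "AE x in M. (\<lambda>k. g k x) \<longlonglongrightarrow> f x"
    and dom: "square_integrable M h" "\<And>k. AE x in M. \<bar>g k x\<bar> \<le> h x"
  shows "in_span_closure f"
proof (rule in_span_closure_approx[OF f])
  fix \<epsilon> :: real assume e: "\<epsilon> > 0"
  have sg: "square_integrable M (g k)" for k using g by (rule in_span_closure_square_integrable)
  have "(\<lambda>k. LINT x|M. (f x - g k x)\<^sup>2) \<longlonglongrightarrow> (LINT x|M. 0)"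
  proof (rule integral_dominated_convergence)
    show "AE x in M. (\<lambda>k. (f x - g k x)\<^sup>2) \<longlonglongrightarrow> 0"
      using lim by eventually_elim (auto intro!: tendsto_eq_intros)
    show "integrable M (\<lambda>x. 2 * (f x)\<^sup>2 + 2 * (h x)\<^sup>2)" using f dom by (auto simp: square_integrable_def)
    show "AE x in M. norm ((f x - g k x)\<^sup>2) \<le> 2 * (f x)\<^sup>2 + 2 * (h x)\<^sup>2" for k
      using dom(2)[of k]
    proof eventually_elim
      case (elim x)
      have "(f x - g k x)\<^sup>2 \<le> 2 * (f x)\<^sup>2 + 2 * (g k x)\<^sup>2"
        using zero_le_power2[of "f x + g k x"] by (simp add: power2_sum power2_diff)
      also have "(g k x)\<^sup>2 \<le> (h x)\<^sup>2" using elim by (simp add: abs_le_square_iff[symmetric])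
      finally show ?case by simp
    qed
    show "(\<lambda>x. (f x - g k x)\<^sup>2) \<in> borel_measurable M" for k
      using f sg[of k] by (auto simp: square_integrable_def)
  qed simp
  then have "\<forall>\<^sub>F k in sequentially. (LINT x|M. (f x - g k x)\<^sup>2) < \<epsilon>\<^sup>2"
    using e by (intro order_tendstoD) auto
  then obtain k where "(LINT x|M. (f x - g k x)\<^sup>2) < \<epsilon>\<^sup>2" by (auto simp: eventually_sequentially)
  then have "(L2_norm_on M (\<lambda>x. f x - g k x))\<^sup>2 < \<epsilon>\<^sup>2" by (simp add: L2_norm_on_squared)
  then have "L2_norm_on M (\<lambda>x. f x - g k x) < \<epsilon>" by (rule power2_less_imp_less) (use e in simp)
  then show "\<exists>g. in_span_closure g \<and> L2_norm_on M (\<lambda>x. f x - g x) < \<epsilon>" using g by blast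
qed

end

section \<open>The angular measure\<close>

text \<open>
  The substitution $t=\sin^2\theta$ in Euler's Beta integral.
\<close>

lemma nn_integral_sin_cos_powr:
  fixes a b :: real
  assumes "a > 0" "b > 0"
  shows "(\<integral>\<^sup>+\<theta>. ennreal (indicator {0<..<pi/2} \<theta> * (sin \<theta> powr (2 * a - 1) * cos \<theta> powr (2 * b - 1))) \<partial>lborel)
    = ennreal (Beta a b / 2)"
proof -
  have "ennreal (Beta a b) = nn_integral lborel (\<lambda>t. ennreal (t powr (a - 1) * (1 - t) powr (b - 1)) * indicator {(sin 0)^2..(sin (pi/2))^2} t)"
    using nn_integral_has_integral_lebesgue[OF _ has_integral_Beta_real[OF assms]]
    by (simp add: mult_ac ennreal_mult' ennreal_indicator)
  also have "\<dots> = (\<integral>\<^sup>+\<theta>. ennreal ((sin \<theta>)\<^sup>2 powr (a - 1) * (1 - (sin \<theta>)\<^sup>2) powr (b - 1) * (2 * sin \<theta> * cos \<theta>) * indicator {0..pi/2} \<theta>) \<partial>lborel)"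
    by (subst nn_integral_substitution[where g = "\<lambda>x. (sin x) ^ 2" and g' = "\<lambda>x. 2 * sin x * cos x" and a = 0 and b = "pi/2", symmetric])
       (auto intro!: derivative_eq_intros continuous_intros mult_nonneg_nonneg sin_ge_zero cos_ge_zero simp: set_borel_measurable_def  ennreal_mult' ennreal_indicator)
  also have "\<dots> = (\<integral>\<^sup>+\<theta>. 2 * ennreal (indicator {0<..<pi/2} \<theta> * (sin \<theta> powr (2 * a - 1) * cos \<theta> powr (2 * b - 1))) \<partial>lborel)"
  proof (intro nn_integral_cong)
    fix \<theta> :: real
    consider "\<theta> \<notin> {0..pi/2}" | "\<theta> = 0" | "\<theta> = pi/2" | "\<theta> \<in> {0<..<pi/2}" by force
    then show "ennreal ((sin \<theta>)\<^sup>2 powr (a - 1) * (1 - (sin \<theta>)\<^sup>2) powr (b - 1) * (2 * sin \<theta> * cos \<theta>) * indicator {0..pi/2} \<theta>)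
      = 2 * ennreal (indicator {0<..<pi/2} \<theta> * (sin \<theta> powr (2 * a - 1) * cos \<theta> powr (2 * b - 1)))"
    proof cases
      case 3
      then have "cos \<theta> = 0" by (simp only: cos_pi_half)
      then have c2: "(2 * sin \<theta> * cos \<theta>) = 0" by simp
      show ?thesis by (simp only: c2 mult_zero_right mult_zero_left ennreal_0) (simp add: 3)
    next
      case 4
      then have p: "sin \<theta> > 0" "cos \<theta> > 0" by (auto intro!: sin_gt_zero cos_gt_zero)
      have 1: "(sin \<theta>)\<^sup>2 powr (a - 1) * sin \<theta> = sin \<theta> powr (2 * a - 1)"
      proof -
        have "(sin \<theta>)\<^sup>2 powr (a - 1) * sin \<theta> = (sin \<theta> powr 2) powr (a - 1) * sin \<theta> powr 1"
          using p by simp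
        also have "\<dots> = sin \<theta> powr (2 * (a - 1) + 1)"
          unfolding powr_powr powr_add ..
        finally show ?thesis by (simp add: algebra_simps)
      qed
      have 2: "(1 - (sin \<theta>)\<^sup>2) powr (b - 1) * cos \<theta> = cos \<theta> powr (2 * b - 1)"
      proof -
        have "(1 - (sin \<theta>)\<^sup>2) powr (b - 1) * cos \<theta> = (cos \<theta> powr 2) powr (b - 1) * cos \<theta> powr 1"
          using p by (simp add: cos_squared_eq)
        also have "\<dots> = cos \<theta> powr (2 * (b - 1) + 1)"
          unfolding powr_powr powr_add ..
        finally show ?thesis by (simp add: algebra_simps)
      qed
      have "(sin \<theta>)\<^sup>2 powr (a - 1) * (1 - (sin \<theta>)\<^sup>2) powr (b - 1) * (2 * sin \<theta> * cos \<theta>)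
        = 2 * (((sin \<theta>)\<^sup>2 powr (a - 1) * sin \<theta>) * ((1 - (sin \<theta>)\<^sup>2) powr (b - 1) * cos \<theta>))"
        by (simp only: mult_ac)
      then have "(sin \<theta>)\<^sup>2 powr (a - 1) * (1 - (sin \<theta>)\<^sup>2) powr (b - 1) * (2 * sin \<theta> * cos \<theta>)
        = 2 * (sin \<theta> powr (2 * a - 1) * cos \<theta> powr (2 * b - 1))"
        unfolding 1 2 .
      then show ?thesis using 4 by (simp only: mult.assoc) (simp add: ennreal_mult'[symmetric] numeral_mult_ennreal mult.assoc)
    qed auto
  qed
  also have "\<dots> = 2 * (\<integral>\<^sup>+\<theta>. ennreal (indicator {0<..<pi/2} \<theta> * (sin \<theta> powr (2 * a - 1) * cos \<theta> powr (2 * b - 1))) \<partial>lborel)"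
    by (rule nn_integral_cmult) auto
  finally have *: "ennreal (Beta a b) = 2 * (\<integral>\<^sup>+\<theta>. ennreal (indicator {0<..<pi/2} \<theta> * (sin \<theta> powr (2 * a - 1) * cos \<theta> powr (2 * b - 1))) \<partial>lborel)"
    (is "_ = 2 * ?I") .
  have "ennreal (Beta a b / 2) = ennreal (1/2) * ennreal (Beta a b)"
    by (subst ennreal_mult'[symmetric]) auto
  also have "\<dots> = ennreal (1/2) * ennreal 2 * ?I" unfolding * by (simp add: mult.assoc)
  also have "ennreal (1/2) * ennreal 2 = 1" by (subst ennreal_mult[symmetric]) auto
  finally show ?thesis by simp
qed

text \<open>
  The range of parameters for which the angular weight $\sin^{2\alpha}\theta$ is integrable.
\<close>

locale laguerre_parameter =
  fixes \<alpha> :: real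
  assumes \<alpha>': "\<alpha> > - 1/2"
begin

text \<open>
  The constant $c_\alpha$, which makes the angular weight a probability density.
\<close>

definition norm_const :: real where
  "norm_const = Gamma (\<alpha> + 1) / (Gamma (\<alpha> + 1 / 2) * Gamma (1 / 2))"

abbreviation J :: "real \<Rightarrow> real" where
  "J \<equiv> entire_bessel (\<alpha> - 1/2)"

definition angular_measure :: "real measure"  (\<open>\<sigma>\<close>) where
  "\<sigma> = density lborel (\<lambda>\<theta>. ennreal (indicator {0<..<pi} \<theta> *
     (norm_const * sin \<theta> powr (2 * \<alpha>))))"

lemma sets_angular_measure [measurable_cong, simp]: "sets \<sigma> = sets borel"
  by (simp add: angular_measure_def)

lemma space_angular_measure [simp]: "space \<sigma> = UNIV"
  by (simp add: angular_measure_def)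

lemma norm_const_pos: "norm_const > 0"
  unfolding norm_const_def using \<alpha>' by (intro divide_pos_pos mult_pos_pos Gamma_real_pos) auto

lemma nn_integral_angular_monomial:
  "(\<integral>\<^sup>+\<theta>. ennreal (cos \<theta> ^ (2 * m) * sin \<theta> ^ (2 * l)) \<partial>\<sigma>)
    = ennreal (pochhammer (1/2) m * pochhammer (\<alpha> + 1/2) l / pochhammer (\<alpha> + 1) (m + l))"
proof -
  define a where "a = \<alpha> + 1/2 + real l"
  define b where "b = 1/2 + real m"
  have c: "norm_const > 0" by (rule norm_const_pos)
  have ab: "a > 0" "b > 0" using \<alpha>' by (auto simp: a_def b_def)
  define h where "h \<theta> = sin \<theta> powr (2 * \<alpha>) * (cos \<theta> ^ (2 * m) * sin \<theta> ^ (2 * l))" for \<theta> :: real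
  have h0: "0 \<le> h \<theta>" for \<theta> unfolding h_def by (intro mult_nonneg_nonneg) auto
  have [measurable]: "h \<in> borel_measurable borel" unfolding h_def by measurable
  have half: "(\<integral>\<^sup>+\<theta>. ennreal (indicator {0<..<pi/2} \<theta> * h \<theta>) \<partial>lborel) = ennreal (Beta a b / 2)"
    unfolding nn_integral_sin_cos_powr[OF ab, symmetric]
  proof (intro nn_integral_cong)
    fix \<theta> :: real
    show "ennreal (indicator {0<..<pi/2} \<theta> * h \<theta>) = ennreal (indicator {0<..<pi/2} \<theta> * (sin \<theta> powr (2 * a - 1) * cos \<theta> powr (2 * b - 1)))"
    proof (cases "\<theta> \<in> {0<..<pi/2}")
      case True
      then have p: "sin \<theta> > 0" "cos \<theta> > 0" by (auto intro!: sin_gt_zero cos_gt_zero)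
      have "sin \<theta> powr (2 * a - 1) = sin \<theta> powr (2 * \<alpha> + real (2 * l))"
        by (simp add: a_def algebra_simps)
      also have "\<dots> = sin \<theta> powr (2 * \<alpha>) * sin \<theta> ^ (2 * l)"
        using p by (simp only: powr_add powr_realpow)
      finally have 1: "sin \<theta> powr (2 * a - 1) = \<dots>" .
      have "cos \<theta> powr (2 * b - 1) = cos \<theta> powr (real (2 * m))"
        by (simp add: b_def algebra_simps)
      also have "\<dots> = cos \<theta> ^ (2 * m)" using p by (simp only: powr_realpow)
      finally have 2: "cos \<theta> powr (2 * b - 1) = \<dots>" .
      show ?thesis unfolding 1 2 h_def by (simp add: mult_ac)
    qed auto
  qed
  have "(\<integral>\<^sup>+\<theta>. ennreal (indicator {pi/2<..<pi} \<theta> * h \<theta>) \<partial>lborel)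
     = (\<integral>\<^sup>+\<theta>. ennreal (indicator {0<..<pi/2} \<theta> * h \<theta>) \<partial>lborel)"
    by (subst nn_integral_real_affine[of _ "-1" pi])
       (auto intro!: nn_integral_cong simp: indicator_def h_def power_mult)
  note half' = this[unfolded half]
  have "(\<integral>\<^sup>+\<theta>. ennreal (indicator {0<..<pi} \<theta> * h \<theta>) \<partial>lborel)
    = (\<integral>\<^sup>+\<theta>. ennreal (indicator {0<..<pi/2} \<theta> * h \<theta>) + ennreal (indicator {pi/2<..<pi} \<theta> * h \<theta>) \<partial>lborel)"
    by (intro nn_integral_cong_AE AE_I[of _ _ "{pi/2}"]) (auto simp: indicator_def split: if_splits)
  also have "\<dots> = ennreal (Beta a b / 2) + ennreal (Beta a b / 2)"
    by (subst nn_integral_add) (auto simp: half half')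
  also have "\<dots> = ennreal (Beta a b)"
    using ab by (subst ennreal_plus[symmetric]) (auto simp: Beta_def intro!: divide_nonneg_nonneg mult_nonneg_nonneg Gamma_real_nonneg)
  finally have full: "(\<integral>\<^sup>+\<theta>. ennreal (indicator {0<..<pi} \<theta> * h \<theta>) \<partial>lborel) = ennreal (Beta a b)" .
  have "(\<integral>\<^sup>+\<theta>. ennreal (cos \<theta> ^ (2 * m) * sin \<theta> ^ (2 * l)) \<partial>\<sigma>)
     = (\<integral>\<^sup>+\<theta>. ennreal norm_const * ennreal (indicator {0<..<pi} \<theta> * h \<theta>) \<partial>lborel)"
    unfolding angular_measure_def using c
    by (subst nn_integral_density)
       (auto intro!: nn_integral_cong simp: ennreal_mult[symmetric] h_def mult_ac power_mult split: split_indicator)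
  also have "\<dots> = ennreal (norm_const * Beta a b)"
    using c by (subst nn_integral_cmult) (auto simp: full ennreal_mult'[symmetric])
  also have "norm_const * Beta a b = pochhammer (1/2) m * pochhammer (\<alpha> + 1/2) l / pochhammer (\<alpha> + 1) (m + l)"
  proof -
    have n: "(1/2::real) \<notin> \<int>\<^sub>\<le>\<^sub>0" "\<alpha> + 1/2 \<notin> \<int>\<^sub>\<le>\<^sub>0" "\<alpha> + 1 \<notin> \<int>\<^sub>\<le>\<^sub>0"
      using \<alpha>' by (auto dest: nonpos_Ints_nonpos)
    have p: "Gamma (1/2::real) > 0" "Gamma (\<alpha> + 1/2) > 0" "Gamma (\<alpha> + 1) > 0" "Gamma (\<alpha> + 1 + real (m + l)) > 0"
      using \<alpha>' by (auto intro!: Gamma_real_pos)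
    have e: "a + b = \<alpha> + 1 + real (m + l)" by (simp add: a_def b_def)
    show ?thesis
      unfolding Beta_def e unfolding pochhammer_Gamma[OF n(1)] pochhammer_Gamma[OF n(2)] pochhammer_Gamma[OF n(3)] a_def b_def norm_const_def
      using p by (simp add: field_simps)
  qed
  finally show ?thesis .
qed

lemma emeasure_angular_UNIV: "emeasure \<sigma> UNIV = 1"
  using nn_integral_angular_monomial[of 0 0] by simp

sublocale ang: finite_measure \<sigma>
  by (rule finite_measureI) (simp add: emeasure_angular_UNIV)

lemma measure_angular_UNIV: "measure \<sigma> UNIV = 1"
  by (simp add: measure_def emeasure_angular_UNIV)

lemma integrable_angular_bounded:
  fixes f :: "real \<Rightarrow> real"
  assumes "f \<in> borel_measurable borel" "\<And>\<theta>. \<bar>f \<theta>\<bar> \<le> C"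
  shows "integrable \<sigma> f"
proof -
  show ?thesis by (rule ang.integrable_const_bound[of _ C]) (use assms in auto)
qed

lemma integrable_angular_continuous:
  fixes f :: "real \<Rightarrow> real"
  assumes "continuous_on UNIV f"
  shows "integrable \<sigma> f"
proof -
  have "compact (f ` {0..pi})" using assms
    by (intro compact_continuous_image continuous_on_subset[OF assms]) auto
  then obtain C where C: "\<And>\<theta>. \<theta> \<in> {0..pi} \<Longrightarrow> \<bar>f \<theta>\<bar> \<le> C"
    using compact_imp_bounded[of "f ` {0..pi}"] unfolding bounded_iff by fastforce
  have [measurable]: "f \<in> borel_measurable borel"
    using assms by (rule borel_measurable_continuous_onI)
  have "AE \<theta> in \<sigma>. norm (f \<theta>) \<le> C"
    unfolding angular_measure_def
    by (subst AE_density) (auto intro!: AE_I2 C simp: indicator_def)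
  then show ?thesis by (rule ang.integrable_const_bound) measurable
qed

text \<open>
  Dominated convergence for series, in the form in which it is applied to power series.
\<close>

lemma sums_integral_angular:
  fixes f :: "nat \<Rightarrow> real \<Rightarrow> real"
  assumes m: "\<And>k. f k \<in> borel_measurable borel" and fC: "\<And>k \<theta>. \<bar>f k \<theta>\<bar> \<le> C k" and C: "summable C"
    and s: "\<And>\<theta>. (\<lambda>k. f k \<theta>) sums F \<theta>"
  shows "(\<lambda>k. LINT \<theta>|\<sigma>. f k \<theta>) sums (LINT \<theta>|\<sigma>. F \<theta>)"
proof -
  have fi: "integrable \<sigma> (f k)" for k
    by (rule integrable_angular_bounded[OF m fC])
  have "(\<lambda>k. LINT \<theta>|\<sigma>. f k \<theta>) sums (LINT \<theta>|\<sigma>. (\<Sum>k. f k \<theta>))"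
  proof (rule sums_integral[OF fi])
    show "AE \<theta> in \<sigma>. summable (\<lambda>k. norm (f k \<theta>))"
      using fC by (intro AE_I2 summable_comparison_test'[OF C]) auto
    show "summable (\<lambda>k. LINT \<theta>|\<sigma>. norm (f k \<theta>))"
    proof (rule summable_comparison_test'[OF C])
      fix k :: nat
      have "(LINT \<theta>|\<sigma>. norm (f k \<theta>)) \<le> (LINT \<theta>|\<sigma>. C k)"
        using fC by (intro integral_mono integrable_norm fi) auto
      then show "norm (LINT \<theta>|\<sigma>. norm (f k \<theta>)) \<le> C k"
        using measure_angular_UNIV by (simp add: abs_of_nonneg Bochner_Integration.integral_nonneg)
    qed
  qed
  also have "(\<lambda>\<theta>. \<Sum>k. f k \<theta>) = F" using s by (simp add: sums_iff fun_eq_iff)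
  finally show ?thesis .
qed

lemma integral_angular_monomial:
  "(LINT \<theta>|\<sigma>. cos \<theta> ^ (2 * m) * sin \<theta> ^ (2 * l))
    = pochhammer (1/2) m * pochhammer (\<alpha> + 1/2) l / pochhammer (\<alpha> + 1) (m + l)"
proof -
  have "0 \<le> pochhammer (1/2) m * pochhammer (\<alpha> + 1/2) l / pochhammer (\<alpha> + 1) (m + l)"
    using \<alpha>' by (intro divide_nonneg_nonneg mult_nonneg_nonneg less_imp_le[OF pochhammer_pos]) auto
  then show ?thesis
    by (subst integral_eq_nn_integral)
       (simp_all add: nn_integral_angular_monomial)
qed

lemma integral_angular_reflect:
  fixes f :: "real \<Rightarrow> real"
  assumes [measurable]: "f \<in> borel_measurable borel"
  shows "(LINT \<theta>|\<sigma>. f (pi - \<theta>)) = (LINT \<theta>|\<sigma>. f \<theta>)"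
proof -
  have c: "norm_const > 0" by (rule norm_const_pos)
  have "(LINT \<theta>|\<sigma>. f \<theta>) = (LINT \<theta>|lborel. (indicator {0<..<pi} \<theta> * (norm_const * sin \<theta> powr (2 * \<alpha>))) * f \<theta>)"
    unfolding angular_measure_def using c
    by (subst integral_density) (auto simp: intro!: AE_I2 mult_nonneg_nonneg)
  also have "\<dots> = (LINT \<theta>|lborel. (indicator {0<..<pi} \<theta> * (norm_const * sin \<theta> powr (2 * \<alpha>))) * f (pi - \<theta>))"
    by (subst lborel_integral_real_affine[of "-1" _ pi])
       (auto intro!: Bochner_Integration.integral_cong simp: indicator_def)
  also have "\<dots> = (LINT \<theta>|\<sigma>. f (pi - \<theta>))"
    unfolding angular_measure_def using c
    by (subst integral_density) (auto simp: intro!: AE_I2 mult_nonneg_nonneg)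
  finally show ?thesis ..
qed

text \<open>
  An integral of Sonine type. Both factors are expanded, the Cauchy product is integrated term by term,
  and the binomial theorem sums the resulting Beta integrals. What matters later is that the result depends
  only on $A^2-B^2$.
\<close>

lemma integral_angular_exp_bessel:
  "(LINT \<theta>|\<sigma>. exp (- (A * cos \<theta>)) * J (B * sin \<theta>))
     = bessel_series (\<alpha> + 1) ((A\<^sup>2 - B\<^sup>2) / 4)"
proof -
  have J: "J z = bessel_series (\<alpha> + 1/2) (- (z\<^sup>2) / 4)" for z
    using entire_bessel_conv_series[of "\<alpha> - 1/2" z] \<alpha>' by (simp add: add.commute)
  have cJ: "continuous_on A J" for A
    using \<alpha>' by (intro continuous_on_entire_bessel) auto
  have cJ': "continuous_on UNIV (\<lambda>\<theta>. J (B * sin \<theta>))"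
    by (rule continuous_on_compose2[OF cJ]) (auto intro!: continuous_intros)
  note [measurable] = borel_measurable_continuous_onI[OF cJ']
  define I where "I = (LINT \<theta>|\<sigma>. exp (- (A * cos \<theta>)) * J (B * sin \<theta>))"
  have I': "I = (LINT \<theta>|\<sigma>. exp (A * cos \<theta>) * J (B * sin \<theta>))"
    unfolding I_def by (subst integral_angular_reflect[symmetric]) auto
  \<comment> \<open>Averaging with the reflected integral replaces the exponential by cosh.\<close>
  have "2 * I = (LINT \<theta>|\<sigma>. exp (- (A * cos \<theta>)) * J (B * sin \<theta>) + exp (A * cos \<theta>) * J (B * sin \<theta>))"
    unfolding mult_2 apply (subst (2) I', unfold I_def)
    by (intro Bochner_Integration.integral_add[symmetric] integrable_angular_continuous continuous_intros cJ')
  also have "\<dots> = (LINT \<theta>|\<sigma>. 2 * (cosh (A * cos \<theta>) * J (B * sin \<theta>)))"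
    by (simp add: cosh_def algebra_simps)
  finally have I2: "I = (LINT \<theta>|\<sigma>. cosh (A * cos \<theta>) * J (B * sin \<theta>))"
    by simp
  define p where "p w k = w ^ k / (fact k * pochhammer (1/2::real) k)" for w :: real and k
  define q where "q w k = w ^ k / (fact k * pochhammer (\<alpha> + 1/2) k)" for w :: real and k
  have pq_summable: "summable (\<lambda>k. norm (p w k))" "summable (\<lambda>k. norm (q w k))" for w
    unfolding p_def q_def using \<alpha>' by (auto intro!: bessel_series_norm_summable simp del: norm_divide real_norm_def)
  define f where "f k \<theta> = (\<Sum>i\<le>k. p ((A * cos \<theta>)\<^sup>2 / 4) i * q (- ((B * sin \<theta>)\<^sup>2) / 4) (k - i))" for k \<theta>
  have fs: "(\<lambda>k. f k \<theta>) sums (cosh (A * cos \<theta>) * J (B * sin \<theta>))" for \<theta>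
    using Cauchy_product_sums[OF pq_summable(1)[of "(A * cos \<theta>)\<^sup>2 / 4"] pq_summable(2)[of "- ((B * sin \<theta>)\<^sup>2) / 4"]]
    unfolding f_def cosh_eq_bessel_series J by (simp add: bessel_series_def p_def q_def)
  \<comment> \<open>The Cauchy product with both trigonometric factors replaced by 1 dominates uniformly in the angle.\<close>
  define C where "C k = (\<Sum>i\<le>k. norm (p (A\<^sup>2 / 4) i) * norm (q (B\<^sup>2 / 4) (k - i)))" for k
  have Cs: "summable C"
    unfolding C_def
    using Cauchy_product_sums[of "\<lambda>i. norm (p (A\<^sup>2 / 4) i)" "\<lambda>i. norm (q (B\<^sup>2 / 4) i)"] pq_summable
    by (auto simp: sums_iff)
  have fC: "\<bar>f k \<theta>\<bar> \<le> C k" for k \<theta>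
  proof -
    have pp: "\<bar>p w i\<bar> \<le> norm (p w' i)" if "\<bar>w\<bar> \<le> \<bar>w'\<bar>" for w w' i
      using that unfolding p_def by (auto simp: abs_mult power_abs intro!: divide_right_mono power_mono)
    have qq: "\<bar>q w i\<bar> \<le> norm (q w' i)" if "\<bar>w\<bar> \<le> \<bar>w'\<bar>" for w w' i
      using that unfolding q_def by (auto simp: abs_mult power_abs intro!: divide_right_mono power_mono)
    have "\<bar>p ((A * cos \<theta>)\<^sup>2 / 4) i * q (- ((B * sin \<theta>)\<^sup>2) / 4) (k - i)\<bar>
        \<le> norm (p (A\<^sup>2 / 4) i) * norm (q (B\<^sup>2 / 4) (k - i))" for i
      unfolding abs_mult
      by (intro mult_mono pp qq)
         (auto simp: abs_mult power_mult_distrib intro!: mult_left_le simp: abs_square_le_1)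
    then show ?thesis unfolding f_def C_def
      by (intro order_trans[OF sum_abs sum_mono])
  qed
  have pn: "pochhammer (1/2::real) i \<noteq> 0" "pochhammer (\<alpha> + 1/2) i \<noteq> 0" for i
    using pochhammer_pos[of "1/2::real" i] pochhammer_pos[of "\<alpha> + 1/2" i] \<alpha>' by auto
  have fcont: "continuous_on UNIV (f k)" for k
    unfolding f_def p_def q_def by (auto intro!: continuous_intros simp: pn)
  have S: "(\<lambda>k. integral\<^sup>L \<sigma> (f k)) sums I"
    unfolding I2 by (rule sums_integral_angular[OF borel_measurable_continuous_onI[OF fcont] fC Cs fs])
  have "integral\<^sup>L \<sigma> (f k) = ((A\<^sup>2 - B\<^sup>2) / 4) ^ k / (fact k * pochhammer (\<alpha> + 1) k)" for k
  proof -
    have t: "p ((A * cos \<theta>)\<^sup>2 / 4) i * q (- ((B * sin \<theta>)\<^sup>2) / 4) j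
       = p (A\<^sup>2 / 4) i * q (- (B\<^sup>2) / 4) j * (cos \<theta> ^ (2 * i) * sin \<theta> ^ (2 * j))" for i j \<theta>
    proof -
      have "(A * cos \<theta>)\<^sup>2 / 4 = A\<^sup>2 / 4 * (cos \<theta>)\<^sup>2" "- ((B * sin \<theta>)\<^sup>2) / 4 = - (B\<^sup>2) / 4 * (sin \<theta>)\<^sup>2"
        by (simp_all add: power_mult_distrib)
      then have "((A * cos \<theta>)\<^sup>2 / 4) ^ i = (A\<^sup>2 / 4) ^ i * cos \<theta> ^ (2 * i)"
        "(- ((B * sin \<theta>)\<^sup>2) / 4) ^ j = (- (B\<^sup>2) / 4) ^ j * sin \<theta> ^ (2 * j)"
        by (simp_all only: power_mult_distrib power_mult)
      then show ?thesis unfolding p_def q_def by (simp only: mult_ac times_divide_eq_left times_divide_eq_right)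
    qed
    have "integral\<^sup>L \<sigma> (f k)
      = (\<Sum>i\<le>k. p (A\<^sup>2 / 4) i * q (- (B\<^sup>2) / 4) (k - i) * (LINT \<theta>|\<sigma>. cos \<theta> ^ (2 * i) * sin \<theta> ^ (2 * (k - i))))"
      unfolding f_def t
      by (subst Bochner_Integration.integral_sum)
         (auto intro!: integrable_angular_continuous continuous_intros)
    also have "\<dots> = (\<Sum>i\<le>k. of_nat (k choose i) * (A\<^sup>2 / 4) ^ i * (- (B\<^sup>2) / 4) ^ (k - i) / (fact k * pochhammer (\<alpha> + 1) k))"
    proof (intro sum.cong refl)
      fix i assume "i \<in> {..k}"
      then have i: "i \<le> k" by auto
      have pp: "pochhammer (1/2::real) i > 0" "pochhammer (\<alpha> + 1/2) (k - i) > 0" "pochhammer (\<alpha> + 1) k > 0"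
        using \<alpha>' by (auto intro!: pochhammer_pos)
      show "p (A\<^sup>2 / 4) i * q (- (B\<^sup>2) / 4) (k - i) * (LINT \<theta>|\<sigma>. cos \<theta> ^ (2 * i) * sin \<theta> ^ (2 * (k - i)))
        = of_nat (k choose i) * (A\<^sup>2 / 4) ^ i * (- (B\<^sup>2) / 4) ^ (k - i) / (fact k * pochhammer (\<alpha> + 1) k)"
        unfolding integral_angular_monomial p_def q_def binomial_fact[OF i]
        using pp i by (simp add: field_simps)
    qed
    also have "\<dots> = (A\<^sup>2 / 4 + - (B\<^sup>2) / 4) ^ k / (fact k * pochhammer (\<alpha> + 1) k)"
      unfolding binomial_ring sum_divide_distrib ..
    finally show ?thesis by (simp add: diff_divide_distrib)
  qed
  then have "I = bessel_series (\<alpha> + 1) ((A\<^sup>2 - B\<^sup>2) / 4)"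
    using S bessel_series_sums[of "\<alpha> + 1" "(A\<^sup>2 - B\<^sup>2) / 4"] \<alpha>' sums_unique2 by auto
  then show ?thesis unfolding I_def .
qed

end

section \<open>Symmetry of the translation\<close>

text \<open>
  The argument at which the translation evaluates its function: the squared third side of a triangle
  with sides $\sqrt x$, $\sqrt t$ and angle $\pi-\theta$ between them.
\<close>

definition shift :: "real \<Rightarrow> real \<Rightarrow> real \<Rightarrow> real" where
  "shift t x \<theta> = x + t + 2 * sqrt (x * t) * cos \<theta>"

lemma shift_nonneg:
  assumes "x \<ge> 0" "t \<ge> 0" shows "shift t x \<theta> \<ge> 0"
proof -
  have c: "0 \<le> 1 + cos \<theta>" using cos_ge_minus_one[of \<theta>] by linarith
  have "0 \<le> (sqrt x - sqrt t)\<^sup>2 + 2 * sqrt (x * t) * (1 + cos \<theta>)"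
    using assms by (auto intro!: add_nonneg_nonneg[OF zero_le_power2] mult_nonneg_nonneg[OF _ c])
  also have "\<dots> = shift t x \<theta>"
    using assms by (simp add: shift_def power2_diff real_sqrt_mult algebra_simps)
  finally show ?thesis .
qed

lemma measurable_shift [measurable]:
  "(\<lambda>p. shift t (fst p) (snd p)) \<in> borel_measurable (borel \<Otimes>\<^sub>M borel)"
  unfolding shift_def by measurable

lemma measurable_shift2 [measurable]: "shift t x \<in> borel_measurable borel"
  unfolding shift_def by measurable

text \<open>
  Sixteen times the squared area of the triangle with sides $\sqrt x$, $\sqrt t$, $\sqrt y$ (Heron's
  formula), and therefore symmetric in all three variables.
\<close>

definition triangle_form :: "real \<Rightarrow> real \<Rightarrow> real \<Rightarrow> real" where
  "triangle_form t x y = 4 * x * t - (y - x - t)\<^sup>2"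

lemma triangle_form_commute: "triangle_form t x y = triangle_form t y x"
  by (simp add: triangle_form_def power2_eq_square algebra_simps)

lemma measurable_triangle_form [measurable]:
  "(\<lambda>p. triangle_form t (fst p) (snd p)) \<in> borel_measurable (borel \<Otimes>\<^sub>M borel)"
  "triangle_form t x \<in> borel_measurable borel"
  unfolding triangle_form_def by measurable

lemma triangle_form_shift:
  assumes "x \<ge> 0" "t \<ge> 0"
  shows "triangle_form t x (shift t x \<theta>) = (2 * sqrt (x * t) * sin \<theta>)\<^sup>2"
  using assms by (simp add: triangle_form_def shift_def power_mult_distrib sin_squared_eq algebra_simps)

lemma triangle_form_pos_imp_pos:
  assumes "triangle_form t x y > 0" "t > 0" shows "x > 0"
  using assms unfolding triangle_form_def
  by (smt (verit) mult_nonneg_nonpos2 mult_nonneg_nonpos zero_le_power2)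

context laguerre_parameter
begin

definition radial_measure :: "real measure"  (\<open>\<rho>\<close>) where
  "\<rho> = density lborel (\<lambda>x. ennreal (indicator {0<..} x * x powr \<alpha>))"

lemma sets_radial_measure [measurable_cong, simp]: "sets \<rho> = sets borel"
  by (simp add: radial_measure_def)

lemma space_radial_measure [simp]: "space \<rho> = UNIV"
  by (simp add: radial_measure_def)

sublocale rad: sigma_finite_measure \<rho>
  unfolding radial_measure_def
  by (subst sigma_finite_measure.sigma_finite_iff_density_finite[OF sigma_finite_lborel]) auto

sublocale pr: pair_sigma_finite \<rho> \<sigma> ..

text \<open>
  The density of \<open>shift t x \<theta>\<close> as $\theta$ is distributed by \<open>\<sigma>\<close>, multiplied by the weight
  $x^\alpha$. The weight cancels the only factor that is not symmetric in $x$ and $y$.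
\<close>

definition translation_kernel :: "real \<Rightarrow> real \<Rightarrow> real \<Rightarrow> real" where
  "translation_kernel t x y = (if triangle_form t x y > 0 then
     norm_const * (4 * t) powr (- \<alpha>) * triangle_form t x y powr (\<alpha> - 1/2) else 0)"

lemma translation_kernel_commute: "translation_kernel t x y = translation_kernel t y x"
  by (simp add: translation_kernel_def triangle_form_commute)

lemma translation_kernel_nonneg: "translation_kernel t x y \<ge> 0"
  using norm_const_pos by (auto simp: translation_kernel_def intro!: mult_nonneg_nonneg)

lemma measurable_translation_kernel [measurable]:
  "(\<lambda>p. translation_kernel t (fst p) (snd p)) \<in> borel_measurable (borel \<Otimes>\<^sub>M borel)"
  "translation_kernel t x \<in> borel_measurable borel"
  unfolding translation_kernel_def by measurable

text \<open>
  The substitution $y=x+t-2\sqrt{xt}\cos\theta$, with increasing right hand side on $[0,\pi]$; the sign of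
  the cosine is changed back by the reflection $\theta\mapsto\pi-\theta$.
\<close>

lemma nn_integral_shift:
  assumes x: "x > 0" and t: "t > 0"
    and G [measurable]: "G \<in> borel_measurable borel" and G0: "\<And>y. 0 \<le> (G y :: real)"
  shows "ennreal (x powr \<alpha>) * (\<integral>\<^sup>+\<theta>. ennreal (G (shift t x \<theta>)) \<partial>\<sigma>)
    = (\<integral>\<^sup>+y. ennreal (translation_kernel t x y * G y) \<partial>lborel)"
proof -
  have c: "norm_const > 0" by (rule norm_const_pos)
  define s where "s = sqrt (x * t)"
  have s: "s > 0" "s\<^sup>2 = x * t" using x t by (auto simp: s_def)
  define g where "g \<theta> = x + t - 2 * s * cos \<theta>" for \<theta>
  have hg: "triangle_form t x (g \<theta>) = (2 * s * sin \<theta>)\<^sup>2" for \<theta>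
    using s by (simp add: triangle_form_def g_def power_mult_distrib sin_squared_eq algebra_simps)
  define f where "f y = translation_kernel t x y * G y" for y
  have [measurable]: "f \<in> borel_measurable borel" unfolding f_def by measurable
  have f0: "f y \<ge> 0" for y unfolding f_def using translation_kernel_nonneg G0 by simp
  have "(\<integral>\<^sup>+y. ennreal (translation_kernel t x y * G y) \<partial>lborel)
     = (\<integral>\<^sup>+y. ennreal (f y) * indicator {g 0..g pi} y \<partial>lborel)"
  proof (intro nn_integral_cong)
    fix y
    have "y \<in> {g 0..g pi}" if "triangle_form t x y > 0"
    proof -
      have "(y - x - t)\<^sup>2 < (2 * s)\<^sup>2" using that s by (simp add: triangle_form_def)
      then have "abs (y - x - t) < 2 * s"
        using s power_less_imp_less_base[of "abs (y - x - t)" 2 "2 * s"] by simp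
      then show ?thesis by (auto simp: g_def)
    qed
    then show "ennreal (translation_kernel t x y * G y) = ennreal (f y) * indicator {g 0..g pi} y"
      by (auto simp: f_def translation_kernel_def indicator_def)
  qed
  also have "\<dots> = (\<integral>\<^sup>+y. ennreal (f y * indicator {g 0..g pi} y) \<partial>lborel)"
    by (intro nn_integral_cong) (auto simp: indicator_def)
  also have "\<dots> = (\<integral>\<^sup>+\<theta>. ennreal (f (g \<theta>) * (2 * s * sin \<theta>) * indicator {0..pi} \<theta>) \<partial>lborel)"
    using s by (intro nn_integral_substitution)
       (auto simp: g_def set_borel_measurable_def sin_ge_zero intro!: derivative_eq_intros continuous_intros mult_nonneg_nonneg)
  also have "\<dots> = (\<integral>\<^sup>+\<theta>. ennreal (x powr \<alpha> * (indicator {0<..<pi} \<theta> * (norm_const * sin \<theta> powr (2 * \<alpha>)) * G (g \<theta>))) \<partial>lborel)"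
  proof (intro nn_integral_cong)
    fix \<theta> :: real
    \<comment> \<open>At the end points the derivative of the substitution and the indicator vanish.\<close>
    consider "\<theta> \<notin> {0..pi}" | "\<theta> = 0 \<or> \<theta> = pi" | "\<theta> \<in> {0<..<pi}" by force
    then show "ennreal (f (g \<theta>) * (2 * s * sin \<theta>) * indicator {0..pi} \<theta>)
       = ennreal (x powr \<alpha> * (indicator {0<..<pi} \<theta> * (norm_const * sin \<theta> powr (2 * \<alpha>)) * G (g \<theta>)))"
    proof cases
      case 3
      then have sp: "sin \<theta> > 0" by (auto intro!: sin_gt_zero)
      \<comment> \<open>The derivative u of the substitution satisfies $u^2=D$, so the powers of D and u combine to $u^{2\alpha}$.\<close>
      define u where "u = 2 * s * sin \<theta>"
      have u: "u > 0" using sp s by (simp add: u_def)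
      have "u\<^sup>2 powr (\<alpha> - 1/2) * u = (u powr 2) powr (\<alpha> - 1/2) * u powr 1"
        using u by simp
      also have "\<dots> = u powr (2 * \<alpha>)" unfolding powr_powr powr_add[symmetric] by (simp add: algebra_simps)
      also have "\<dots> = ((2 * s) powr 2) powr \<alpha> * sin \<theta> powr (2 * \<alpha>)"
        unfolding u_def using s sp by (subst powr_mult) (auto simp: powr_powr simp del: powr_numeral)
      also have "(2 * s) powr 2 = (4 * t) * x"
        using s by (simp add: power_mult_distrib mult_ac)
      also have "((4 * t) * x) powr \<alpha> = (4 * t) powr \<alpha> * x powr \<alpha>"
        using x t by (subst powr_mult) auto
      finally have "u\<^sup>2 powr (\<alpha> - 1/2) * u = (4 * t) powr \<alpha> * x powr \<alpha> * sin \<theta> powr (2 * \<alpha>)" .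
      then have "(4 * t) powr (-\<alpha>) * (u\<^sup>2 powr (\<alpha> - 1/2) * u) = ((4 * t) powr (-\<alpha>) * (4 * t) powr \<alpha>) * (x powr \<alpha> * sin \<theta> powr (2 * \<alpha>))"
        by (simp only: mult_ac)
      also have "(4 * t) powr (-\<alpha>) * (4 * t) powr \<alpha> = 1"
        using t by (simp flip: powr_add)
      finally have "(4 * t) powr (-\<alpha>) * (u\<^sup>2 powr (\<alpha> - 1/2) * u) = x powr \<alpha> * sin \<theta> powr (2 * \<alpha>)" by simp
      moreover have "f (g \<theta>) * (2 * s * sin \<theta>) = norm_const * G (g \<theta>) * ((4 * t) powr (-\<alpha>) * (u\<^sup>2 powr (\<alpha> - 1/2) * u))"
        using u unfolding f_def translation_kernel_def hg u_def[symmetric] by simp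
      ultimately show ?thesis using 3 by (simp add: mult_ac)
    qed auto
  qed
  also have "\<dots> = (\<integral>\<^sup>+\<theta>. ennreal (x powr \<alpha> * (indicator {0<..<pi} \<theta> * (norm_const * sin \<theta> powr (2 * \<alpha>)) * G (shift t x \<theta>))) \<partial>lborel)"
    by (subst nn_integral_real_affine[of _ "-1" pi])
       (auto intro!: nn_integral_cong simp: indicator_def g_def shift_def s_def)
  also have "\<dots> = (\<integral>\<^sup>+\<theta>. ennreal (x powr \<alpha>) * (ennreal (indicator {0<..<pi} \<theta> * (norm_const * sin \<theta> powr (2 * \<alpha>))) * ennreal (G (shift t x \<theta>))) \<partial>lborel)"
    using c G0 by (intro nn_integral_cong) (simp add: ennreal_mult'[symmetric] ennreal_mult''[symmetric])
  also have "\<dots> = ennreal (x powr \<alpha>) * (\<integral>\<^sup>+\<theta>. (ennreal (indicator {0<..<pi} \<theta> * (norm_const * sin \<theta> powr (2 * \<alpha>))) * ennreal (G (shift t x \<theta>))) \<partial>lborel)"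
    by (rule nn_integral_cmult) measurable
  also have "(\<integral>\<^sup>+\<theta>. (ennreal (indicator {0<..<pi} \<theta> * (norm_const * sin \<theta> powr (2 * \<alpha>))) * ennreal (G (shift t x \<theta>))) \<partial>lborel)
     = (\<integral>\<^sup>+\<theta>. ennreal (G (shift t x \<theta>)) \<partial>\<sigma>)"
    unfolding angular_measure_def by (rule nn_integral_density[symmetric]) measurable
  finally show ?thesis ..
qed

text \<open>
  The joint law of \<open>x\<close> and \<open>shift t x \<theta>\<close> under the measure $x^\alpha\,dx\otimes\sigma$. Symmetry of
  the translation is stated as invariance of this measure under exchange of coordinates, which covers
  nonnegative and signed integrands at once.
\<close>

definition translation_coupling :: "real \<Rightarrow> (real \<times> real) measure" where
  "translation_coupling t = distr (\<rho> \<Otimes>\<^sub>M \<sigma>) (borel \<Otimes>\<^sub>M borel)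
     (\<lambda>p. (fst p, shift t (fst p) (snd p)))"

lemma sets_translation_coupling [measurable_cong, simp]:
  "sets (translation_coupling t) = sets (borel \<Otimes>\<^sub>M borel)"
  by (simp add: translation_coupling_def)

lemma sets_radial_angular [measurable_cong]:
  "sets (\<rho> \<Otimes>\<^sub>M \<sigma>) = sets (borel \<Otimes>\<^sub>M borel)"
  by (intro sets_pair_measure_cong) auto

lemma translation_coupling_density:
  assumes t: "t > 0"
  shows "translation_coupling t = density (lborel \<Otimes>\<^sub>M lborel) (\<lambda>p. ennreal (translation_kernel t (fst p) (snd p)))"
proof (rule measure_eqI)
  fix E assume "E \<in> sets (translation_coupling t)"
  then have E[measurable]: "E \<in> sets (borel \<Otimes>\<^sub>M borel)" by simp
  have "emeasure (translation_coupling t) E = (\<integral>\<^sup>+p. indicator E p \<partial>translation_coupling t)"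
    by simp
  also have "\<dots> = (\<integral>\<^sup>+p. indicator E (fst p, shift t (fst p) (snd p)) \<partial>(\<rho> \<Otimes>\<^sub>M \<sigma>))"
    unfolding translation_coupling_def by (subst nn_integral_distr) auto
  also have "\<dots> = (\<integral>\<^sup>+x. (\<integral>\<^sup>+\<theta>. indicator E (x, shift t x \<theta>) \<partial>\<sigma>) \<partial>\<rho>)"
    by (subst ang.nn_integral_fst[symmetric]) auto
  also have "\<dots> = (\<integral>\<^sup>+x. ennreal (indicator {0<..} x * x powr \<alpha>) * (\<integral>\<^sup>+\<theta>. indicator E (x, shift t x \<theta>) \<partial>\<sigma>) \<partial>lborel)"
    unfolding radial_measure_def by (subst nn_integral_density) (auto intro!: ang.borel_measurable_nn_integral)
  also have "\<dots> = (\<integral>\<^sup>+x. (\<integral>\<^sup>+y. ennreal (translation_kernel t x y) * indicator E (x, y) \<partial>lborel) \<partial>lborel)"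
  proof (intro nn_integral_cong)
    fix x :: real
    show "ennreal (indicator {0<..} x * x powr \<alpha>) * (\<integral>\<^sup>+\<theta>. indicator E (x, shift t x \<theta>) \<partial>\<sigma>)
       = (\<integral>\<^sup>+y. ennreal (translation_kernel t x y) * indicator E (x, y) \<partial>lborel)"
    proof (cases "x > 0")
      case True
      have "ennreal (x powr \<alpha>) * (\<integral>\<^sup>+\<theta>. ennreal (indicator E (x, shift t x \<theta>)) \<partial>\<sigma>)
         = (\<integral>\<^sup>+y. ennreal (translation_kernel t x y * indicator E (x, y)) \<partial>lborel)"
        by (intro nn_integral_shift[OF True t]) auto
      then show ?thesis using True translation_kernel_nonneg
        by (simp add: ennreal_mult' ennreal_indicator)
    next
      case False
      then have "translation_kernel t x y = 0" for y
        using triangle_form_pos_imp_pos[OF _ t, of x y] by (auto simp: translation_kernel_def)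
      then show ?thesis using False by simp
    qed
  qed
  also have "\<dots> = (\<integral>\<^sup>+p. ennreal (translation_kernel t (fst p) (snd p)) * indicator E p \<partial>(lborel \<Otimes>\<^sub>M lborel))"
    by (subst lborel.nn_integral_fst[symmetric]) auto
  also have "\<dots> = emeasure (density (lborel \<Otimes>\<^sub>M lborel) (\<lambda>p. ennreal (translation_kernel t (fst p) (snd p)))) E"
    by (subst emeasure_density) auto
  finally show "emeasure (translation_coupling t) E = \<dots>" .
qed (simp add: cong: sets_pair_measure_cong)

text \<open>
  By \<open>translation_coupling_density\<close> the coupling has the symmetric density \<open>translation_kernel\<close>.
\<close>

lemma translation_coupling_swap:
  assumes t: "t > 0"
  shows "distr (translation_coupling t) (borel \<Otimes>\<^sub>M borel) (\<lambda>p. (snd p, fst p)) = translation_coupling t"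
proof (rule measure_eqI)
  fix E assume "E \<in> sets (distr (translation_coupling t) (borel \<Otimes>\<^sub>M borel) (\<lambda>p. (snd p, fst p)))"
  then have E[measurable]: "E \<in> sets (borel \<Otimes>\<^sub>M borel)" by simp
  have "emeasure (distr (translation_coupling t) (borel \<Otimes>\<^sub>M borel) (\<lambda>p. (snd p, fst p))) E
     = (\<integral>\<^sup>+p. indicator E p \<partial>distr (translation_coupling t) (borel \<Otimes>\<^sub>M borel) (\<lambda>p. (snd p, fst p)))"
    by simp
  also have "\<dots> = (\<integral>\<^sup>+p. indicator E (snd p, fst p) \<partial>translation_coupling t)"
    by (subst nn_integral_distr) auto
  also have "\<dots> = (\<integral>\<^sup>+p. ennreal (translation_kernel t (fst p) (snd p)) * indicator E (snd p, fst p) \<partial>(lborel \<Otimes>\<^sub>M lborel))"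
    unfolding translation_coupling_density[OF t] by (subst nn_integral_density) auto
  also have "\<dots> = (\<integral>\<^sup>+y. \<integral>\<^sup>+x. ennreal (translation_kernel t x y) * indicator E (y, x) \<partial>lborel \<partial>lborel)"
    by (subst lborel_pair.nn_integral_snd[symmetric]) (auto simp: case_prod_beta')
  also have "\<dots> = (\<integral>\<^sup>+y. \<integral>\<^sup>+x. ennreal (translation_kernel t y x) * indicator E (y, x) \<partial>lborel \<partial>lborel)"
    by (subst translation_kernel_commute) simp
  also have "\<dots> = (\<integral>\<^sup>+p. ennreal (translation_kernel t (fst p) (snd p)) * indicator E p \<partial>(lborel \<Otimes>\<^sub>M lborel))"
    by (subst lborel.nn_integral_fst[symmetric]) auto
  also have "\<dots> = emeasure (translation_coupling t) E"
    unfolding translation_coupling_density[OF t] by (subst emeasure_density) auto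
  finally show "emeasure (distr (translation_coupling t) (borel \<Otimes>\<^sub>M borel) (\<lambda>p. (snd p, fst p))) E = \<dots>" .
qed simp

lemma nn_integral_coupling:
  assumes [measurable]: "F \<in> borel_measurable (borel \<Otimes>\<^sub>M borel)"
  shows "(\<integral>\<^sup>+p. F p \<partial>translation_coupling t)
    = (\<integral>\<^sup>+x. (\<integral>\<^sup>+\<theta>. F (x, shift t x \<theta>) \<partial>\<sigma>) \<partial>\<rho>)"
proof -
  show ?thesis unfolding translation_coupling_def
    by (subst nn_integral_distr) (auto simp: ang.nn_integral_fst[symmetric])
qed

lemma nn_integral_coupling_swap:
  assumes "t > 0" and [measurable]: "F \<in> borel_measurable (borel \<Otimes>\<^sub>M borel)"
  shows "(\<integral>\<^sup>+p. F (snd p, fst p) \<partial>translation_coupling t) = (\<integral>\<^sup>+p. F p \<partial>translation_coupling t)"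
  by (subst (2) translation_coupling_swap[OF assms(1), symmetric], subst nn_integral_distr) auto

text \<open>
  The second marginal of the coupling equals the first: averaging over the angle preserves the measure
  $x^\alpha\,dx$. This is the source of all norm estimates.
\<close>

lemma nn_integral_translate:
  assumes t: "t > 0" and [measurable]: "F \<in> borel_measurable borel"
  shows "(\<integral>\<^sup>+x. (\<integral>\<^sup>+\<theta>. F (shift t x \<theta>) \<partial>\<sigma>) \<partial>\<rho>)
     = (\<integral>\<^sup>+x. F x \<partial>\<rho>)"
proof -
  have "(\<integral>\<^sup>+x. (\<integral>\<^sup>+\<theta>. F (shift t x \<theta>) \<partial>\<sigma>) \<partial>\<rho>)
    = (\<integral>\<^sup>+p. F (snd p) \<partial>translation_coupling t)"
    by (subst nn_integral_coupling) auto
  also have "\<dots> = (\<integral>\<^sup>+p. F (fst p) \<partial>translation_coupling t)"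
    using nn_integral_coupling_swap[OF t, of "\<lambda>p. F (fst p)"] by simp
  also have "\<dots> = (\<integral>\<^sup>+x. (\<integral>\<^sup>+\<theta>. F x \<partial>\<sigma>) \<partial>\<rho>)"
    by (subst nn_integral_coupling) auto
  also have "\<dots> = (\<integral>\<^sup>+x. F x \<partial>\<rho>)"
    by (simp add: emeasure_angular_UNIV)
  finally show ?thesis .
qed

end

section \<open>Power series and alternating sums\<close>

lemma powser_zero_imp_coeff_zero:
  fixes c :: "nat \<Rightarrow> real"
  assumes "\<And>x. (\<lambda>n. c n * x ^ n) sums 0"
  shows "c n = 0"
  using assms
proof (induction n arbitrary: c)
  case 0
  then show ?case using sums_unique2[OF powser_sums_zero[of c]] by blast
next
  case (Suc n)
  have s: "summable (\<lambda>n. c n * x ^ n)" and z: "(\<Sum>n. c n * x ^ n) = 0" for x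
    using Suc.prems[of x] by (auto simp: sums_iff)
  have "(\<lambda>n. diffs c n * x ^ n) sums 0" for x
  proof -
    have "((\<lambda>x. \<Sum>n. c n * x ^ n) has_field_derivative (\<Sum>n. diffs c n * x ^ n)) (at x)"
      by (rule termdiffs_strong_converges_everywhere[OF s])
    moreover have "((\<lambda>x. \<Sum>n. c n * x ^ n) has_field_derivative 0) (at x)"
      unfolding z by simp
    ultimately have "(\<Sum>n. diffs c n * x ^ n) = 0" by (rule DERIV_unique)
    then show ?thesis using termdiff_converges_all[OF s, of x] by (simp add: sums_iff)
  qed
  then have "diffs c n = 0" by (rule Suc.IH)
  then show ?case by (simp add: diffs_def)
qed

lemma powser_eqD:
  fixes c d :: "nat \<Rightarrow> real"
  assumes "\<And>x. (\<lambda>n. c n * x ^ n) sums F x" "\<And>x. (\<lambda>n. d n * x ^ n) sums F x"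
  shows "c n = d n"
proof -
  have "(\<lambda>n. (c n - d n) * x ^ n) sums 0" for x
    using sums_diff[OF assms(1)[of x] assms(2)[of x]] by (simp add: left_diff_distrib)
  then have "c n - d n = 0" by (rule powser_zero_imp_coeff_zero)
  then show ?thesis by simp
qed

text \<open>
  The point is the shape of the new coefficients: as $a+a^2$ is divisible by $a$, the one of index $j$
  involves only the old coefficients up to index $j$.
\<close>

lemma sums_compose_quadratic:
  fixes B :: "nat \<Rightarrow> real"
  assumes B: "\<And>w. summable (\<lambda>k. norm (B k * w ^ k))"
  shows "(\<lambda>j. (\<Sum>k\<le>j. B k * real (k choose (j - k))) * a ^ j) sums (\<Sum>k. B k * (a + a\<^sup>2) ^ k)"
proof -
  define g where "g = (\<lambda>(k, i). B k * real (k choose i) * a ^ (k + i))"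
  have inner: "((\<lambda>i. B k * real (k choose i) * z ^ (k + i)) has_sum (B k * (z + z\<^sup>2) ^ k)) UNIV" for k and z :: real
  proof (rule has_sum_finite_neutralI[of "{..k}"])
    have "z + z\<^sup>2 = z * (z + 1)" by (simp add: power2_eq_square algebra_simps)
    then have "(z + z\<^sup>2) ^ k = z ^ k * (\<Sum>i\<le>k. real (k choose i) * z ^ i)"
      using binomial_ring[of z 1 k] by (simp add: power_mult_distrib)
    then show "B k * (z + z\<^sup>2) ^ k = (\<Sum>i\<le>k. B k * real (k choose i) * z ^ (k + i))"
      by (simp add: sum_distrib_left power_add mult_ac)
  qed (auto simp: binomial_eq_0)
  have inner_abs: "((\<lambda>i. norm (g (k, i))) has_sum (\<bar>B k\<bar> * (\<bar>a\<bar> + \<bar>a\<bar>\<^sup>2) ^ k)) UNIV" for k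
  proof -
    have "((\<lambda>i. \<bar>B k\<bar> * (real (k choose i) * \<bar>a\<bar> ^ (k + i))) has_sum (\<bar>B k\<bar> * (\<bar>a\<bar> + \<bar>a\<bar>\<^sup>2) ^ k)) UNIV"
    proof (rule has_sum_finite_neutralI[of "{..k}"])
      have "\<bar>a\<bar> + \<bar>a\<bar>\<^sup>2 = \<bar>a\<bar> * (\<bar>a\<bar> + 1)" by (simp add: power2_eq_square algebra_simps del: power2_abs)
      then have "(\<bar>a\<bar> + \<bar>a\<bar>\<^sup>2) ^ k = \<bar>a\<bar> ^ k * (\<Sum>i\<le>k. real (k choose i) * \<bar>a\<bar> ^ i)"
        using binomial_ring[of "\<bar>a\<bar>" 1 k] by (simp add: power_mult_distrib del: power2_abs)
      then show "\<bar>B k\<bar> * (\<bar>a\<bar> + \<bar>a\<bar>\<^sup>2) ^ k = (\<Sum>i\<le>k. \<bar>B k\<bar> * (real (k choose i) * \<bar>a\<bar> ^ (k + i)))"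
        by (simp add: sum_distrib_left power_add mult_ac del: power2_abs)
    qed (auto simp: binomial_eq_0)
    then show ?thesis by (simp add: g_def abs_mult power_abs mult_ac)
  qed
  have outer_abs: "(\<lambda>k. \<bar>B k\<bar> * (\<bar>a\<bar> + \<bar>a\<bar>\<^sup>2) ^ k) summable_on UNIV"
    using B[of "\<bar>a\<bar> + \<bar>a\<bar>\<^sup>2"] by (intro norm_summable_imp_summable_on) (simp add: abs_mult power_abs)
  have "(\<lambda>p. norm (g p)) summable_on (Sigma UNIV (\<lambda>_. UNIV))"
    unfolding Infinite_Sum.abs_summable_on_Sigma_iff
  proof (intro conjI ballI)
    show "(\<lambda>i. norm (g (k, i))) summable_on UNIV" for k
      using inner_abs[of k] by (auto simp: summable_on_def)
    have "(\<Sum>\<^sub>\<infinity>i. norm (g (k, i))) = \<bar>B k\<bar> * (\<bar>a\<bar> + \<bar>a\<bar>\<^sup>2) ^ k" for k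
      using inner_abs[of k] by (rule infsumI)
    then show "(\<lambda>k. norm (\<Sum>\<^sub>\<infinity>i. norm (g (k, i)))) summable_on UNIV"
      using outer_abs by (simp add: abs_mult power_abs)
  qed
  then have gs: "g summable_on (Sigma UNIV (\<lambda>_. UNIV))" by (rule Infinite_Sum.abs_summable_summable)
  have "(\<lambda>k. B k * (a + a\<^sup>2) ^ k) sums (\<Sum>k. B k * (a + a\<^sup>2) ^ k)"
    using summable_norm_cancel[OF B] by (rule summable_sums)
  then have "((\<lambda>k. B k * (a + a\<^sup>2) ^ k) has_sum (\<Sum>k. B k * (a + a\<^sup>2) ^ k)) UNIV"
    using norm_summable_imp_has_sum[OF B] by blast
  then have "(g has_sum (\<Sum>k. B k * (a + a\<^sup>2) ^ k)) (Sigma UNIV (\<lambda>_. UNIV))"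
    using inner[where z = a] gs by (intro has_sum_SigmaI) (auto simp: g_def)
  moreover have "((\<lambda>(j, k). B k * real (k choose (j - k)) * a ^ j) has_sum S) (Sigma UNIV (\<lambda>j. {..j}))
     \<longleftrightarrow> (g has_sum S) (Sigma UNIV (\<lambda>_. UNIV))" for S
  proof -
    have "bij_betw (\<lambda>(j, k). (k, j - k)) (Sigma UNIV (\<lambda>j::nat. {..j})) (Sigma UNIV (\<lambda>_::nat. UNIV :: nat set))"
      by (rule bij_betwI[where g = "\<lambda>(k, i). (k + i, k)"]) auto
    from has_sum_reindex_bij_betw[OF this, of g S] show ?thesis
      by (subst (asm) has_sum_cong[where g = "\<lambda>(j, k). B k * real (k choose (j - k)) * a ^ j"])
         (auto simp: g_def)
  qed
  ultimately have "((\<lambda>(j, k). B k * real (k choose (j - k)) * a ^ j) has_sum (\<Sum>k. B k * (a + a\<^sup>2) ^ k)) (Sigma UNIV (\<lambda>j. {..j}))"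
    by simp
  then have "((\<lambda>j. (\<Sum>k\<le>j. B k * real (k choose (j - k))) * a ^ j) has_sum (\<Sum>k. B k * (a + a\<^sup>2) ^ k)) UNIV"
    by (rule has_sum_SigmaD) (auto simp: sum_distrib_right intro!: has_sum_finiteI)
  then show ?thesis by (rule has_sum_imp_sums)
qed

lemma alternating_pochhammer_sum_Suc:
  fixes b :: real
  shows "(\<Sum>k\<le>Suc n. (- 1) ^ k * real (Suc n choose k) * pochhammer (b + real k) (Suc m))
    = - real (Suc m) * (\<Sum>k\<le>n. (- 1) ^ k * real (n choose k) * pochhammer (b + 1 + real k) m)"
proof -
  define P where "P k = pochhammer (b + real k) (Suc m)" for k
  have dP: "P k - P (Suc k) = - real (Suc m) * pochhammer (b + 1 + real k) m" for k
  proof -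
    have "P k = (b + real k) * pochhammer (b + real k + 1) m" by (simp add: P_def pochhammer_rec)
    moreover have "P (Suc k) = (b + real k + 1 + real m) * pochhammer (b + real k + 1) m"
      unfolding P_def pochhammer_Suc by (simp add: add_ac)
    ultimately show ?thesis by (simp add: algebra_simps)
  qed
  have "(\<Sum>k\<le>Suc n. (- 1) ^ k * real (Suc n choose k) * P k)
     = P 0 + (\<Sum>k\<le>n. (- 1) ^ Suc k * real (Suc n choose Suc k) * P (Suc k))"
    by (subst sum.atMost_Suc_shift) simp
  also have "\<dots> = P 0 + (\<Sum>k\<le>n. (- 1) ^ Suc k * real (n choose Suc k) * P (Suc k)) - (\<Sum>k\<le>n. (- 1) ^ k * real (n choose k) * P (Suc k))"
  proof -
    have "(- 1) ^ Suc k * real (Suc n choose Suc k) * P (Suc k)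
      = (- 1) ^ Suc k * real (n choose Suc k) * P (Suc k) - (- 1) ^ k * real (n choose k) * P (Suc k)" for k
      by (simp add: algebra_simps)
    then show ?thesis by (simp only: sum_subtractf add_diff_eq)
  qed
  also have "P 0 + (\<Sum>k\<le>n. (- 1) ^ Suc k * real (n choose Suc k) * P (Suc k)) = (\<Sum>k\<le>Suc n. (- 1) ^ k * real (n choose k) * P k)"
    by (subst sum.atMost_Suc_shift) simp
  also have "\<dots> = (\<Sum>k\<le>n. (- 1) ^ k * real (n choose k) * P k)" by simp
  also have "\<dots> - (\<Sum>k\<le>n. (- 1) ^ k * real (n choose k) * P (Suc k)) = (\<Sum>k\<le>n. (- 1) ^ k * real (n choose k) * (P k - P (Suc k)))"
    by (simp add: sum_subtractf right_diff_distrib)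
  also have "\<dots> = - real (Suc m) * (\<Sum>k\<le>n. (- 1) ^ k * real (n choose k) * pochhammer (b + 1 + real k) m)"
    unfolding dP sum_distrib_left by (intro sum.cong) auto
  finally show ?thesis unfolding P_def .
qed

text \<open>
  The $n$-th difference of a polynomial of degree $m\le n$. This is the orthogonality of the Laguerre
  polynomials in discrete form.
\<close>

lemma alternating_pochhammer_sum:
  fixes b :: real
  assumes "m \<le> n"
  shows "(\<Sum>k\<le>n. (- 1) ^ k * real (n choose k) * pochhammer (b + real k) m) = (if m = n then (- 1) ^ n * fact n else 0)"
  using assms
proof (induction n arbitrary: m b)
  case (Suc n)
  show ?case
  proof (cases m)
    case 0
    then show ?thesis using choose_alternating_sum[of "Suc n"] by (simp add: of_nat_sum del: sum.atMost_Suc binomial_Suc_Suc)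
  next
    case (Suc m')
    then show ?thesis using Suc.prems unfolding Suc alternating_pochhammer_sum_Suc
      by (subst Suc.IH) (auto simp: algebra_simps)
  qed
qed simp

section \<open>Borel representatives on the half line\<close>

text \<open>
  A Borel function that represents a Lebesgue measurable one on the half line. The translation composes its
  function with a map of two variables, which preserves measurability only for Borel functions.
\<close>

definition agrees_on_halfline :: "(real \<Rightarrow> real) \<Rightarrow> (real \<Rightarrow> real) \<Rightarrow> bool" where
  "agrees_on_halfline f g \<longleftrightarrow> g \<in> borel_measurable borel \<and> (AE x in lborel. x \<ge> 0 \<longrightarrow> f x = g x)"

lemma AE_lborel_imp_lebesgue_on:
  assumes S: "S \<in> sets lebesgue" and ae: "AE x in lborel. x \<in> S \<longrightarrow> P x"
  shows "AE x in lebesgue_on S. P x"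
  using ae S by (subst AE_restrict_space_iff) (auto simp: AE_completion_iff)

text \<open>
  Lebesgue measure is complete, so agreement almost everywhere transfers measurability.
\<close>

lemma measurable_lebesgue_on_AE:
  fixes f g :: "real \<Rightarrow> real"
  assumes S: "S \<in> sets lebesgue" and g: "g \<in> borel_measurable borel" and ae: "AE x in lborel. x \<in> S \<longrightarrow> f x = g x"
  shows "f \<in> borel_measurable (lebesgue_on S)"
proof -
  have "g \<in> borel_measurable lborel" using g by simp
  then have "g \<in> borel_measurable lebesgue" by (rule measurable_completion)
  then have "(\<lambda>x. if x \<in> S then g x else 0) \<in> borel_measurable lebesgue"
    using S by (intro borel_measurable_if_I measurable_restrict_space1) auto
  moreover have "AE x in lebesgue. (if x \<in> S then g x else 0) = (if x \<in> S then f x else 0)"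
    unfolding AE_completion_iff using ae by eventually_elim auto
  ultimately have "(\<lambda>x. if x \<in> S then f x else 0) \<in> borel_measurable lebesgue"
    by (rule borel_measurable_AE)
  then show ?thesis using S by (simp add: borel_measurable_if)
qed

lemma borel_imp_lebesgue_on:
  "g \<in> borel_measurable borel \<Longrightarrow> g \<in> borel_measurable (lebesgue_on S)" for g :: "real \<Rightarrow> real"
  by (intro measurable_restrict_space1 measurable_completion) simp

lemma agrees_AE: "agrees_on_halfline f g \<Longrightarrow> AE x in lebesgue_on {0..}. f x = g x"
  unfolding agrees_on_halfline_def by (intro AE_lborel_imp_lebesgue_on) auto

lemma agrees_measurable:
  "agrees_on_halfline f g \<Longrightarrow> f \<in> borel_measurable (lebesgue_on {0..})"
  unfolding agrees_on_halfline_def by (rule measurable_lebesgue_on_AE) auto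

lemma squared_weight: "\<bar>a * exp (- x / 2)\<bar>\<^sup>2 * w = a\<^sup>2 * (exp (- x) * w)" for a x w :: real
  by (simp add: power_mult_distrib flip: exp_of_nat_mult)

lemma agrees_diff:
  "agrees_on_halfline f f' \<Longrightarrow> agrees_on_halfline g g' \<Longrightarrow> agrees_on_halfline (\<lambda>x. f x - g x) (\<lambda>x. f' x - g' x)"
  unfolding agrees_on_halfline_def by (auto elim!: eventually_elim2)

lemma agrees_refl: "g \<in> borel_measurable borel \<Longrightarrow> agrees_on_halfline g g"
  by (simp add: agrees_on_halfline_def)

text \<open>
  Lebesgue measurable functions in \<open>laguerre_L2 \<alpha>\<close> have Borel representatives, which differ from them on the
  half line only on a null set.
\<close>

definition borel_version :: "(real \<Rightarrow> real) \<Rightarrow> real \<Rightarrow> real" where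
  "borel_version f = (SOME g. agrees_on_halfline f g)"

section \<open>The translation operators on the weighted space\<close>

text \<open>
  For $\alpha\ge0$ the Bessel function in the kernel has index at least $-\frac12$ and is bounded by $1$,
  so the translation is dominated by a positive averaging operator.
\<close>

locale nonneg_laguerre_parameter = laguerre_parameter +
  assumes \<alpha>: "\<alpha> \<ge> 0"
begin

abbreviation T :: "real \<Rightarrow> (real \<Rightarrow> real) \<Rightarrow> real \<Rightarrow> real" where
  "T \<equiv> laguerre_translation \<alpha>"

abbreviation L :: "nat \<Rightarrow> real \<Rightarrow> real" where
  "L n \<equiv> laguerre_poly n \<alpha>"

abbreviation R :: "nat \<Rightarrow> real \<Rightarrow> real" where
  "R n \<equiv> laguerre_poly_normalized n \<alpha>"

definition laguerre_measure :: "real measure"  (\<open>\<mu>\<close>) where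
  "\<mu> = density \<rho> (\<lambda>x. ennreal (exp (- x)))"

lemma sets_laguerre_measure [measurable_cong, simp]: "sets \<mu> = sets borel"
  by (simp add: laguerre_measure_def)

lemma space_laguerre_measure [simp]: "space \<mu> = UNIV"
  by (simp add: laguerre_measure_def)

abbreviation L2 :: "(real \<Rightarrow> real) \<Rightarrow> bool" where
  "L2 \<equiv> square_integrable \<mu>"

abbreviation L2_norm :: "(real \<Rightarrow> real) \<Rightarrow> real" where
  "L2_norm \<equiv> L2_norm_on \<mu>"

lemma nn_integral_laguerre:
  assumes [measurable]: "f \<in> borel_measurable borel"
  shows "(\<integral>\<^sup>+x. f x \<partial>\<mu>) = (\<integral>\<^sup>+x. ennreal (exp (- x)) * f x \<partial>\<rho>)"
  unfolding laguerre_measure_def by (subst nn_integral_density) auto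

lemma AE_radial_pos: "AE x in \<rho>. x > 0"
  unfolding radial_measure_def by (subst AE_density) (auto simp: indicator_def)

lemma AE_laguerre_iff_radial:
  "(AE x in \<mu>. P x) \<longleftrightarrow> (AE x in \<rho>. P x)"
  unfolding laguerre_measure_def by (subst AE_density) (auto simp: radial_measure_def)

lemma AE_laguerre_pos: "AE x in \<mu>. x > 0"
  unfolding AE_laguerre_iff_radial by (rule AE_radial_pos)

text \<open>
  The factor of the integrand of the translation that does not depend on the function.
\<close>

definition translation_weight :: "real \<Rightarrow> real \<Rightarrow> real \<Rightarrow> real" where
  "translation_weight t x \<theta> = exp (- (sqrt (x * t) * cos \<theta>)) * J (sqrt (x * t) * sin \<theta>)"

lemma measurable_entire_bessel:
  "J \<in> borel_measurable borel"
  using \<alpha> by (intro borel_measurable_continuous_onI continuous_on_entire_bessel) auto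

lemma measurable_translation_weight:
  "(\<lambda>p. translation_weight t (fst p) (snd p)) \<in> borel_measurable (borel \<Otimes>\<^sub>M borel)"
    "translation_weight t x \<in> borel_measurable borel"
  using measurable_entire_bessel unfolding translation_weight_def by measurable

lemma laguerre_translation_eq_angular:
  assumes f[measurable]: "f \<in> borel_measurable borel"
  shows "T t f x = (LINT \<theta>|\<sigma>. f (shift t x \<theta>) * translation_weight t x \<theta>)"
proof -
  have c: "norm_const > 0" by (rule norm_const_pos)
  note [measurable] = measurable_entire_bessel measurable_translation_weight
  define h where "h \<theta> = f (shift t x \<theta>) * translation_weight t x \<theta> * sin \<theta> powr (2 * \<alpha>)" for \<theta>
  have [measurable]: "h \<in> borel_measurable borel" unfolding h_def by measurable
  have "T t f x = norm_const * (LINT \<theta>|lebesgue_on {0..pi}. h \<theta>)"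
    unfolding laguerre_translation_def norm_const_def h_def shift_def translation_weight_def by (simp add: mult_ac)
  also have "(LINT \<theta>|lebesgue_on {0..pi}. h \<theta>) = (LINT \<theta>|lebesgue. indicator {0..pi} \<theta> *\<^sub>R h \<theta>)"
    by (subst integral_restrict_space) auto
  also have "\<dots> = (LINT \<theta>|lborel. indicator {0..pi} \<theta> *\<^sub>R h \<theta>)"
    by (rule integral_completion) measurable
  also have "norm_const * \<dots> = (LINT \<theta>|lborel. norm_const * (indicator {0..pi} \<theta> *\<^sub>R h \<theta>))" by simp
  also have "\<dots> = (LINT \<theta>|lborel. (indicator {0<..<pi} \<theta> * (norm_const * sin \<theta> powr (2 * \<alpha>))) *\<^sub>R (f (shift t x \<theta>) * translation_weight t x \<theta>))"
    by (intro integral_cong_AE AE_I[of _ _ "{0,pi}"]) (auto simp: indicator_def h_def emeasure_lborel_countable)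
  also have "\<dots> = (LINT \<theta>|\<sigma>. f (shift t x \<theta>) * translation_weight t x \<theta>)"
    unfolding angular_measure_def using c
    by (subst integral_density) (auto intro!: AE_I2 mult_nonneg_nonneg)
  finally show ?thesis .
qed

lemma laguerre_translation_0:
  "T 0 f x = f x"
proof -
  have "T 0 f x = T 0 (\<lambda>_. f x) x"
    by (simp add: laguerre_translation_def)
  also have "\<dots> = f x"
    using \<alpha> entire_bessel_conv_series[of "\<alpha> - 1/2" 0] measure_angular_UNIV
    by (subst laguerre_translation_eq_angular) (auto simp: translation_weight_def)
  finally show ?thesis .
qed

text \<open>
  After multiplication by $e^{-x/2}$ the exponential factors combine to $e^{t/2}e^{-y/2}$, where $y$
  is the shifted point.
\<close>

lemma abs_translation_weight_le:
  "\<bar>translation_weight t x \<theta>\<bar> \<le> exp ((x + t) / 2) * exp (- shift t x \<theta> / 2)"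
proof -
  have "\<bar>translation_weight t x \<theta>\<bar> \<le> exp (- (sqrt (x * t) * cos \<theta>)) * 1"
    unfolding translation_weight_def abs_mult using \<alpha>
    by (intro mult_mono abs_entire_bessel_le_1) auto
  also have "\<dots> = exp ((x + t) / 2) * exp (- shift t x \<theta> / 2)"
    by (simp add: shift_def field_simps flip: exp_add)
  finally show ?thesis .
qed

lemma laguerre_translation_measurable:
  assumes f[measurable]: "f \<in> borel_measurable borel"
  shows "T t f \<in> borel_measurable borel"
proof -
  note [measurable] = measurable_entire_bessel measurable_translation_weight
  have "(\<lambda>x. LINT \<theta>|\<sigma>. f (shift t x \<theta>) * translation_weight t x \<theta>) \<in> borel_measurable borel"
    by (rule ang.borel_measurable_lebesgue_integral) (simp add: case_prod_beta')
  moreover have "T t f = (\<lambda>x. LINT \<theta>|\<sigma>. f (shift t x \<theta>) * translation_weight t x \<theta>)"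
    by (intro ext laguerre_translation_eq_angular f)
  ultimately show ?thesis by simp
qed

abbreviation energy :: "(real \<Rightarrow> real) \<Rightarrow> real \<Rightarrow> real" where
  "energy f y \<equiv> exp (- y) * (f y)\<^sup>2"

text \<open>
  The Cauchy-Schwarz inequality for the probability measure \<open>\<sigma>\<close>. A translation whose integral does
  not exist has the value $0$ and obeys the bound trivially.
\<close>

lemma translation_pointwise_bound:
  assumes f[measurable]: "f \<in> borel_measurable borel"
  shows "ennreal (exp (- x)) * ennreal ((T t f x)\<^sup>2)
    \<le> ennreal (exp t) * (\<integral>\<^sup>+\<theta>. ennreal (energy f (shift t x \<theta>)) \<partial>\<sigma>)"
proof -
  note [measurable] = measurable_entire_bessel measurable_translation_weight
  define h where "h \<theta> = \<bar>f (shift t x \<theta>)\<bar> * exp (- shift t x \<theta> / 2)" for \<theta>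
  have [measurable]: "h \<in> borel_measurable borel" unfolding h_def by measurable
  have h0: "h \<theta> \<ge> 0" for \<theta> by (simp add: h_def)
  have "ennreal \<bar>T t f x\<bar> \<le> (\<integral>\<^sup>+\<theta>. ennreal \<bar>f (shift t x \<theta>) * translation_weight t x \<theta>\<bar> \<partial>\<sigma>)"
    unfolding laguerre_translation_eq_angular[OF f]
    by (cases "integrable \<sigma> (\<lambda>\<theta>. f (shift t x \<theta>) * translation_weight t x \<theta>)")
       (use integral_norm_bound_ennreal in \<open>force simp: not_integrable_integral_eq\<close>)+
  also have "\<dots> \<le> (\<integral>\<^sup>+\<theta>. ennreal (exp ((x + t) / 2)) * ennreal (h \<theta>) \<partial>\<sigma>)"
  proof (intro nn_integral_mono)
    fix \<theta>
    have "\<bar>f (shift t x \<theta>) * translation_weight t x \<theta>\<bar> \<le> \<bar>f (shift t x \<theta>)\<bar> * (exp ((x + t) / 2) * exp (- shift t x \<theta> / 2))"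
      unfolding abs_mult by (intro mult_left_mono abs_translation_weight_le) auto
    then have "\<bar>f (shift t x \<theta>) * translation_weight t x \<theta>\<bar> \<le> exp ((x + t) / 2) * h \<theta>"
      by (simp only: h_def mult_ac)
    then show "ennreal \<bar>f (shift t x \<theta>) * translation_weight t x \<theta>\<bar> \<le> ennreal (exp ((x + t) / 2)) * ennreal (h \<theta>)"
      using h0 by (subst ennreal_mult[symmetric]) (auto intro!: ennreal_leI)
  qed
  also have "\<dots> = ennreal (exp ((x + t) / 2)) * (\<integral>\<^sup>+\<theta>. ennreal (h \<theta>) * 1 \<partial>\<sigma>)"
    by (subst nn_integral_cmult) auto
  finally have "(ennreal \<bar>T t f x\<bar>)\<^sup>2 \<le> (ennreal (exp ((x + t) / 2)) * (\<integral>\<^sup>+\<theta>. ennreal (h \<theta>) * 1 \<partial>\<sigma>))\<^sup>2"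
    by (rule power_mono) simp
  also have "\<dots> = (ennreal (exp ((x + t) / 2)))\<^sup>2 * (\<integral>\<^sup>+\<theta>. ennreal (h \<theta>) * 1 \<partial>\<sigma>)\<^sup>2"
    by (rule power_mult_distrib)
  also have "\<dots> \<le> (ennreal (exp ((x + t) / 2)))\<^sup>2 * ((\<integral>\<^sup>+\<theta>. (ennreal (h \<theta>))\<^sup>2 \<partial>\<sigma>) * (\<integral>\<^sup>+\<theta>. 1\<^sup>2 \<partial>\<sigma>))"
    by (intro mult_left_mono Cauchy_Schwarz_nn_integral) auto
  also have "(\<integral>\<^sup>+\<theta>. (1::ennreal)\<^sup>2 \<partial>\<sigma>) = 1"
    using \<alpha> by (simp add: emeasure_angular_UNIV)
  also have "(\<integral>\<^sup>+\<theta>. (ennreal (h \<theta>))\<^sup>2 \<partial>\<sigma>) = (\<integral>\<^sup>+\<theta>. ennreal (energy f (shift t x \<theta>)) \<partial>\<sigma>)"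
    using h0 by (intro nn_integral_cong) (simp add: ennreal_power h_def power_mult_distrib mult.commute flip: exp_of_nat_mult)
  also have "(ennreal (exp ((x + t) / 2)))\<^sup>2 = ennreal (exp (x + t))"
    by (simp add: ennreal_power flip: exp_of_nat_mult)
  finally have *: "(ennreal \<bar>T t f x\<bar>)\<^sup>2 \<le> ennreal (exp (x + t)) * (\<integral>\<^sup>+\<theta>. ennreal (energy f (shift t x \<theta>)) \<partial>\<sigma>)"
    by simp
  have "ennreal (exp (- x)) * ennreal ((T t f x)\<^sup>2) = ennreal (exp (- x)) * (ennreal \<bar>T t f x\<bar>)\<^sup>2"
    by (simp add: ennreal_power)
  also have "\<dots> \<le> ennreal (exp (- x)) * (ennreal (exp (x + t)) * (\<integral>\<^sup>+\<theta>. ennreal (energy f (shift t x \<theta>)) \<partial>\<sigma>))"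
    by (intro mult_left_mono *) simp
  also have "\<dots> = ennreal (exp t) * (\<integral>\<^sup>+\<theta>. ennreal (energy f (shift t x \<theta>)) \<partial>\<sigma>)"
    unfolding mult.assoc[symmetric] by (simp add: ennreal_mult[symmetric] flip: exp_add)
  finally show ?thesis .
qed

text \<open>
  Integration of the pointwise bound: averaging over the angle preserves \<open>\<rho>\<close>, so only the factor
  $e^t$ remains.
\<close>

lemma nn_integral_translation_bound:
  assumes t: "t \<ge> 0" and f[measurable]: "f \<in> borel_measurable borel"
  shows "(\<integral>\<^sup>+x. ennreal ((T t f x)\<^sup>2) \<partial>\<mu>)
    \<le> ennreal (exp t) * (\<integral>\<^sup>+x. ennreal ((f x)\<^sup>2) \<partial>\<mu>)"
proof (cases "t = 0")
  case True
  then show ?thesis by (simp add: laguerre_translation_0)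
next
  case False
  with t have t: "t > 0" by simp
  note [measurable] = laguerre_translation_measurable[OF f]
  have "(\<integral>\<^sup>+x. ennreal ((T t f x)\<^sup>2) \<partial>\<mu>)
     = (\<integral>\<^sup>+x. ennreal (exp (- x)) * ennreal ((T t f x)\<^sup>2) \<partial>\<rho>)"
    by (rule nn_integral_laguerre) measurable
  also have "\<dots> \<le> (\<integral>\<^sup>+x. ennreal (exp t) * (\<integral>\<^sup>+\<theta>. ennreal (energy f (shift t x \<theta>)) \<partial>\<sigma>) \<partial>\<rho>)"
    by (intro nn_integral_mono translation_pointwise_bound f)
  also have "\<dots> = ennreal (exp t) * (\<integral>\<^sup>+x. (\<integral>\<^sup>+\<theta>. ennreal (energy f (shift t x \<theta>)) \<partial>\<sigma>) \<partial>\<rho>)"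
    by (intro nn_integral_cmult ang.borel_measurable_nn_integral) (simp add: case_prod_beta')
  also have "(\<integral>\<^sup>+x. (\<integral>\<^sup>+\<theta>. ennreal (energy f (shift t x \<theta>)) \<partial>\<sigma>) \<partial>\<rho>)
     = (\<integral>\<^sup>+x. ennreal (exp (- x) * (f x)\<^sup>2) \<partial>\<rho>)"
    by (rule nn_integral_translate[OF t]) measurable
  also have "\<dots> = (\<integral>\<^sup>+x. ennreal ((f x)\<^sup>2) \<partial>\<mu>)"
    by (subst nn_integral_laguerre) (auto simp: ennreal_mult)
  finally show ?thesis .
qed

lemma square_integrable_laguerre_iff:
  "L2 f \<longleftrightarrow> f \<in> borel_measurable borel \<and> (\<integral>\<^sup>+x. ennreal ((f x)\<^sup>2) \<partial>\<mu>) < \<infinity>"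
proof -
  have "f \<in> borel_measurable \<mu> \<longleftrightarrow> f \<in> borel_measurable borel"
    by (intro arg_cong2[where f = "(\<in>)"] refl measurable_cong_sets) auto
  moreover have "f \<in> borel_measurable borel \<Longrightarrow> (\<lambda>x. (f x)\<^sup>2) \<in> borel_measurable \<mu>"
    by measurable
  ultimately show ?thesis
    unfolding square_integrable_def integrable_iff_bounded by auto
qed

lemma square_integrable_translation:
  assumes t: "t \<ge> 0" and f: "L2 f"
  shows "L2 (T t f)"
    and "(LINT x|\<mu>. (T t f x)\<^sup>2) \<le> exp t * (LINT x|\<mu>. (f x)\<^sup>2)"
proof -
  have f': "f \<in> borel_measurable borel" and fin: "(\<integral>\<^sup>+x. ennreal ((f x)\<^sup>2) \<partial>\<mu>) < \<infinity>"
    using f unfolding square_integrable_laguerre_iff by auto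
  note [measurable] = f' laguerre_translation_measurable[OF f']
  note b = nn_integral_translation_bound[OF t f']
  have "ennreal (exp t) * (\<integral>\<^sup>+x. ennreal ((f x)\<^sup>2) \<partial>\<mu>) < \<infinity>"
    using fin by (simp add: ennreal_mult_less_top)
  then have fin': "(\<integral>\<^sup>+x. ennreal ((T t f x)\<^sup>2) \<partial>\<mu>) < \<infinity>"
    using b by (rule le_less_trans[rotated])
  then show si: "L2 (T t f)"
    unfolding square_integrable_laguerre_iff by auto
  have "ennreal (LINT x|\<mu>. (T t f x)\<^sup>2) = (\<integral>\<^sup>+x. ennreal ((T t f x)\<^sup>2) \<partial>\<mu>)"
    using si by (intro nn_integral_eq_integral[symmetric]) (auto simp: square_integrable_def)
  also note b
  also have "(\<integral>\<^sup>+x. ennreal ((f x)\<^sup>2) \<partial>\<mu>) = ennreal (LINT x|\<mu>. (f x)\<^sup>2)"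
    using f by (intro nn_integral_eq_integral) (auto simp: square_integrable_def)
  finally show "(LINT x|\<mu>. (T t f x)\<^sup>2) \<le> exp t * (LINT x|\<mu>. (f x)\<^sup>2)"
    by (simp add: ennreal_mult[symmetric] Bochner_Integration.integral_nonneg ennreal_le_iff)
qed

text \<open>
  Additivity of the translation can fail at points where one of the defining integrals diverges; these
  form a null set.
\<close>

lemma AE_integrable_translation:
  assumes t: "t > 0" and f: "L2 f"
  shows "AE x in \<mu>. integrable \<sigma> (\<lambda>\<theta>. f (shift t x \<theta>) * translation_weight t x \<theta>)"
proof -
  have f'[measurable]: "f \<in> borel_measurable borel" and fin: "(\<integral>\<^sup>+x. ennreal ((f x)\<^sup>2) \<partial>\<mu>) < \<infinity>"
    using f unfolding square_integrable_laguerre_iff by auto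
  note [measurable] = measurable_entire_bessel measurable_translation_weight
  define I where "I x = (\<integral>\<^sup>+\<theta>. ennreal (energy f (shift t x \<theta>)) \<partial>\<sigma>)" for x
  have [measurable]: "I \<in> borel_measurable borel" unfolding I_def
    by (intro ang.borel_measurable_nn_integral) (simp add: case_prod_beta')
  have "(\<integral>\<^sup>+x. I x \<partial>\<rho>) = (\<integral>\<^sup>+x. ennreal (exp (- x) * (f x)\<^sup>2) \<partial>\<rho>)"
    unfolding I_def by (rule nn_integral_translate[OF t]) measurable
  also have "\<dots> = (\<integral>\<^sup>+x. ennreal ((f x)\<^sup>2) \<partial>\<mu>)"
    by (subst nn_integral_laguerre) (auto simp: ennreal_mult)
  finally have "AE x in \<rho>. I x \<noteq> \<infinity>"
    using fin by (intro nn_integral_PInf_AE) auto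
  then show ?thesis unfolding AE_laguerre_iff_radial
  proof eventually_elim
    case (elim x)
    have i: "integrable \<sigma> (\<lambda>\<theta>. energy f (shift t x \<theta>))"
      using elim unfolding I_def by (intro integrableI_nonneg) (auto simp: top.not_eq_extremum)
    show ?case
    proof (rule Bochner_Integration.integrable_bound)
      show "integrable \<sigma> (\<lambda>\<theta>. exp ((x + t) / 2) * (1 + energy f (shift t x \<theta>)))"
        using i by auto
      show "AE \<theta> in \<sigma>. norm (f (shift t x \<theta>) * translation_weight t x \<theta>)
        \<le> norm (exp ((x + t) / 2) * (1 + energy f (shift t x \<theta>)))"
      proof (intro AE_I2)
        fix \<theta>
        define v where "v = \<bar>f (shift t x \<theta>)\<bar> * exp (- shift t x \<theta> / 2)"
        have "\<bar>f (shift t x \<theta>) * translation_weight t x \<theta>\<bar> \<le> \<bar>f (shift t x \<theta>)\<bar> * (exp ((x + t) / 2) * exp (- shift t x \<theta> / 2))"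
          unfolding abs_mult by (intro mult_left_mono abs_translation_weight_le) auto
        also have "\<dots> = exp ((x + t) / 2) * v" by (simp add: v_def)
        also have "v \<le> 1 + v\<^sup>2"
          using zero_le_power2[of "v - 1"] zero_le_power2[of v] by (simp add: power2_diff) (smt (verit) v_def abs_ge_zero exp_ge_zero mult_nonneg_nonneg)
        also have "v\<^sup>2 = energy f (shift t x \<theta>)"
          by (simp add: v_def power_mult_distrib flip: exp_of_nat_mult)
        finally show "norm (f (shift t x \<theta>) * translation_weight t x \<theta>)
        \<le> norm (exp ((x + t) / 2) * (1 + energy f (shift t x \<theta>)))"
          by (simp add: abs_mult abs_of_nonneg)
      qed
    qed measurable
  qed
qed

lemma AE_translation_diff:
  assumes t: "t \<ge> 0" and f: "L2 f" and g: "L2 g"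
  shows "AE x in \<mu>. T t (\<lambda>x. f x - g x) x = T t f x - T t g x"
proof (cases "t = 0")
  case True
  then show ?thesis by (simp add: laguerre_translation_0)
next
  case False
  with t have t: "t > 0" by simp
  have fg[measurable]: "f \<in> borel_measurable borel" "g \<in> borel_measurable borel"
    using f g unfolding square_integrable_laguerre_iff by auto
  show ?thesis
    using AE_integrable_translation[OF t f] AE_integrable_translation[OF t g]
  proof eventually_elim
    case (elim x)
    then show ?case using fg
      by (simp add: laguerre_translation_eq_angular left_diff_distrib)
  qed
qed

text \<open>
  Both sides are integrals over the coupling. The integrand is
  $f(y)e^{-y/2}\,g(x)e^{-x/2}\,j_{\alpha-1/2}(\sqrt{D}/2)\,e^{t/2}$ with $D$ the symmetric form
  \<open>triangle_form\<close>, so exchanging $f$ and $g$ amounts to exchanging the coordinates.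
\<close>

lemma translation_selfadjoint:
  assumes t: "t \<ge> 0" and f: "L2 f" and g: "L2 g"
  shows "(LINT x|\<mu>. T t f x * g x) = (LINT x|\<mu>. f x * T t g x)"
proof (cases "t = 0")
  case True
  then show ?thesis by (simp add: laguerre_translation_0)
next
  case False
  with t have t: "t > 0" by simp
  note [measurable] = measurable_entire_bessel measurable_translation_weight
  define H where "H f g p = f (snd p) * exp (- snd p / 2) * (g (fst p) * exp (- fst p / 2)) * (J (sqrt (triangle_form t (fst p) (snd p)) / 2) * exp (t / 2))"
    for f g :: "real \<Rightarrow> real" and p :: "real \<times> real"
  have Hm[measurable]: "H f g \<in> borel_measurable (borel \<Otimes>\<^sub>M borel)"
    if [measurable]: "f \<in> borel_measurable borel" "g \<in> borel_measurable borel" for f g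
    unfolding H_def by measurable
  have Hi: "integrable (translation_coupling t) (H f g)"
    if f: "L2 f" and g: "L2 g" for f g
  proof -
    have [measurable]: "f \<in> borel_measurable borel" "g \<in> borel_measurable borel"
      and fin: "(\<integral>\<^sup>+x. ennreal ((f x)\<^sup>2) \<partial>\<mu>) < \<infinity>" "(\<integral>\<^sup>+x. ennreal ((g x)\<^sup>2) \<partial>\<mu>) < \<infinity>"
      using f g unfolding square_integrable_laguerre_iff by auto
    have i1: "integrable (translation_coupling t) (\<lambda>p. exp (- fst p) * (h (fst p))\<^sup>2)"
      if [measurable]: "h \<in> borel_measurable borel" and fin: "(\<integral>\<^sup>+x. ennreal ((h x)\<^sup>2) \<partial>\<mu>) < \<infinity>" for h
    proof (rule integrableI_nonneg)
      have "(\<integral>\<^sup>+p. ennreal (exp (- fst p) * (h (fst p))\<^sup>2) \<partial>translation_coupling t)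
        = (\<integral>\<^sup>+x. ennreal (exp (- x) * (h x)\<^sup>2) \<partial>\<rho>)"
        by (subst nn_integral_coupling) (auto simp: emeasure_angular_UNIV)
      also have "\<dots> = (\<integral>\<^sup>+x. ennreal ((h x)\<^sup>2) \<partial>\<mu>)"
        by (subst nn_integral_laguerre) (auto simp: ennreal_mult)
      finally show "(\<integral>\<^sup>+p. ennreal (exp (- fst p) * (h (fst p))\<^sup>2) \<partial>translation_coupling t) < \<infinity>"
        using fin by simp
    qed auto
    have i2: "integrable (translation_coupling t) (\<lambda>p. exp (- snd p) * (h (snd p))\<^sup>2)"
      if h[measurable]: "h \<in> borel_measurable borel" and fin: "(\<integral>\<^sup>+x. ennreal ((h x)\<^sup>2) \<partial>\<mu>) < \<infinity>" for h
    proof -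
      have "integrable (distr (translation_coupling t) (borel \<Otimes>\<^sub>M borel) (\<lambda>p. (snd p, fst p))) (\<lambda>p. exp (- fst p) * (h (fst p))\<^sup>2)"
        unfolding translation_coupling_swap[OF t] by (rule i1[OF that])
      then show ?thesis by (subst (asm) integrable_distr_eq) auto
    qed
    show ?thesis
    proof (rule Bochner_Integration.integrable_bound)
      show "integrable (translation_coupling t) (\<lambda>p. exp (t / 2) * (exp (- snd p) * (f (snd p))\<^sup>2 + exp (- fst p) * (g (fst p))\<^sup>2))"
        by (intro integrable_mult_right Bochner_Integration.integrable_add i1 i2 fin) measurable
      show "AE p in translation_coupling t. norm (H f g p) \<le> norm (exp (t / 2) * (exp (- snd p) * (f (snd p))\<^sup>2 + exp (- fst p) * (g (fst p))\<^sup>2))"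
      proof (intro AE_I2)
        fix p :: "real \<times> real"
        define u where "u = f (snd p) * exp (- snd p / 2)"
        define v where "v = g (fst p) * exp (- fst p / 2)"
        have uv: "u\<^sup>2 = exp (- snd p) * (f (snd p))\<^sup>2" "v\<^sup>2 = exp (- fst p) * (g (fst p))\<^sup>2"
          by (simp_all add: u_def v_def power_mult_distrib flip: exp_of_nat_mult)
        have "2 * (abs u * abs v) \<le> u\<^sup>2 + v\<^sup>2"
          using zero_le_power2[of "abs u - abs v"] by (simp add: power2_diff)
        moreover have "0 \<le> abs u * abs v" by simp
        ultimately have "abs u * abs v \<le> u\<^sup>2 + v\<^sup>2" by linarith
        then have "(abs u * abs v) * (\<bar>J (sqrt (triangle_form t (fst p) (snd p)) / 2)\<bar> * exp (t / 2)) \<le> (u\<^sup>2 + v\<^sup>2) * (1 * exp (t / 2))"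
          using \<alpha> by (intro mult_mono abs_entire_bessel_le_1) auto
        then show "norm (H f g p) \<le> norm (exp (t / 2) * (exp (- snd p) * (f (snd p))\<^sup>2 + exp (- fst p) * (g (fst p))\<^sup>2))"
          unfolding H_def u_def[symmetric] v_def[symmetric] uv[symmetric] by (simp add: abs_mult mult_ac)
      qed
    qed measurable
  qed
  have main: "(LINT x|\<mu>. T t f x * g x) = integral\<^sup>L (translation_coupling t) (H f g)"
    if f: "L2 f" and g: "L2 g" for f g
  proof -
    have fg[measurable]: "f \<in> borel_measurable borel" "g \<in> borel_measurable borel"
      using f g unfolding square_integrable_laguerre_iff by auto
    note [measurable] = laguerre_translation_measurable[OF fg(1)]
    have "integrable (\<rho> \<Otimes>\<^sub>M \<sigma>) (\<lambda>p. H f g (fst p, shift t (fst p) (snd p)))"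
      using Hi[OF f g] unfolding translation_coupling_def by (subst (asm) integrable_distr_eq) auto
    then have "(LINT x|\<rho>. LINT \<theta>|\<sigma>. H f g (x, shift t x \<theta>))
      = (LINT p|(\<rho> \<Otimes>\<^sub>M \<sigma>). H f g (fst p, shift t (fst p) (snd p)))"
      by (subst pr.integral_fst'[symmetric]) auto
    also have "\<dots> = integral\<^sup>L (translation_coupling t) (H f g)"
      unfolding translation_coupling_def by (subst integral_distr) auto
    also have "(LINT x|\<rho>. LINT \<theta>|\<sigma>. H f g (x, shift t x \<theta>))
      = (LINT x|\<rho>. exp (- x) *\<^sub>R (T t f x * g x))"
    proof (rule integral_cong_AE)
      show "AE x in \<rho>. (LINT \<theta>|\<sigma>. H f g (x, shift t x \<theta>)) = exp (- x) *\<^sub>R (T t f x * g x)"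
        using AE_radial_pos
      proof eventually_elim
        case (elim x)
        have "AE \<theta> in \<sigma>. H f g (x, shift t x \<theta>) = (exp (- x) * g x) * (f (shift t x \<theta>) * translation_weight t x \<theta>)"
          unfolding angular_measure_def
        proof (subst AE_density, measurable, intro AE_I2 impI)
          fix \<theta> assume "0 < ennreal (indicator {0<..<pi} \<theta> * (norm_const * sin \<theta> powr (2 * \<alpha>)))"
          then have "\<theta> \<in> {0<..<pi}" by (cases "\<theta> \<in> {0<..<pi}") auto
          then have sp: "sin \<theta> > 0" by (auto intro!: sin_gt_zero)
          have h: "sqrt (triangle_form t x (shift t x \<theta>)) / 2 = sqrt (x * t) * sin \<theta>"
            using elim t sp by (subst triangle_form_shift) (auto simp: real_sqrt_mult abs_mult)
          have e: "exp (- shift t x \<theta> / 2) * exp (- x / 2) * exp (t / 2) = exp (- x) * exp (- (sqrt (x * t) * cos \<theta>))"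
            by (simp add: shift_def field_simps flip: exp_add)
          have "H f g (x, shift t x \<theta>) = f (shift t x \<theta>) * g x * (exp (- shift t x \<theta> / 2) * exp (- x / 2) * exp (t / 2)) * J (sqrt (x * t) * sin \<theta>)"
            unfolding H_def fst_conv snd_conv h by (simp only: mult_ac)
          also have "\<dots> = (exp (- x) * g x) * (f (shift t x \<theta>) * translation_weight t x \<theta>)"
            unfolding e translation_weight_def by (simp only: mult_ac)
          finally show "H f g (x, shift t x \<theta>) = \<dots>" .
        qed
        note ae = this
        have "(LINT \<theta>|\<sigma>. H f g (x, shift t x \<theta>)) = (LINT \<theta>|\<sigma>. (exp (- x) * g x) * (f (shift t x \<theta>) * translation_weight t x \<theta>))"
          by (rule integral_cong_AE[OF _ _ ae]) measurable
        then show ?case by (simp add: laguerre_translation_eq_angular[OF fg(1)])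
      qed
    qed (auto intro!: ang.borel_measurable_lebesgue_integral)
    also have "\<dots> = (LINT x|\<mu>. T t f x * g x)"
      unfolding laguerre_measure_def by (rule integral_density[symmetric]) auto
    finally show ?thesis .
  qed
  have [measurable]: "f \<in> borel_measurable borel" "g \<in> borel_measurable borel"
      using f g unfolding square_integrable_laguerre_iff by auto
  have "integral\<^sup>L (translation_coupling t) (H f g) = integral\<^sup>L (distr (translation_coupling t) (borel \<Otimes>\<^sub>M borel) (\<lambda>p. (snd p, fst p))) (H f g)"
    by (simp add: translation_coupling_swap[OF t])
  also have "\<dots> = (LINT p|translation_coupling t. H f g (snd p, fst p))"
    by (subst integral_distr) auto
  also have "\<dots> = integral\<^sup>L (translation_coupling t) (H g f)"
    by (intro Bochner_Integration.integral_cong refl)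
       (unfold H_def fst_conv snd_conv triangle_form_commute[of t "snd _" "fst _"], simp only: mult_ac)
  finally show ?thesis using main[OF f g] main[OF g f] by (simp add: mult.commute)
qed

section \<open>Translation of polynomials\<close>

text \<open>
  The moments of \<open>shift\<close> against the kernel. Their generating function in $a$ is the integral of Sonine
  type with $A=(1+2a)s$ and $B=s$, where $A^2-B^2=4s^2(a+a^2)$. Comparing coefficients shows that the
  $j$-th moment is a polynomial of degree at most $j$ in $s^2=xt$.
\<close>

lemma angular_moment:
  "(LINT \<theta>|\<sigma>. (- 2 * s * cos \<theta>) ^ j / fact j * (exp (- (s * cos \<theta>)) * J (s * sin \<theta>)))
    = (\<Sum>k\<le>j. (s\<^sup>2) ^ k / (fact k * pochhammer (\<alpha> + 1) k) * real (k choose (j - k)))" (is "?m j = ?c j")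
proof (rule powser_eqD)
  note mb [measurable] = measurable_entire_bessel
  define W where "W \<theta> = exp (- (s * cos \<theta>)) * J (s * sin \<theta>)" for \<theta>
  have [measurable]: "W \<in> borel_measurable borel" unfolding W_def by measurable
  have Wle: "\<bar>W \<theta>\<bar> \<le> exp \<bar>s\<bar>" for \<theta>
  proof -
    have "- (s * cos \<theta>) \<le> \<bar>s\<bar> * \<bar>cos \<theta>\<bar>" by (metis abs_ge_minus_self abs_mult)
    also have "\<dots> \<le> \<bar>s\<bar> * 1" by (intro mult_left_mono) auto
    finally have "exp (- (s * cos \<theta>)) \<le> exp \<bar>s\<bar>" by simp
    then have "\<bar>exp (- (s * cos \<theta>))\<bar> * \<bar>J (s * sin \<theta>)\<bar> \<le> exp \<bar>s\<bar> * 1"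
      using \<alpha> by (intro mult_mono abs_entire_bessel_le_1) auto
    then show ?thesis by (simp add: W_def abs_mult)
  qed
  fix a :: real
  define f where "f j \<theta> = (- 2 * s * a * cos \<theta>) ^ j / fact j * W \<theta>" for j \<theta>
  define C where "C j = (2 * \<bar>s\<bar> * \<bar>a\<bar>) ^ j / fact j * exp \<bar>s\<bar>" for j :: nat
  have fC: "\<bar>f j \<theta>\<bar> \<le> C j" for j \<theta>
  proof -
    have "\<bar>- 2 * s * a * cos \<theta>\<bar> = 2 * \<bar>s\<bar> * \<bar>a\<bar> * \<bar>cos \<theta>\<bar>" by (simp add: abs_mult)
    also have "\<dots> \<le> 2 * \<bar>s\<bar> * \<bar>a\<bar> * 1" by (intro mult_left_mono) auto
    finally have "\<bar>(- 2 * s * a * cos \<theta>) ^ j / fact j\<bar> \<le> (2 * \<bar>s\<bar> * \<bar>a\<bar>) ^ j / fact j"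
      unfolding abs_divide power_abs by (intro divide_right_mono power_mono frac_le) auto
    then show ?thesis unfolding f_def C_def abs_mult[of "_ / _"]
      by (intro mult_mono Wle) auto
  qed
  have Cs: "summable C" unfolding C_def
    using summable_exp[of "2 * \<bar>s\<bar> * \<bar>a\<bar>"] by (intro summable_mult2) (simp add: divide_inverse mult.commute)
  have fs: "(\<lambda>j. f j \<theta>) sums (exp (- (((1 + 2 * a) * s) * cos \<theta>)) * J (s * sin \<theta>))" for \<theta>
  proof -
    have "(\<lambda>j. f j \<theta>) sums (exp (- 2 * s * a * cos \<theta>) * W \<theta>)"
      unfolding f_def using exp_converges[of "- 2 * s * a * cos \<theta>"]
      by (intro sums_mult2) (simp add: divide_inverse mult.commute)
    also have "exp (- 2 * s * a * cos \<theta>) * W \<theta> = exp (- (((1 + 2 * a) * s) * cos \<theta>)) * J (s * sin \<theta>)"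
      by (simp add: W_def algebra_simps flip: exp_add)
    finally show ?thesis .
  qed
  have "f j \<in> borel_measurable borel" for j unfolding f_def by measurable
  then have "(\<lambda>j. integral\<^sup>L \<sigma> (f j)) sums (LINT \<theta>|\<sigma>. exp (- (((1 + 2 * a) * s) * cos \<theta>)) * J (s * sin \<theta>))"
    by (rule sums_integral_angular[OF _ fC Cs fs])
  also have "(LINT \<theta>|\<sigma>. exp (- (((1 + 2 * a) * s) * cos \<theta>)) * J (s * sin \<theta>))
     = bessel_series (\<alpha> + 1) ((((1 + 2 * a) * s)\<^sup>2 - s\<^sup>2) / 4)"
    by (rule integral_angular_exp_bessel)
  also have "(((1 + 2 * a) * s)\<^sup>2 - s\<^sup>2) / 4 = s\<^sup>2 * (a + a\<^sup>2)"
    by (simp add: power2_eq_square algebra_simps)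
  also have "(\<lambda>j. integral\<^sup>L \<sigma> (f j)) = (\<lambda>j. ?m j * a ^ j)"
  proof
    fix j
    have "(- 2 * s * a * cos \<theta>) ^ j = (- 2 * s * cos \<theta>) ^ j * a ^ j" for \<theta>
      unfolding power_mult_distrib[symmetric] by (simp only: mult_ac)
    then have "f j = (\<lambda>\<theta>. (- 2 * s * cos \<theta>) ^ j / fact j * W \<theta> * a ^ j)"
      by (simp add: f_def fun_eq_iff)
    then show "integral\<^sup>L \<sigma> (f j) = ?m j * a ^ j" by (simp add: W_def)
  qed
  finally show "(\<lambda>j. ?m j * a ^ j) sums bessel_series (\<alpha> + 1) (s\<^sup>2 * (a + a\<^sup>2))" .
  have "(\<lambda>j. ?c j * a ^ j) sums (\<Sum>k. (s\<^sup>2) ^ k / (fact k * pochhammer (\<alpha> + 1) k) * (a + a\<^sup>2) ^ k)"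
  proof (rule sums_compose_quadratic)
    fix w :: real
    show "summable (\<lambda>k. norm ((s\<^sup>2) ^ k / (fact k * pochhammer (\<alpha> + 1) k) * w ^ k))"
      using bessel_series_norm_summable[of "\<alpha> + 1" "s\<^sup>2 * w"] \<alpha> by (simp add: power_mult_distrib)
  qed
  then show "(\<lambda>j. ?c j * a ^ j) sums bessel_series (\<alpha> + 1) (s\<^sup>2 * (a + a\<^sup>2))"
    by (simp add: bessel_series_def power_mult_distrib)
qed

lemma translation_power_poly:
  assumes t: "t \<ge> 0"
  obtains q :: "real poly" where "degree q \<le> n" "\<And>x. x \<ge> 0 \<Longrightarrow> T t (\<lambda>y. y ^ n) x = poly q x"
proof
  define m :: "nat \<Rightarrow> real poly" where
    "m j = (\<Sum>k\<le>j. smult (t ^ k / (fact k * pochhammer (\<alpha> + 1) k) * real (k choose (j - k))) (monom 1 k))" for j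
  define q where "q = (\<Sum>j\<le>n. smult (real (n choose j) * (-1) ^ j * fact j) ([:t, 1:] ^ (n - j) * m j))"
  have dm: "degree (m j) \<le> j" for j unfolding m_def
    by (intro degree_sum_le) (auto intro: order_trans[OF degree_smult_le] simp: degree_monom_eq)
  show "degree q \<le> n" unfolding q_def
  proof (intro degree_sum_le order_trans[OF degree_smult_le])
    fix j assume "j \<in> {..n}"
    have "degree ([:t, 1:] ^ (n - j) * m j) \<le> degree ([:t, 1:] ^ (n - j)) + degree (m j)" by (rule degree_mult_le)
    also have "\<dots> \<le> (n - j) + j" by (intro add_mono dm order_trans[OF degree_power_le]) auto
    finally show "degree ([:t, 1:] ^ (n - j) * m j) \<le> n" using \<open>j \<in> {..n}\<close> by simp
  qed auto
  fix x :: real assume x: "x \<ge> 0"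
  define s where "s = sqrt (x * t)"
  have s: "s\<^sup>2 = x * t" using x t by (simp add: s_def)
  define W where "W \<theta> = exp (- (s * cos \<theta>)) * J (s * sin \<theta>)" for \<theta>
  have Wc: "continuous_on UNIV W" unfolding W_def using \<alpha>
    by (intro continuous_intros continuous_on_compose2[OF continuous_on_entire_bessel[of "\<alpha> - 1/2" UNIV]]) auto
  have "T t (\<lambda>y. y ^ n) x = (LINT \<theta>|\<sigma>. (shift t x \<theta>) ^ n * W \<theta>)"
    by (subst laguerre_translation_eq_angular) (auto simp: translation_weight_def W_def s_def)
  also have "\<dots> = (LINT \<theta>|\<sigma>. (\<Sum>j\<le>n. (real (n choose j) * (-1) ^ j * fact j * (x + t) ^ (n - j)) * ((- 2 * s * cos \<theta>) ^ j / fact j * W \<theta>)))"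
  proof (rule Bochner_Integration.integral_cong[OF refl])
    fix \<theta>
    have "shift t x \<theta> ^ n = ((-1) * (- 2 * s * cos \<theta>) + (x + t)) ^ n"
      by (simp add: shift_def s_def add_ac)
    also have "\<dots> = (\<Sum>j\<le>n. real (n choose j) * ((-1) * (- 2 * s * cos \<theta>)) ^ j * (x + t) ^ (n - j))"
      by (rule binomial_ring)
    also have "\<dots> = (\<Sum>j\<le>n. real (n choose j) * ((-1) ^ j * (- 2 * s * cos \<theta>) ^ j) * (x + t) ^ (n - j))"
      by (simp only: power_mult_distrib[of "-1" "- 2 * s * cos \<theta>"])
    finally have e: "shift t x \<theta> ^ n = \<dots>" .
    show "shift t x \<theta> ^ n * W \<theta> = (\<Sum>j\<le>n. (real (n choose j) * (-1) ^ j * fact j * (x + t) ^ (n - j)) * ((- 2 * s * cos \<theta>) ^ j / fact j * W \<theta>))"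
      unfolding e sum_distrib_right by (intro sum.cong) (auto simp: field_simps)
  qed
  also have "\<dots> = (\<Sum>j\<le>n. (real (n choose j) * (-1) ^ j * fact j * (x + t) ^ (n - j)) * (LINT \<theta>|\<sigma>. (- 2 * s * cos \<theta>) ^ j / fact j * W \<theta>))"
    by (subst Bochner_Integration.integral_sum)
       (auto intro!: integrable_angular_continuous continuous_intros Wc)
  also have "\<dots> = (\<Sum>j\<le>n. (real (n choose j) * (-1) ^ j * fact j * (x + t) ^ (n - j)) * poly (m j) x)"
  proof (intro sum.cong refl arg_cong2[where f = "(*)"])
    fix j
    show "(LINT \<theta>|\<sigma>. (- 2 * s * cos \<theta>) ^ j / fact j * W \<theta>) = poly (m j) x"
      unfolding W_def angular_moment s m_def
      by (simp add: poly_sum poly_monom power_mult_distrib mult_ac)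
  qed
  also have "\<dots> = poly q x"
    by (simp add: q_def poly_sum mult_ac add_ac)
  finally show "T t (\<lambda>y. y ^ n) x = poly q x" .
qed

text \<open>
  Translation in $x$ does not raise the degree: the $j$-th moment has degree at most $j$ in $x$ and is
  multiplied by $(x+t)^{n-j}$.
\<close>

lemma translation_poly:
  assumes t: "t \<ge> 0"
  shows "\<exists>q. degree q \<le> degree p \<and> (\<forall>x\<ge>0. T t (poly p) x = poly q x)"
proof -
  have "\<forall>n. \<exists>q. degree q \<le> n \<and> (\<forall>x\<ge>0. T t (\<lambda>y. y ^ n) x = poly q x)"
    using translation_power_poly[OF t] by metis
  then obtain Q where Q: "\<And>n. degree (Q n) \<le> n" "\<And>n x. x \<ge> 0 \<Longrightarrow> T t (\<lambda>y. y ^ n) x = poly (Q n) x"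
    by metis
  define q where "q = (\<Sum>i\<le>degree p. smult (coeff p i) (Q i))"
  have "degree q \<le> degree p" unfolding q_def
    by (intro degree_sum_le order_trans[OF degree_smult_le] order_trans[OF Q(1)]) auto
  moreover have "T t (poly p) x = poly q x" if x: "x \<ge> 0" for x
  proof -
    have Wc: "continuous_on UNIV (translation_weight t x)" unfolding translation_weight_def using \<alpha>
      by (intro continuous_intros continuous_on_compose2[OF continuous_on_entire_bessel[of "\<alpha> - 1/2" UNIV]]) auto
    have Sc: "continuous_on UNIV (shift t x)" unfolding shift_def
      by (intro continuous_intros)
    have [measurable]: "poly p \<in> borel_measurable borel"
      by (intro borel_measurable_continuous_onI continuous_intros)
    have "T t (poly p) x = (LINT \<theta>|\<sigma>. (\<Sum>i\<le>degree p. coeff p i * ((shift t x \<theta>) ^ i * translation_weight t x \<theta>)))"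
      by (subst laguerre_translation_eq_angular) (auto simp: poly_altdef sum_distrib_right mult.assoc)
    also have "\<dots> = (\<Sum>i\<le>degree p. coeff p i * (LINT \<theta>|\<sigma>. (shift t x \<theta>) ^ i * translation_weight t x \<theta>))"
      by (subst Bochner_Integration.integral_sum)
         (auto intro!: integrable_angular_continuous continuous_intros Wc Sc)
    also have "\<dots> = (\<Sum>i\<le>degree p. coeff p i * T t (\<lambda>y. y ^ i) x)"
      by (subst laguerre_translation_eq_angular) auto
    also have "\<dots> = poly q x" using x by (simp add: q_def Q(2) poly_sum)
    finally show ?thesis .
  qed
  ultimately show ?thesis by blast
qed

section \<open>Laguerre polynomials and the product formula\<close>

lemma nn_integral_exp_power_laguerre:
  assumes l: "l \<ge> 0"
  shows "(\<integral>\<^sup>+x. ennreal (\<bar>x\<bar> ^ m * exp (- l * x)) \<partial>\<mu>)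
     = ennreal (Gamma (\<alpha> + real m + 1) / (1 + l) powr (\<alpha> + real m + 1))"
proof -
  define s where "s = \<alpha> + real m + 1"
  have s: "s > 0" using \<alpha> by (simp add: s_def)
  have "(\<integral>\<^sup>+x. ennreal (\<bar>x\<bar> ^ m * exp (- l * x)) \<partial>\<mu>)
     = (\<integral>\<^sup>+x. ennreal (exp (- x) * (\<bar>x\<bar> ^ m * exp (- l * x))) \<partial>\<rho>)"
    by (subst nn_integral_laguerre) (auto simp: ennreal_mult)
  also have "\<dots> = (\<integral>\<^sup>+x. ennreal (indicator {0<..} x * x powr \<alpha>) * ennreal (exp (- x) * (\<bar>x\<bar> ^ m * exp (- l * x))) \<partial>lborel)"
    unfolding radial_measure_def by (subst nn_integral_density) auto
  also have "\<dots> = (\<integral>\<^sup>+x. ennreal (indicator {0<..} x * (x powr (s - 1) / exp ((1 + l) * x))) \<partial>lborel)"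
  proof (intro nn_integral_cong)
    fix x :: real
    show "ennreal (indicator {0<..} x * x powr \<alpha>) * ennreal (exp (- x) * (\<bar>x\<bar> ^ m * exp (- l * x)))
      = ennreal (indicator {0<..} x * (x powr (s - 1) / exp ((1 + l) * x)))"
    proof (cases "x > 0")
      case True
      have "x powr (s - 1) = x powr \<alpha> * x ^ m" using True by (simp add: s_def powr_add powr_realpow)
      moreover have "1 / exp ((1 + l) * x) = exp (- x) * exp (- l * x)"
        by (simp add: exp_minus[symmetric] inverse_eq_divide[symmetric] flip: exp_add) (simp add: algebra_simps)
      ultimately have "x powr (s - 1) / exp ((1 + l) * x) = x powr \<alpha> * (exp (- x) * (x ^ m * exp (- l * x)))"
        by (simp add: divide_inverse mult_ac)
      then show ?thesis using True by (simp add: ennreal_mult)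
    qed auto
  qed
  also have "\<dots> = ennreal (inverse (1 + l)) * (\<integral>\<^sup>+x. ennreal (indicator {0<..} x * ((x / (1 + l)) powr (s - 1) / exp x)) \<partial>lborel)"
    using l by (subst nn_integral_real_affine[of _ "inverse (1 + l)" 0])
       (auto intro!: arg_cong2[where f="(*)"] nn_integral_cong simp: divide_inverse mult.commute indicator_def zero_less_mult_iff)
  also have "(\<integral>\<^sup>+x. ennreal (indicator {0<..} x * ((x / (1 + l)) powr (s - 1) / exp x)) \<partial>lborel)
     = (\<integral>\<^sup>+x. ennreal (inverse ((1 + l) powr (s - 1))) * ennreal (indicator {0..} x * x powr (s - 1) / exp x) \<partial>lborel)"
  proof (intro nn_integral_cong_AE AE_I[of _ _ "{0}"] subsetI)
    fix x :: real
    assume x: "x \<in> {x \<in> space lborel. ennreal (indicator {0<..} x * ((x / (1 + l)) powr (s - 1) / exp x))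
      \<noteq> ennreal (inverse ((1 + l) powr (s - 1))) * ennreal (indicator {0..} x * x powr (s - 1) / exp x)}"
    have "x \<le> 0"
    proof (rule ccontr)
      assume "\<not> x \<le> 0"
      then have "(x / (1 + l)) powr (s - 1) = x powr (s - 1) / (1 + l) powr (s - 1)"
        by (simp only: powr_divide)
      then show False using x \<open>\<not> x \<le> 0\<close> by (simp add: ennreal_mult[symmetric] field_simps)
    qed
    then show "x \<in> {0}" using x by (auto simp: indicator_def split: if_splits)
  qed simp_all
  also have "\<dots> = ennreal (inverse ((1 + l) powr (s - 1))) * ennreal (Gamma s)"
    by (subst nn_integral_cmult) (auto simp: Gamma_conv_nn_integral_real[OF s])
  also have "ennreal (inverse (1 + l)) * (ennreal (inverse ((1 + l) powr (s - 1))) * ennreal (Gamma s))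
     = ennreal (Gamma s / (1 + l) powr s)"
  proof -
    have "(1 + l) powr s = (1 + l) powr (s - 1) * (1 + l)"
      using l powr_add[of "1 + l" "s - 1" 1] by simp
    then show ?thesis using l s Gamma_real_pos[OF s]
      by (simp add: ennreal_mult[symmetric] field_simps)
  qed
  finally show ?thesis by (simp add: s_def)
qed

lemma has_bochner_integral_exp_power:
  assumes l: "l \<ge> 0"
  shows "has_bochner_integral \<mu> (\<lambda>x. x ^ m * exp (- l * x)) (Gamma (\<alpha> + real m + 1) / (1 + l) powr (\<alpha> + real m + 1))"
proof (rule has_bochner_integral_nn_integral)
  show "(\<lambda>x. x ^ m * exp (- l * x)) \<in> borel_measurable \<mu>" by measurable
  show "AE x in \<mu>. 0 \<le> x ^ m * exp (- l * x)" using AE_laguerre_pos by eventually_elim simp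
  show "0 \<le> Gamma (\<alpha> + real m + 1) / (1 + l) powr (\<alpha> + real m + 1)"
    using \<alpha> by (intro divide_nonneg_nonneg Gamma_real_nonneg) auto
  have "(\<integral>\<^sup>+x. ennreal (x ^ m * exp (- l * x)) \<partial>\<mu>) = (\<integral>\<^sup>+x. ennreal (\<bar>x\<bar> ^ m * exp (- l * x)) \<partial>\<mu>)"
    by (intro nn_integral_cong_AE) (use AE_laguerre_pos in eventually_elim, auto)
  then show "(\<integral>\<^sup>+x. ennreal (x ^ m * exp (- l * x)) \<partial>\<mu>) = ennreal (Gamma (\<alpha> + real m + 1) / (1 + l) powr (\<alpha> + real m + 1))"
    using nn_integral_exp_power_laguerre[OF l] by simp
qed

lemma integral_power_laguerre:
  "integrable \<mu> (\<lambda>x. x ^ m)" "(LINT x|\<mu>. x ^ m) = Gamma (\<alpha> + real m + 1)"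
  using has_bochner_integral_exp_power[of 0 m] by (auto simp: has_bochner_integral_iff)

lemma finite_measure_laguerre:
  "finite_measure \<mu>"
  using nn_integral_exp_power_laguerre[of 0 0] by (intro finite_measureI) simp

lemma integrable_poly_laguerre:
  "integrable \<mu> (poly p)"
  unfolding poly_altdef using integral_power_laguerre by auto

lemma borel_measurable_poly [measurable]: "poly (p :: real poly) \<in> borel_measurable borel"
  by (intro borel_measurable_continuous_onI continuous_intros)

lemma square_integrable_poly:
  "L2 (poly p)"
  unfolding square_integrable_def
  using integrable_poly_laguerre[of "p ^ 2"] by (simp add: poly_power[abs_def])

text \<open>
  A nonzero polynomial has finitely many roots, and these have measure zero.
\<close>

lemma poly_zero_of_integral_square_zero:
  assumes z: "(LINT x|\<mu>. (poly p x)\<^sup>2) = 0"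
  shows "p = 0"
proof (rule ccontr)
  assume p: "p \<noteq> 0"
  have "AE x in \<mu>. (poly p x)\<^sup>2 = 0"
    using square_integrable_poly[of p] z
    by (subst (asm) integral_nonneg_eq_0_iff_AE) (auto simp: square_integrable_def)
  then have ae: "AE x in \<mu>. x \<in> {x. poly p x = 0}" by simp
  have fin: "finite {x. poly p x = 0}" using p by (rule poly_roots_finite)
  have "AE x in lborel. x \<notin> {x. poly p x = 0}"
    using fin by (intro AE_not_in) (auto intro: finite_imp_null_set_lborel)
  then have "AE x in \<mu>. x \<notin> {x. poly p x = 0}"
    unfolding AE_laguerre_iff_radial unfolding radial_measure_def by (subst AE_density) auto
  with ae have "AE x in \<mu>. False" by eventually_elim auto
  then have "emeasure \<mu> (space \<mu>) = 0"
    by (simp add: AE_iff_measurable[OF _ refl])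
  moreover have "emeasure \<mu> (space \<mu>) = ennreal (Gamma (\<alpha> + 1))"
    using nn_integral_exp_power_laguerre[of 0 0] by simp
  moreover have "Gamma (\<alpha> + 1) > 0" using \<alpha> by (intro Gamma_real_pos) auto
  ultimately show False by simp
qed

text \<open>
  The Laguerre polynomial as an element of the polynomial ring, where it has a degree and a leading
  coefficient.
\<close>

definition laguerre_polynomial :: "nat \<Rightarrow> real poly" where
  "laguerre_polynomial n = (\<Sum>k\<le>n. monom ((- 1) ^ k * ((real n + \<alpha>) gchoose (n - k)) / fact k) k)"

lemma poly_laguerre_polynomial: "poly (laguerre_polynomial n) x = L n x"
  by (simp add: laguerre_polynomial_def laguerre_poly_def poly_sum poly_monom)

lemma coeff_laguerre_polynomial_top: "coeff (laguerre_polynomial n) n = (- 1) ^ n / fact n"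
  unfolding laguerre_polynomial_def by (simp add: coeff_sum)

lemma degree_laguerre_polynomial: "degree (laguerre_polynomial n) = n"
proof (rule antisym)
  show "degree (laguerre_polynomial n) \<le> n" unfolding laguerre_polynomial_def
    by (intro degree_sum_le) (auto intro: order_trans[OF degree_monom_le])
  show "n \<le> degree (laguerre_polynomial n)"
    by (intro le_degree) (simp add: coeff_laguerre_polynomial_top)
qed

lemma laguerre_weight_Gamma:
  assumes "k \<le> n"
  shows "((real n + \<alpha>) gchoose (n - k)) / fact k * Gamma (\<alpha> + real k + 1) = Gamma (\<alpha> + real n + 1) / fact n * real (n choose k)"
proof -
  have "real n + \<alpha> - real (n - k) + 1 = \<alpha> + real k + 1" using \<alpha> assms by (simp add: of_nat_diff)
  then have 1: "((real n + \<alpha>) gchoose (n - k)) = pochhammer (\<alpha> + real k + 1) (n - k) / fact (n - k)"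
    by (subst gbinomial_pochhammer') simp
  have "\<alpha> + real k + 1 \<notin> \<int>\<^sub>\<le>\<^sub>0" using \<alpha> assms by (auto dest: nonpos_Ints_nonpos)
  then have 2: "pochhammer (\<alpha> + real k + 1) (n - k) = Gamma (\<alpha> + real n + 1) / Gamma (\<alpha> + real k + 1)"
    using \<alpha> assms by (subst pochhammer_Gamma) (auto simp: of_nat_diff add_ac)
  have "Gamma (\<alpha> + real k + 1) > 0" using \<alpha> assms by (intro Gamma_real_pos) auto
  then show ?thesis unfolding 1 2 binomial_fact[OF assms] by (simp add: field_simps)
qed

text \<open>
  The Fourier-Laguerre coefficients of an exponential, by the Gamma integral and the binomial theorem.
\<close>

lemma integral_exp_laguerre:
  assumes l: "l \<ge> 0"
  shows "(LINT x|\<mu>. exp (- l * x) * L n x)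
     = Gamma (\<alpha> + real n + 1) / fact n * (1 + l) powr (- \<alpha> - 1) * (l / (1 + l)) ^ n"
proof -
  note I = has_bochner_integral_exp_power[OF l, unfolded has_bochner_integral_iff]
  have "(LINT x|\<mu>. exp (- l * x) * L n x)
    = (LINT x|\<mu>. (\<Sum>k\<le>n. ((- 1) ^ k * ((real n + \<alpha>) gchoose (n - k)) / fact k) * (x ^ k * exp (- l * x))))"
    unfolding laguerre_poly_def by (simp add: sum_distrib_left mult_ac)
  also have "\<dots> = (\<Sum>k\<le>n. ((- 1) ^ k * ((real n + \<alpha>) gchoose (n - k)) / fact k) * (Gamma (\<alpha> + real k + 1) / (1 + l) powr (\<alpha> + real k + 1)))"
    using I by (subst Bochner_Integration.integral_sum) (auto intro!: integrable_mult_right simp: mult.commute[of "fact _"])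
  also have "\<dots> = (\<Sum>k\<le>n. Gamma (\<alpha> + real n + 1) / fact n * (1 + l) powr (- \<alpha> - 1) * (real (n choose k) * (- 1 / (1 + l)) ^ k * 1 ^ (n - k)))"
  proof (intro sum.cong refl)
    fix k assume "k \<in> {..n}"
    then have k: "k \<le> n" by simp
    have "(1 + l) powr (\<alpha> + real k + 1) = (1 + l) powr (\<alpha> + 1 + real k)" by (simp add: add_ac)
    also have "\<dots> = (1 + l) powr (\<alpha> + 1) * (1 + l) ^ k" using l by (simp add: powr_add powr_realpow)
    finally have 1: "(1 + l) powr (\<alpha> + real k + 1) = \<dots>" .
    have "((- 1) ^ k * ((real n + \<alpha>) gchoose (n - k)) / fact k) * (Gamma (\<alpha> + real k + 1) / (1 + l) powr (\<alpha> + real k + 1))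
      = (- 1) ^ k * (((real n + \<alpha>) gchoose (n - k)) / fact k * Gamma (\<alpha> + real k + 1)) / ((1 + l) powr (\<alpha> + 1) * (1 + l) ^ k)"
      unfolding 1 by (simp add: mult_ac)
    also have "\<dots> = Gamma (\<alpha> + real n + 1) / fact n * (1 / (1 + l) powr (\<alpha> + 1)) * (real (n choose k) * ((- 1) ^ k / (1 + l) ^ k))"
      unfolding laguerre_weight_Gamma[OF k] by (simp add: mult_ac)
    also have "1 / (1 + l) powr (\<alpha> + 1) = (1 + l) powr (- \<alpha> - 1)"
      using powr_minus[of "1 + l" "\<alpha> + 1"] by (simp add: inverse_eq_divide)
    finally show "((- 1) ^ k * ((real n + \<alpha>) gchoose (n - k)) / fact k) * (Gamma (\<alpha> + real k + 1) / (1 + l) powr (\<alpha> + real k + 1))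
      = Gamma (\<alpha> + real n + 1) / fact n * (1 + l) powr (- \<alpha> - 1) * (real (n choose k) * (- 1 / (1 + l)) ^ k * 1 ^ (n - k))"
      by (simp only: power_divide power_one mult_1_right)
  qed
  also have "\<dots> = Gamma (\<alpha> + real n + 1) / fact n * (1 + l) powr (- \<alpha> - 1) * (- 1 / (1 + l) + 1) ^ n"
    unfolding binomial_ring sum_distrib_left ..
  also have "- 1 / (1 + l) + 1 = l / (1 + l)" using l by (simp add: field_simps)
  finally show ?thesis .
qed

lemma integral_power_mult_laguerre:
  assumes m: "m \<le> n"
  shows "(LINT x|\<mu>. x ^ m * L n x) = (if m = n then (- 1) ^ n * Gamma (\<alpha> + real n + 1) else 0)"
proof -
  note I = integral_power_laguerre
  have "(LINT x|\<mu>. x ^ m * L n x)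
    = (LINT x|\<mu>. (\<Sum>k\<le>n. ((- 1) ^ k * ((real n + \<alpha>) gchoose (n - k)) / fact k) * x ^ (k + m)))"
    unfolding laguerre_poly_def by (simp add: sum_distrib_left power_add mult_ac)
  also have "\<dots> = (\<Sum>k\<le>n. ((- 1) ^ k * ((real n + \<alpha>) gchoose (n - k)) / fact k) * Gamma (\<alpha> + real (k + m) + 1))"
    using I by (subst Bochner_Integration.integral_sum) (auto intro!: integrable_mult_right)
  also have "\<dots> = (\<Sum>k\<le>n. Gamma (\<alpha> + real n + 1) / fact n * ((- 1) ^ k * real (n choose k) * pochhammer (\<alpha> + 1 + real k) m))"
  proof (intro sum.cong refl)
    fix k assume "k \<in> {..n}"
    then have k: "k \<le> n" by simp
    have "\<alpha> + 1 + real k \<notin> \<int>\<^sub>\<le>\<^sub>0" using \<alpha> by (auto dest: nonpos_Ints_nonpos)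
    then have 2: "pochhammer (\<alpha> + 1 + real k) m = Gamma (\<alpha> + real (k + m) + 1) / Gamma (\<alpha> + real k + 1)"
      by (subst pochhammer_Gamma) (auto simp: add_ac)
    have g: "Gamma (\<alpha> + real k + 1) > 0" using \<alpha> by (intro Gamma_real_pos) auto
    then have "((- 1) ^ k * ((real n + \<alpha>) gchoose (n - k)) / fact k) * Gamma (\<alpha> + real (k + m) + 1)
      = (- 1) ^ k * (((real n + \<alpha>) gchoose (n - k)) / fact k * Gamma (\<alpha> + real k + 1)) * pochhammer (\<alpha> + 1 + real k) m"
      unfolding 2 by simp
    then show "((- 1) ^ k * ((real n + \<alpha>) gchoose (n - k)) / fact k) * Gamma (\<alpha> + real (k + m) + 1)
      = Gamma (\<alpha> + real n + 1) / fact n * ((- 1) ^ k * real (n choose k) * pochhammer (\<alpha> + 1 + real k) m)"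
      unfolding laguerre_weight_Gamma[OF k] by (simp add: mult_ac)
  qed
  also have "\<dots> = Gamma (\<alpha> + real n + 1) / fact n * (if m = n then (- 1) ^ n * fact n else 0)"
    unfolding sum_distrib_left[symmetric] alternating_pochhammer_sum[OF m] ..
  finally show ?thesis by simp
qed

lemma integral_poly_mult_laguerre:
  assumes d: "degree p \<le> n"
  shows "(LINT x|\<mu>. poly p x * L n x) = coeff p n * ((- 1) ^ n * Gamma (\<alpha> + real n + 1))"
proof -
  have i: "integrable \<mu> (\<lambda>x. x ^ m * L n x)" for m
    using integrable_poly_laguerre[of "monom 1 m * laguerre_polynomial n"]
    by (simp add: poly_monom poly_laguerre_polynomial poly_mult[abs_def])
  have "(LINT x|\<mu>. poly p x * L n x) = (LINT x|\<mu>. (\<Sum>m\<le>degree p. coeff p m * (x ^ m * L n x)))"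
    unfolding poly_altdef by (simp add: sum_distrib_right mult.assoc)
  also have "\<dots> = (\<Sum>m\<le>degree p. coeff p m * (LINT x|\<mu>. x ^ m * L n x))"
    by (subst Bochner_Integration.integral_sum) (auto intro!: i)
  also have "\<dots> = (\<Sum>m\<le>degree p. if m = n then coeff p n * ((- 1) ^ n * Gamma (\<alpha> + real n + 1)) else 0)"
    using d by (intro sum.cong refl) (auto simp: integral_power_mult_laguerre)
  also have "\<dots> = coeff p n * ((- 1) ^ n * Gamma (\<alpha> + real n + 1))"
    using d by (auto simp: coeff_eq_0)
  finally show ?thesis .
qed

lemma laguerre_orthogonal:
  "(LINT x|\<mu>. L m x * L n x)
    = (if m = n then Gamma (\<alpha> + real n + 1) / fact n else 0)"
proof -
  have le: "(LINT x|\<mu>. L m x * L n x)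
    = (if m = n then Gamma (\<alpha> + real n + 1) / fact n else 0)" if "m \<le> n" for m n
    using integral_poly_mult_laguerre[of "laguerre_polynomial m" n] that
    by (auto simp: poly_laguerre_polynomial degree_laguerre_polynomial coeff_laguerre_polynomial_top coeff_eq_0 simp flip: power_add)
  show ?thesis using le[of m n] le[of n m] by (cases "m \<le> n") (auto simp: mult.commute)
qed

lemma gbinomial_laguerre_pos:
  "((real n + \<alpha>) gchoose n) > 0"
  using \<alpha> by (subst gbinomial_pochhammer') (auto intro!: divide_pos_pos pochhammer_pos)

text \<open>
  The product formula, obtained without computation. The translation is self-adjoint and maps
  polynomials of degree at most $m$ to such polynomials, for every $m$. So it preserves the orthogonal
  complement of the polynomials of lower degree: \<open>T t (L n)\<close> is a multiple of \<open>L n\<close>. The factor is found at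
  $x=0$, where the definition of the translation is symmetric in $x$ and $t$.
\<close>

lemma translation_laguerre:
  assumes t: "t \<ge> 0" and x: "x \<ge> 0"
  shows "T t (L n) x = R n t * L n x"
proof -
  define P where "P = laguerre_polynomial n"
  define M where "M = \<mu>"
  have P: "poly P = L n" by (simp add: P_def poly_laguerre_polynomial fun_eq_iff)
  obtain q where q: "degree q \<le> n" "\<And>x. x \<ge> 0 \<Longrightarrow> T t (poly P) x = poly q x"
    using translation_poly[OF t, of P] by (auto simp: P_def degree_laguerre_polynomial)
  define c where "c = coeff q n / coeff P n"
  \<comment> \<open>The remainder has degree below n and is orthogonal to itself.\<close>
  define r where "r = q - smult c P"
  have rn: "coeff r n = 0" by (simp add: r_def c_def P_def coeff_laguerre_polynomial_top)
  have dr: "degree r \<le> n" unfolding r_def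
    by (intro degree_diff_le q order_trans[OF degree_smult_le]) (simp add: P_def degree_laguerre_polynomial)
  have i: "integrable M (\<lambda>x. poly a x * poly b x)" for a b
    using integrable_poly_laguerre[of "a * b"] by (simp add: M_def poly_mult[abs_def])
  have "(LINT x|M. (poly r x)\<^sup>2) = (LINT x|M. poly q x * poly r x - c * (poly r x * poly P x))"
    by (simp add: r_def power2_eq_square algebra_simps)
  also have "\<dots> = (LINT x|M. poly q x * poly r x) - c * (LINT x|M. poly r x * poly P x)"
    by (subst Bochner_Integration.integral_diff) (auto intro!: i)
  also have "(LINT x|M. poly r x * poly P x) = 0"
    unfolding M_def P using integral_poly_mult_laguerre[OF dr] rn by simp
  also have "(LINT x|M. poly q x * poly r x) = (LINT x|M. T t (poly P) x * poly r x)"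
  proof (rule integral_cong_AE)
    show "AE x in M. poly q x * poly r x = T t (poly P) x * poly r x"
      unfolding M_def using AE_laguerre_pos by eventually_elim (simp add: q)
  qed (use laguerre_translation_measurable in \<open>auto simp: M_def\<close>)
  also have "\<dots> = (LINT x|M. poly P x * T t (poly r) x)"
    unfolding M_def by (intro translation_selfadjoint t square_integrable_poly)
  also have "\<dots> = 0"
  proof -
    obtain q' where q': "degree q' \<le> degree r" "\<And>x. x \<ge> 0 \<Longrightarrow> T t (poly r) x = poly q' x"
      using translation_poly[OF t, of r] by auto
    have "coeff q' n = 0"
    proof (cases "degree r < n")
      case True
      then show ?thesis using q' by (intro coeff_eq_0) auto
    next
      case False
      with dr rn have "r = 0" by (metis le_antisym leading_coeff_0_iff not_le)
      then have z: "poly q' x = 0" if "x \<ge> 0" for x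
        using q'(2)[OF that] laguerre_translation_eq_angular[of "\<lambda>_. 0" t x] by (simp add: \<open>r = 0\<close> poly_0[abs_def])
      have "q' = 0"
      proof (rule ccontr)
        assume "q' \<noteq> 0"
        then have "finite {x. poly q' x = 0}" by (rule poly_roots_finite)
        moreover have "{0::real..} \<subseteq> {x. poly q' x = 0}" using z by auto
        ultimately have "finite {0::real..}" by (rule rev_finite_subset)
        then show False using infinite_Ici by blast
      qed
      then show ?thesis by simp
    qed
    moreover have "degree q' \<le> n" using q'(1) dr by simp
    ultimately have "(LINT x|M. poly q' x * poly P x) = 0"
      unfolding M_def P using integral_poly_mult_laguerre[of q' n] by simp
    moreover have "(LINT x|M. poly P x * T t (poly r) x) = (LINT x|M. poly q' x * poly P x)"
    proof (rule integral_cong_AE)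
      show "AE x in M. poly P x * T t (poly r) x = poly q' x * poly P x"
        unfolding M_def using AE_laguerre_pos by eventually_elim (simp add: q')
    qed (use laguerre_translation_measurable in \<open>auto simp: M_def\<close>)
    ultimately show ?thesis by simp
  qed
  finally have "(LINT x|M. (poly r x)\<^sup>2) = 0" by simp
  then have "r = 0" unfolding M_def by (rule poly_zero_of_integral_square_zero)
  then have qc: "poly q x = c * L n x" for x using P by (simp add: r_def fun_eq_iff)
  have "T t (poly P) 0 = T 0 (poly P) t"
    by (simp add: laguerre_translation_def)
  then have "L n t = c * L n 0"
    using q(2)[of 0] qc[of 0] laguerre_translation_0[of "poly P" t] P by simp
  then have "c = R n t"
    using gbinomial_laguerre_pos[of n] by (simp add: laguerre_poly_normalized_def laguerre_poly_0)
  then show ?thesis using q(2)[OF x] qc[of x] P by simp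
qed

section \<open>Completeness of the Laguerre functions\<close>

definition laguerre_norm_sq :: "nat \<Rightarrow> real" where
  "laguerre_norm_sq n = Gamma (\<alpha> + real n + 1) / fact n"

definition laguerre_function :: "nat \<Rightarrow> real \<Rightarrow> real" where
  "laguerre_function n x = L n x / sqrt (laguerre_norm_sq n)"

lemma laguerre_norm_sq_pos: "laguerre_norm_sq n > 0"
  unfolding laguerre_norm_sq_def using \<alpha> by (intro divide_pos_pos Gamma_real_pos) auto

lemma square_integrable_laguerre_poly:
  "L2 (L n)"
  using square_integrable_poly[of "laguerre_polynomial n"] by (simp add: poly_laguerre_polynomial[abs_def])

sublocale orthonormal_family \<mu> laguerre_function
proof
  fix m n
  show "L2 (laguerre_function n)"
    unfolding laguerre_function_def[abs_def]
    using square_integrable_cmult[OF square_integrable_laguerre_poly[of n], of "1 / sqrt (laguerre_norm_sq n)"] by simp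
  have "(LINT x|\<mu>. laguerre_function m x * laguerre_function n x)
    = (LINT x|\<mu>. L m x * L n x / (sqrt (laguerre_norm_sq m) * sqrt (laguerre_norm_sq n)))"
    by (simp add: laguerre_function_def)
  also have "\<dots> = (if m = n then laguerre_norm_sq n else 0) / (sqrt (laguerre_norm_sq m) * sqrt (laguerre_norm_sq n))"
    unfolding integral_divide_zero laguerre_orthogonal laguerre_norm_sq_def ..
  also have "\<dots> = (if m = n then 1 else 0)" using laguerre_norm_sq_pos[of n] by auto
  finally show "(LINT x|\<mu>. laguerre_function m x * laguerre_function n x) = (if m = n then 1 else 0)" .
qed

sublocale finite_measure \<mu>
  by (rule finite_measure_laguerre)

lemma square_integrable_bounded:
  assumes "f \<in> borel_measurable borel" "AE x in \<mu>. \<bar>f x\<bar> \<le> C"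
  shows "L2 f"
  unfolding square_integrable_def
proof
  show "integrable \<mu> (\<lambda>x. (f x)\<^sup>2)"
  proof (rule integrable_const_bound)
    show "AE x in \<mu>. norm ((f x)\<^sup>2) \<le> C\<^sup>2" using assms(2)
    proof eventually_elim
      case (elim x)
      then have "\<bar>f x\<bar>\<^sup>2 \<le> C\<^sup>2" by (intro power_mono) auto
      then show ?case by simp
    qed
  qed (use assms in auto)
qed (use assms in auto)

text \<open>
  The generalized binomial series sums the squared coefficients of the exponential, and the result is its
  squared norm.
\<close>

lemma in_span_closure_exp:
  assumes l: "l \<ge> 0"
  shows "in_span_closure (\<lambda>x. exp (- l * x))"
proof (rule parseval_imp_in_span_closure)
  \<comment> \<open>The coefficients of the exponential are those of a binomial series in $r^2$.\<close>
  define r where "r = l / (1 + l)"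
  have r: "0 \<le> r" "r < 1" using l by (auto simp: r_def)
  have e2: "(exp (- l * x))\<^sup>2 = exp (- (2 * l) * x)" for x by (simp flip: exp_of_nat_mult)
  note I = has_bochner_integral_exp_power[of "2 * l" 0, unfolded has_bochner_integral_iff]
  show "L2 (\<lambda>x. exp (- l * x))"
    unfolding square_integrable_def e2 using I l by auto
  have n: "(L2_norm (\<lambda>x. exp (- l * x)))\<^sup>2 = Gamma (\<alpha> + 1) / (1 + 2 * l) powr (\<alpha> + 1)"
    unfolding L2_norm_on_squared e2 using I l by simp
  have c: "(coefficient (\<lambda>x. exp (- l * x)) n)\<^sup>2 = Gamma (\<alpha> + 1) * ((1 + l) powr (- \<alpha> - 1))\<^sup>2 * (((- \<alpha> - 1) gchoose n) * (- r\<^sup>2) ^ n)" for n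
  proof -
    have p: "laguerre_norm_sq n > 0" by (rule laguerre_norm_sq_pos)
    have "coefficient (\<lambda>x. exp (- l * x)) n = (LINT x|\<mu>. exp (- l * x) * L n x) / sqrt (laguerre_norm_sq n)"
      by (simp add: coefficient_def laguerre_function_def)
    also have "\<dots> = laguerre_norm_sq n / sqrt (laguerre_norm_sq n) * ((1 + l) powr (- \<alpha> - 1) * r ^ n)"
      unfolding integral_exp_laguerre[OF l] laguerre_norm_sq_def[symmetric] r_def by simp
    also have "laguerre_norm_sq n / sqrt (laguerre_norm_sq n) = sqrt (laguerre_norm_sq n)"
      using p by (simp add: real_div_sqrt)
    finally have "(coefficient (\<lambda>x. exp (- l * x)) n)\<^sup>2 = laguerre_norm_sq n * ((1 + l) powr (- \<alpha> - 1))\<^sup>2 * (r\<^sup>2) ^ n"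
      using p by (simp add: power_mult_distrib power2_eq_square mult_ac)
    also have "laguerre_norm_sq n = Gamma (\<alpha> + 1) * (((- \<alpha> - 1) gchoose n) * (- 1) ^ n)"
    proof -
      have "\<alpha> + 1 \<notin> \<int>\<^sub>\<le>\<^sub>0" using \<alpha> by (auto dest: nonpos_Ints_nonpos)
      then have "pochhammer (\<alpha> + 1) n = Gamma (\<alpha> + 1 + real n) / Gamma (\<alpha> + 1)"
        by (rule pochhammer_Gamma)
      moreover have "Gamma (\<alpha> + 1) > 0" using \<alpha> by (intro Gamma_real_pos) auto
      ultimately have 1: "laguerre_norm_sq n = Gamma (\<alpha> + 1) * (pochhammer (\<alpha> + 1) n / fact n)"
        by (simp add: laguerre_norm_sq_def add_ac)
      have "((- \<alpha> - 1) gchoose n) * (- 1) ^ n = pochhammer (\<alpha> + 1) n / fact n * ((- 1) ^ n * (- 1) ^ n)"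
        using gbinomial_pochhammer[of "- \<alpha> - 1" n] by (simp add: add.commute)
      also have "(- 1) ^ n * (- 1) ^ n = (1::real)" by (simp flip: power_mult_distrib)
      finally show ?thesis unfolding 1 by simp
    qed
    also have "Gamma (\<alpha> + 1) * (((- \<alpha> - 1) gchoose n) * (- 1) ^ n) * ((1 + l) powr (- \<alpha> - 1))\<^sup>2 * (r\<^sup>2) ^ n
      = Gamma (\<alpha> + 1) * ((1 + l) powr (- \<alpha> - 1))\<^sup>2 * (((- \<alpha> - 1) gchoose n) * ((- 1) ^ n * (r\<^sup>2) ^ n))"
      by (simp only: mult_ac)
    also have "(- 1) ^ n * (r\<^sup>2) ^ n = (- r\<^sup>2) ^ n" by (simp flip: power_mult_distrib)
    finally show ?thesis .
  qed
  have "\<bar>- r\<^sup>2\<bar> < 1" using r by (simp add: abs_square_less_1)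
  then have "(\<lambda>n. ((- \<alpha> - 1) gchoose n) * (- r\<^sup>2) ^ n) sums (1 + - r\<^sup>2) powr (- \<alpha> - 1)"
    by (rule gen_binomial_real)
  then have "(\<lambda>n. (coefficient (\<lambda>x. exp (- l * x)) n)\<^sup>2) sums (Gamma (\<alpha> + 1) * ((1 + l) powr (- \<alpha> - 1))\<^sup>2 * (1 + - r\<^sup>2) powr (- \<alpha> - 1))"
    unfolding c by (rule sums_mult)
  also have "Gamma (\<alpha> + 1) * ((1 + l) powr (- \<alpha> - 1))\<^sup>2 * (1 + - r\<^sup>2) powr (- \<alpha> - 1) = Gamma (\<alpha> + 1) / (1 + 2 * l) powr (\<alpha> + 1)"
  proof -
    have "((1 + l) powr (- \<alpha> - 1))\<^sup>2 * (1 + - r\<^sup>2) powr (- \<alpha> - 1) = ((1 + l)\<^sup>2) powr (- \<alpha> - 1) * (1 + - r\<^sup>2) powr (- \<alpha> - 1)"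
      using l by (simp add: power2_eq_square powr_mult)
    also have "\<dots> = ((1 + l)\<^sup>2 * (1 + - r\<^sup>2)) powr (- \<alpha> - 1)" by (simp only: powr_mult)
    also have "(1 + l)\<^sup>2 * (1 + - r\<^sup>2) = 1 + 2 * l"
      using l by (simp add: r_def power_divide right_diff_distrib) (simp add: power2_eq_square algebra_simps)
    also have "(1 + 2 * l) powr (- \<alpha> - 1) = 1 / (1 + 2 * l) powr (\<alpha> + 1)"
      using powr_minus[of "1 + 2 * l" "\<alpha> + 1"] by (simp add: inverse_eq_divide)
    finally show ?thesis by (simp add: mult.assoc)
  qed
  finally show "(\<lambda>n. (coefficient (\<lambda>x. exp (- l * x)) n)\<^sup>2) sums (L2_norm (\<lambda>x. exp (- l * x)))\<^sup>2"
    unfolding n .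
qed

text \<open>
  With $u=e^{-x}$ this is the Weierstrass approximation theorem on $[0,1]$: polynomials in $u$ are
  combinations of exponentials, and uniform convergence implies convergence in norm because the measure
  is finite.
\<close>

lemma in_span_closure_continuous:
  fixes f :: "real \<Rightarrow> real"
  assumes f: "continuous_on UNIV f" and z: "\<And>x. x \<ge> B \<Longrightarrow> f x = 0"
  shows "in_span_closure f"
proof (rule in_span_closure_approx)
  \<comment> \<open>Cutting u off at exp (- B) keeps the logarithm finite and changes nothing, as f vanishes beyond B.\<close>
  define G where "G u = f (- ln (max u (exp (- B))))" for u
  have pos: "max u (exp (- B)) > 0" for u by (simp add: less_max_iff_disj)
  have Gc: "continuous_on {0..1} G"
    unfolding G_def
    by (rule continuous_on_compose2[OF f]) (use pos in \<open>auto intro!: continuous_intros simp: less_imp_neq[symmetric]\<close>)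
  have GE: "G (exp (- x)) = f x" for x
  proof (cases "x \<ge> B")
    case True
    then have "max (exp (- x)) (exp (- B)) = exp (- B)" by (simp add: max_def)
    then show ?thesis using z True by (simp add: G_def)
  next
    case False
    then have "max (exp (- x)) (exp (- B)) = exp (- x)" by (simp add: max_def)
    then show ?thesis by (simp add: G_def)
  qed
  have "bounded (G ` {0..1})" using Gc by (intro compact_imp_bounded compact_continuous_image) auto
  then obtain C where C: "\<And>u. u \<in> {0..1} \<Longrightarrow> \<bar>G u\<bar> \<le> C" unfolding bounded_iff by fastforce
  have [measurable]: "f \<in> borel_measurable borel" using f by (rule borel_measurable_continuous_onI)
  show sf: "L2 f"
  proof (rule square_integrable_bounded)
    show "AE x in \<mu>. \<bar>f x\<bar> \<le> C" using AE_laguerre_pos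
    proof eventually_elim
      case (elim x)
      then show ?case using C[of "exp (- x)"] GE[of x] by simp
    qed
  qed measurable
  fix \<epsilon> :: real assume e: "\<epsilon> > 0"
  define m where "m = measure \<mu> UNIV"
  have m: "m \<ge> 0" by (simp add: m_def)
  define \<eta> where "\<eta> = \<epsilon> / (m + 1)"
  have \<eta>: "\<eta> > 0" using e m by (simp add: \<eta>_def)
  obtain p where p: "real_polynomial_function p" "\<And>u. u \<in> {0..1} \<Longrightarrow> \<bar>G u - p u\<bar> < \<eta>"
    using Stone_Weierstrass_real_polynomial_function[OF _ Gc \<eta>] by auto
  then obtain a n where pa: "p = (\<lambda>u. \<Sum>i\<le>n. a i * u ^ i)" unfolding real_polynomial_function_iff_sum by blast
  have pe: "(\<lambda>x. p (exp (- x))) = (\<lambda>x. \<Sum>i\<le>n. a i * exp (- real i * x))"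
    by (simp add: pa fun_eq_iff flip: exp_of_nat_mult)
  have ip: "in_span_closure (\<lambda>x. p (exp (- x)))" unfolding pe
    by (intro in_span_closure_sum in_span_closure_cmult in_span_closure_exp) auto
  have "(L2_norm (\<lambda>x. f x - p (exp (- x))))\<^sup>2 \<le> (LINT x|\<mu>. \<eta>\<^sup>2)"
    unfolding L2_norm_on_squared
  proof (rule integral_mono_AE)
    show "integrable \<mu> (\<lambda>x. (f x - p (exp (- x)))\<^sup>2)"
      using square_integrable_diff[OF sf in_span_closure_square_integrable[OF ip]] by (simp add: square_integrable_def)
    show "AE x in \<mu>. (f x - p (exp (- x)))\<^sup>2 \<le> \<eta>\<^sup>2" using AE_laguerre_pos
    proof eventually_elim
      case (elim x)
      then have "\<bar>f x - p (exp (- x))\<bar> \<le> \<eta>" using p(2)[of "exp (- x)"] GE[of x] by simp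
      then have "\<bar>f x - p (exp (- x))\<bar>\<^sup>2 \<le> \<eta>\<^sup>2" by (intro power_mono) auto
      then show ?case by simp
    qed
  qed auto
  also have "\<dots> = m * \<eta>\<^sup>2" by (simp add: m_def)
  also have "\<dots> < (m + 1)\<^sup>2 * \<eta>\<^sup>2" using m \<eta> by (intro mult_strict_right_mono) (auto simp: power2_eq_square algebra_simps add_pos_nonneg)
  also have "\<dots> = \<epsilon>\<^sup>2" using m by (simp add: \<eta>_def power_divide)
  finally have "L2_norm (\<lambda>x. f x - p (exp (- x))) < \<epsilon>"
    by (rule power2_less_imp_less) (use e in simp)
  then show "\<exists>g. in_span_closure g \<and> L2_norm (\<lambda>x. f x - g x) < \<epsilon>" using ip by blast
qed

text \<open>
  A measurable function is an almost everywhere limit of continuous functions; these are clipped to the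
  same bound and cut off at infinity.
\<close>

lemma in_span_closure_bounded:
  fixes f :: "real \<Rightarrow> real"
  assumes f[measurable]: "f \<in> borel_measurable borel" and C: "\<And>x. \<bar>f x\<bar> \<le> C"
  shows "in_span_closure f"
proof -
  have "f \<in> borel_measurable (lebesgue_on UNIV)" using measurable_completion[of f lborel borel] by (simp add: lebesgue_on_UNIV_eq)
  then have "f measurable_on UNIV" by (intro lebesgue_measurable_imp_measurable_on) auto
  then obtain N g where N: "negligible N" and g: "\<And>n. continuous_on UNIV (g n)" and lim: "\<And>x. x \<notin> N \<Longrightarrow> (\<lambda>n. g n x) \<longlonglongrightarrow> f x"
    unfolding measurable_on_def by auto
  define k where "k n x = max (- C) (min C (g n x)) * max 0 (min 1 (real n - x))" for n x
  have C0: "C \<ge> 0" using C[of 0] by linarith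
  have kc: "in_span_closure (k n)" for n
  proof (rule in_span_closure_continuous)
    show "continuous_on UNIV (k n)" unfolding k_def by (intro continuous_intros g)
    show "k n x = 0" if "x \<ge> real n" for x using that by (simp add: k_def)
  qed
  have kC: "\<bar>k n x\<bar> \<le> C" for n x
  proof -
    have "\<bar>max (- C) (min C (g n x))\<bar> * \<bar>max 0 (min 1 (real n - x))\<bar> \<le> C * 1"
      using C0 by (intro mult_mono) auto
    then show ?thesis by (simp add: k_def abs_mult)
  qed
  have klim: "(\<lambda>n. k n x) \<longlonglongrightarrow> f x" if "x \<notin> N" for x
  proof -
    have "(\<lambda>n. max (- C) (min C (g n x))) \<longlonglongrightarrow> max (- C) (min C (f x))"
      by (intro tendsto_intros lim that)
    moreover have "max (- C) (min C (f x)) = f x" using C[of x] by auto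
    moreover have "(\<lambda>n. max 0 (min 1 (real n - x))) \<longlonglongrightarrow> 1"
    proof (rule tendsto_eventually)
      show "\<forall>\<^sub>F n in sequentially. max 0 (min 1 (real n - x)) = 1"
        using eventually_ge_at_top[of "nat \<lceil>x + 1\<rceil>"]
      proof eventually_elim
        case (elim n)
        then have "real n \<ge> x + 1" by linarith
        then show ?case by simp
      qed
    qed
    ultimately show ?thesis unfolding k_def using tendsto_mult by fastforce
  qed
  have "AE x in lebesgue. x \<notin> N" using N by (simp add: negligible_iff_null_sets AE_not_in)
  then have "AE x in lborel. x \<notin> N" unfolding AE_completion_iff .
  then have ae: "AE x in \<mu>. x \<notin> N"
    unfolding AE_laguerre_iff_radial unfolding radial_measure_def by (subst AE_density) auto
  show ?thesis
  proof (rule in_span_closure_AE_limit)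
    show "L2 f" using C by (intro square_integrable_bounded[where C = C]) auto
    show "AE x in \<mu>. (\<lambda>n. k n x) \<longlonglongrightarrow> f x" using ae by eventually_elim (rule klim)
    show "L2 (\<lambda>_. C)" by (intro square_integrable_bounded[where C = "\<bar>C\<bar>"]) auto
    show "AE x in \<mu>. \<bar>k n x\<bar> \<le> C" for n using kC by simp
  qed (rule kc)
qed

theorem laguerre_complete:
  assumes f: "L2 f"
  shows "in_span_closure f"
proof -
  have [measurable]: "f \<in> borel_measurable borel" using f by (simp add: square_integrable_laguerre_iff)
  define k where "k n x = max (- real n) (min (real n) (f x))" for n x
  show ?thesis
  proof (rule in_span_closure_AE_limit[OF f])
    show "in_span_closure (k n)" for n
      by (rule in_span_closure_bounded[where C = "real n"]) (auto simp: k_def[abs_def])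
    show "AE x in \<mu>. (\<lambda>n. k n x) \<longlonglongrightarrow> f x"
    proof (intro AE_I2 tendsto_eventually)
      fix x
      show "\<forall>\<^sub>F n in sequentially. k n x = f x"
        using eventually_ge_at_top[of "nat \<lceil>\<bar>f x\<bar>\<rceil>"]
      proof eventually_elim
        case (elim n)
        then have "real n \<ge> \<bar>f x\<bar>" by linarith
        then show ?case by (auto simp: k_def)
      qed
    qed
    show "L2 (\<lambda>x. \<bar>f x\<bar>)" using f by (simp add: square_integrable_def)
    show "AE x in \<mu>. \<bar>k n x\<bar> \<le> \<bar>f x\<bar>" for n by (auto simp: k_def)
  qed
qed

section \<open>Independence of the representative\<close>

lemma lebesgue_on_halfline_integral:
  fixes g :: "real \<Rightarrow> real"
  assumes [measurable]: "g \<in> borel_measurable borel"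
  shows "integrable (lebesgue_on {0..}) (\<lambda>x. g x * (exp (- x) * x powr \<alpha>)) \<longleftrightarrow> integrable \<mu> g" (is "?A \<longleftrightarrow> ?B")
    and "(LINT x|lebesgue_on {0..}. g x * (exp (- x) * x powr \<alpha>)) = (LINT x|\<mu>. g x)"
proof -
  have B1: "integrable \<mu> g \<longleftrightarrow> integrable \<rho> (\<lambda>x. exp (- x) *\<^sub>R g x)"
    unfolding laguerre_measure_def by (rule integrable_density) auto
  have B2: "\<dots> \<longleftrightarrow> integrable lborel (\<lambda>x. (indicator {0<..} x * x powr \<alpha>) *\<^sub>R (exp (- x) *\<^sub>R g x))"
    unfolding radial_measure_def by (rule integrable_density) auto
  have C1: "(LINT x|\<mu>. g x) = (LINT x|\<rho>. exp (- x) *\<^sub>R g x)"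
    unfolding laguerre_measure_def by (rule integral_density) auto
  have C2: "\<dots> = (LINT x|lborel. (indicator {0<..} x * x powr \<alpha>) *\<^sub>R (exp (- x) *\<^sub>R g x))"
    unfolding radial_measure_def by (rule integral_density) auto
  have e: "(\<lambda>x. (indicator {0<..} x * x powr \<alpha>) *\<^sub>R (exp (- x) *\<^sub>R g x)) = (\<lambda>x. indicator {0..} x *\<^sub>R (g x * (exp (- x) * x powr \<alpha>)))"
    by (auto simp: fun_eq_iff indicator_def)
  have "?A \<longleftrightarrow> integrable lebesgue (\<lambda>x. indicator {0..} x *\<^sub>R (g x * (exp (- x) * x powr \<alpha>)))"
    by (subst integrable_restrict_space) auto
  also have "\<dots> \<longleftrightarrow> integrable lborel (\<lambda>x. indicator {0..} x *\<^sub>R (g x * (exp (- x) * x powr \<alpha>)))"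
    by (rule integrable_completion) measurable
  finally show "?A \<longleftrightarrow> ?B" unfolding B1 B2 e .
  have "(LINT x|lebesgue_on {0..}. g x * (exp (- x) * x powr \<alpha>)) = (LINT x|lebesgue. indicator {0..} x *\<^sub>R (g x * (exp (- x) * x powr \<alpha>)))"
    by (subst integral_restrict_space) auto
  also have "\<dots> = (LINT x|lborel. indicator {0..} x *\<^sub>R (g x * (exp (- x) * x powr \<alpha>)))"
    by (rule integral_completion) measurable
  finally show "(LINT x|lebesgue_on {0..}. g x * (exp (- x) * x powr \<alpha>)) = (LINT x|\<mu>. g x)"
    unfolding C1 C2 e .
qed

lemma agrees_laguerre_L2:
  assumes "agrees_on_halfline f g"
  shows "f \<in> laguerre_L2 \<alpha> \<longleftrightarrow> L2 g"
    and "laguerre_norm \<alpha> f = L2_norm g"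
    and "laguerre_coeff \<alpha> f n = (LINT x|\<mu>. g x * R n x)"
proof -
  have [measurable]: "g \<in> borel_measurable borel" using assms by (simp add: agrees_on_halfline_def)
  have gm [measurable]: "g \<in> borel_measurable (lebesgue_on {0..})" by (rule borel_imp_lebesgue_on) measurable
  have fm [measurable]: "f \<in> borel_measurable (lebesgue_on {0..})" using assms by (rule agrees_measurable)
  define w where "w x = exp (- x) * x powr \<alpha>" for x
  have "w \<in> borel_measurable borel" unfolding w_def by measurable
  then have [measurable]: "w \<in> borel_measurable (lebesgue_on {0..})" by (rule borel_imp_lebesgue_on)
  have Rm: "R n \<in> borel_measurable borel"
    unfolding laguerre_poly_normalized_def laguerre_poly_def by measurable
  note [measurable] = Rm borel_imp_lebesgue_on[OF Rm]
  note ae = agrees_AE[OF assms]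
  have ae2: "AE x in lebesgue_on {0..}. (f x)\<^sup>2 * w x = (g x)\<^sup>2 * w x"
    using ae by eventually_elim simp
  have "integrable (lebesgue_on {0..}) (\<lambda>x. \<bar>f x * exp (- x / 2)\<bar>\<^sup>2 * x powr \<alpha>) \<longleftrightarrow> integrable (lebesgue_on {0..}) (\<lambda>x. (g x)\<^sup>2 * w x)"
    unfolding squared_weight w_def[symmetric]
    by (rule integrable_cong_AE[OF _ _ ae2]) measurable
  also have "\<dots> \<longleftrightarrow> integrable \<mu> (\<lambda>x. (g x)\<^sup>2)"
    unfolding w_def by (rule lebesgue_on_halfline_integral) measurable
  finally show "f \<in> laguerre_L2 \<alpha> \<longleftrightarrow> L2 g"
    unfolding laguerre_L2_def square_integrable_def using fm by auto
  have "(LINT x|lebesgue_on {0..}. \<bar>f x * exp (- x / 2)\<bar>\<^sup>2 * x powr \<alpha>) = (LINT x|lebesgue_on {0..}. (g x)\<^sup>2 * w x)"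
    unfolding squared_weight w_def[symmetric]
    by (rule integral_cong_AE[OF _ _ ae2]) measurable
  also have "\<dots> = (LINT x|\<mu>. (g x)\<^sup>2)"
    unfolding w_def by (rule lebesgue_on_halfline_integral) measurable
  finally show "laguerre_norm \<alpha> f = L2_norm g"
    unfolding laguerre_norm_def L2_norm_on_def by simp
  have ae3: "AE x in lebesgue_on {0..}. f x * R n x * w x = g x * R n x * w x"
    using ae by eventually_elim simp
  have "laguerre_coeff \<alpha> f n = (LINT x|lebesgue_on {0..}. f x * R n x * w x)"
    unfolding laguerre_coeff_def w_def by (simp add: mult.assoc)
  also have "\<dots> = (LINT x|lebesgue_on {0..}. g x * R n x * w x)"
    by (rule integral_cong_AE[OF _ _ ae3]) measurable
  also have "\<dots> = (LINT x|\<mu>. g x * R n x)"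
    unfolding w_def by (rule lebesgue_on_halfline_integral) measurable
  finally show "laguerre_coeff \<alpha> f n = (LINT x|\<mu>. g x * R n x)" .
qed

lemma ex_agrees:
  assumes "f \<in> laguerre_L2 \<alpha>"
  shows "\<exists>g. agrees_on_halfline f g"
proof -
  have "f \<in> borel_measurable (lebesgue_on {0..})" using assms by (simp add: laguerre_L2_def)
  then have "(\<lambda>x. if x \<in> {0..} then f x else 0) \<in> borel_measurable lebesgue"
    by (intro borel_measurable_if_I) auto
  then obtain g where "g \<in> borel_measurable lborel" "AE x in lborel. (if x \<in> {0..} then f x else 0) = g x"
    using completion_ex_borel_measurable_real by blast
  then have "agrees_on_halfline f g" unfolding agrees_on_halfline_def by (auto elim!: eventually_mono)
  then show ?thesis by blast
qed

lemma AE_angular_imp_lborel: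
  assumes "AE \<theta> in \<sigma>. P \<theta>"
  shows "AE \<theta> in lborel. \<theta> \<in> {0..pi} \<longrightarrow> P \<theta>"
proof -
  have c: "norm_const > 0" by (rule norm_const_pos)
  have "AE \<theta> in lborel. \<theta> \<notin> {0, pi}" by (intro AE_not_in) (auto intro: finite_imp_null_set_lborel)
  moreover have "AE \<theta> in lborel. 0 < ennreal (indicator {0<..<pi} \<theta> *
     (norm_const * sin \<theta> powr (2 * \<alpha>))) \<longrightarrow> P \<theta>"
    using assms unfolding angular_measure_def by (subst (asm) AE_density) auto
  ultimately show ?thesis
  proof eventually_elim
    case (elim \<theta>)
    show ?case
    proof
      assume "\<theta> \<in> {0..pi}"
      then have t: "\<theta> \<in> {0<..<pi}" using elim by auto
      then have "sin \<theta> > 0" by (auto intro!: sin_gt_zero)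
      then have "indicator {0<..<pi} \<theta> * (norm_const * sin \<theta> powr (2 * \<alpha>)) > 0"
        using t mult_pos_pos[OF c, of "sin \<theta> powr (2 * \<alpha>)"] by simp
      then show "P \<theta>" using elim by (simp only: ennreal_less_zero_iff)
    qed
  qed
qed

text \<open>
  A null set of arguments is met by \<open>shift t x \<theta>\<close> for almost all $x$ only on a null set of angles, because
  the angular average preserves \<open>\<rho>\<close>. So the translation depends only on the class of the function.
\<close>

lemma agrees_translation:
  assumes t: "t \<ge> 0" and fg: "agrees_on_halfline f g"
  shows "agrees_on_halfline (T t f) (T t g)"
proof (cases "t = 0")
  case True
  have "T t h = h" for h unfolding True by (intro ext laguerre_translation_0)
  then show ?thesis using fg by simp
next
  case False
  with t have t: "t > 0" by simp
  have g[measurable]: "g \<in> borel_measurable borel" and ae: "AE x in lborel. x \<ge> 0 \<longrightarrow> f x = g x"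
    using fg by (auto simp: agrees_on_halfline_def)
  obtain N where N: "N \<in> null_sets lborel" "{x. \<not> (x \<ge> 0 \<longrightarrow> f x = g x)} \<subseteq> N"
    using ae unfolding eventually_ae_filter by auto
  have [measurable]: "N \<in> sets borel" using N by auto
  have "(\<integral>\<^sup>+x. (\<integral>\<^sup>+\<theta>. indicator N (shift t x \<theta>) \<partial>\<sigma>) \<partial>\<rho>) = (\<integral>\<^sup>+x. indicator N x \<partial>\<rho>)"
    by (rule nn_integral_translate[OF t]) measurable
  also have "\<dots> = (\<integral>\<^sup>+x. ennreal (indicator {0<..} x * x powr \<alpha>) * indicator N x \<partial>lborel)"
    unfolding radial_measure_def by (subst nn_integral_density) auto
  also have "\<dots> = (\<integral>\<^sup>+x. 0 \<partial>(lborel :: real measure))"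
  proof (rule nn_integral_cong_AE)
    show "AE x in lborel. ennreal (indicator {0<..} x * x powr \<alpha>) * indicator N x = 0"
      using AE_not_in[OF N(1)] by eventually_elim simp
  qed
  finally have z: "(\<integral>\<^sup>+x. (\<integral>\<^sup>+\<theta>. indicator N (shift t x \<theta>) \<partial>\<sigma>) \<partial>\<rho>) = 0" by simp
  have "AE x in \<rho>. (\<integral>\<^sup>+\<theta>. indicator N (shift t x \<theta>) \<partial>\<sigma>) = 0"
    using z by (subst (asm) nn_integral_0_iff_AE) (auto intro!: ang.borel_measurable_nn_integral simp: case_prod_beta')
  then have "AE x in lborel. 0 < x \<longrightarrow> (\<integral>\<^sup>+\<theta>. indicator N (shift t x \<theta>) \<partial>\<sigma>) = 0"
    unfolding radial_measure_def by (subst (asm) AE_density) (auto elim!: eventually_mono)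
  moreover have "AE x in lborel. x \<noteq> (0::real)" by (rule AE_lborel_singleton)
  ultimately have "AE x in lborel. x \<ge> 0 \<longrightarrow> T t f x = T t g x"
  proof eventually_elim
    case (elim x)
    show ?case
    proof
      assume "x \<ge> 0"
      with elim have x: "x > 0" and z: "(\<integral>\<^sup>+\<theta>. indicator N (shift t x \<theta>) \<partial>\<sigma>) = 0" by auto
      have "AE \<theta> in \<sigma>. indicator N (shift t x \<theta>) = (0::ennreal)"
        using z by (subst (asm) nn_integral_0_iff_AE) auto
      then have "AE \<theta> in \<sigma>. f (shift t x \<theta>) = g (shift t x \<theta>)"
      proof eventually_elim
        case (elim \<theta>)
        then have "shift t x \<theta> \<notin> N" by (auto simp: indicator_def split: if_splits)
        then show ?case using N shift_nonneg[of x t \<theta>] x t by auto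
      qed
      then have ae: "AE \<theta> in lborel. \<theta> \<in> {0..pi} \<longrightarrow> f (shift t x \<theta>) = g (shift t x \<theta>)"
        by (rule AE_angular_imp_lborel)
      define W where "W \<theta> = exp (- (sqrt (x * t) * cos \<theta>)) * J (sqrt (x * t) * sin \<theta>) * sin \<theta> powr (2 * \<alpha>)" for \<theta>
      have [measurable]: "W \<in> borel_measurable borel"
        unfolding W_def using measurable_entire_bessel by measurable
      have "(LINT \<theta>|lebesgue_on {0..pi}. f (shift t x \<theta>) * W \<theta>) = (LINT \<theta>|lebesgue_on {0..pi}. g (shift t x \<theta>) * W \<theta>)"
      proof (rule integral_cong_AE)
        have gW: "(\<lambda>\<theta>. g (shift t x \<theta>) * W \<theta>) \<in> borel_measurable borel" by measurable
        show "(\<lambda>\<theta>. g (shift t x \<theta>) * W \<theta>) \<in> borel_measurable (lebesgue_on {0..pi})"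
          using gW by (rule borel_imp_lebesgue_on)
        have ae': "AE \<theta> in lborel. \<theta> \<in> {0..pi} \<longrightarrow> f (shift t x \<theta>) * W \<theta> = g (shift t x \<theta>) * W \<theta>"
          using ae by eventually_elim auto
        show "(\<lambda>\<theta>. f (shift t x \<theta>) * W \<theta>) \<in> borel_measurable (lebesgue_on {0..pi})"
          by (rule measurable_lebesgue_on_AE[OF _ gW ae']) auto
        show "AE \<theta> in lebesgue_on {0..pi}. f (shift t x \<theta>) * W \<theta> = g (shift t x \<theta>) * W \<theta>"
          by (rule AE_lborel_imp_lebesgue_on[OF _ ae']) auto
      qed
      then show "T t f x = T t g x"
        unfolding laguerre_translation_def W_def shift_def by (simp add: mult.assoc)
    qed
  qed
  then show ?thesis unfolding agrees_on_halfline_def using laguerre_translation_measurable[OF g] by simp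
qed

section \<open>The translation as a multiplier\<close>

text \<open>
  The translation has norm at most $e^{t/2}$, so this bounds each of its eigenvalues.
\<close>

lemma abs_laguerre_poly_normalized_le:
  assumes t: "t \<ge> 0"
  shows "\<bar>R n t\<bar> \<le> exp (t / 2)"
proof -
  define r where "r = R n t"
  define h where "h = (LINT x|\<mu>. (L n x)\<^sup>2)"
  have h: "h > 0" using laguerre_orthogonal[of n n] laguerre_norm_sq_pos[of n]
    by (simp add: h_def power2_eq_square laguerre_norm_sq_def)
  have s: "L2 (L n)" by (rule square_integrable_laguerre_poly)
  note T = square_integrable_translation[OF t s]
  have "r\<^sup>2 * h = (LINT x|\<mu>. (r * L n x)\<^sup>2)"
    by (simp add: h_def power_mult_distrib)
  also have "\<dots> = (LINT x|\<mu>. (T t (L n) x)\<^sup>2)"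
  proof (rule integral_cong_AE)
    show "AE x in \<mu>. (r * L n x)\<^sup>2 = (T t (L n) x)\<^sup>2"
      using AE_laguerre_pos by eventually_elim (simp add: translation_laguerre[OF t] r_def)
  qed (use s T in \<open>auto simp: square_integrable_def\<close>)
  also have "\<dots> \<le> exp t * h" unfolding h_def by (rule T)
  finally have "r\<^sup>2 \<le> exp t" using h by simp
  also have "exp t = (exp (t / 2))\<^sup>2" by (simp flip: exp_of_nat_mult)
  finally have "\<bar>r\<bar>\<^sup>2 \<le> (exp (t / 2))\<^sup>2" by simp
  then show ?thesis unfolding r_def[symmetric] by (rule power2_le_imp_le) simp
qed

text \<open>
  The translation is a multiplier: self-adjointness moves it to the Laguerre polynomial, which is an
  eigenfunction.
\<close>

lemma coefficient_translation:
  assumes t: "t \<ge> 0" and f: "L2 f"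
  shows "coefficient (T t f) n = R n t * coefficient f n"
proof -
  have s: "L2 (L n)" by (rule square_integrable_laguerre_poly)
  have "(LINT x|\<mu>. T t f x * L n x)
    = (LINT x|\<mu>. f x * T t (L n) x)"
    by (rule translation_selfadjoint[OF t f s])
  also have "\<dots> = (LINT x|\<mu>. R n t * (f x * L n x))"
  proof (rule integral_cong_AE)
    show "AE x in \<mu>. f x * T t (L n) x = R n t * (f x * L n x)"
      using AE_laguerre_pos by eventually_elim (simp add: translation_laguerre[OF t])
  qed (use s f square_integrable_translation(1)[OF t s] in \<open>auto simp: square_integrable_def\<close>)
  finally show ?thesis by (simp add: coefficient_def laguerre_function_def)
qed

lemma coefficient_diff:
  assumes "L2 f" "L2 g"
  shows "coefficient (\<lambda>x. f x - g x) n = coefficient f n - coefficient g n"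
  unfolding coefficient_def left_diff_distrib using assms
  by (intro Bochner_Integration.integral_diff square_integrable_mult_integrable square_integrable_family)

text \<open>
  By completeness the norm is determined by the coefficients.
\<close>

lemma norm_squared_le_of_partial_sums:
  assumes f: "L2 f" and B: "\<And>N. (\<Sum>n<N. (coefficient f n)\<^sup>2) \<le> B"
  shows "(L2_norm f)\<^sup>2 \<le> B"
proof (rule field_le_epsilon)
  fix e :: real assume e: "e > 0"
  then have "sqrt e > 0" by simp
  then obtain N where "L2_norm (\<lambda>x. f x - partial_sum N f x) < sqrt e"
    using in_span_closure_partial_sum[OF laguerre_complete[OF f]] by blast
  then have "(L2_norm (\<lambda>x. f x - partial_sum N f x))\<^sup>2 \<le> (sqrt e)\<^sup>2"
    by (intro power_mono) auto
  then show "(L2_norm f)\<^sup>2 \<le> B + e"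
    using B[of N] e unfolding norm_diff_partial_sum[OF f] by simp
qed

lemma translation_norm_le:
  assumes t: "t \<ge> 0" and f: "L2 f"
  shows "L2_norm (T t f) \<le> exp (t / 2) * L2_norm f"
proof (rule power2_le_imp_le)
  have "(exp (t / 2))\<^sup>2 = exp t" by (simp flip: exp_of_nat_mult)
  then show "(L2_norm (T t f))\<^sup>2 \<le> (exp (t / 2) * L2_norm f)\<^sup>2"
    unfolding power_mult_distrib L2_norm_on_squared using square_integrable_translation(2)[OF t f] by simp
qed simp

lemma continuous_laguerre_poly_normalized: "continuous_on A (R n)"
  unfolding laguerre_poly_normalized_def laguerre_poly_def using gbinomial_laguerre_pos[of n]
  by (intro continuous_intros) auto

text \<open>
  For one function the coefficients beyond some \<open>N\<close> carry little mass, and multipliers are bounded by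
  $e^{(M+1)/2}$ on the relevant range; the finitely many other multipliers are uniformly continuous.
\<close>

lemma translation_continuous:
  assumes g: "L2 g" and e: "\<epsilon> > 0"
  shows "\<exists>\<delta>>0. \<forall>t h. 0 \<le> t \<and> t \<le> M \<and> 0 \<le> h \<and> h \<le> \<delta> \<longrightarrow>
     L2_norm (\<lambda>x. T (t + h) g x - T t g x) < \<epsilon>"
proof -
  define E where "E = exp ((M + 1) / 2)"
  define a where "a = coefficient g"
  have RE: "\<bar>R n s\<bar> \<le> E" if "0 \<le> s" "s \<le> M + 1" for n s
    using abs_laguerre_poly_normalized_le[OF that(1), of n] that
    by (auto simp: E_def intro: order_trans)
  have E0: "E > 0" by (simp add: E_def)
  \<comment> \<open>The tail contributes at most $(2E)^2\eta^2=\epsilon^2/4$ to the squared norm.\<close>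
  define \<eta> where "\<eta> = \<epsilon> / (4 * E)"
  have \<eta>: "\<eta> > 0" using e E0 by (simp add: \<eta>_def)
  obtain N where N: "L2_norm (\<lambda>x. g x - partial_sum N g x) < \<eta>"
    using in_span_closure_partial_sum[OF laguerre_complete[OF g] \<eta>] by blast
  have tail: "(L2_norm g)\<^sup>2 - (\<Sum>n<N. (a n)\<^sup>2) < \<eta>\<^sup>2"
  proof -
    have "(L2_norm (\<lambda>x. g x - partial_sum N g x))\<^sup>2 < \<eta>\<^sup>2"
      using N by (intro power_strict_mono) auto
    then show ?thesis unfolding norm_diff_partial_sum[OF g] a_def .
  qed
  define G where "G = (L2_norm g)\<^sup>2"
  have G0: "G \<ge> 0" by (simp add: G_def)
  \<comment> \<open>The head contributes at most $\kappa^2G\le\epsilon^2/4$.\<close>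
  define \<kappa> where "\<kappa> = \<epsilon> / (2 * (G + 1))"
  have \<kappa>: "\<kappa> > 0" using e G0 by (simp add: \<kappa>_def)
  have "\<exists>d>0. \<forall>t s. 0 \<le> t \<and> t \<le> M + 1 \<and> 0 \<le> s \<and> s \<le> M + 1 \<and> \<bar>s - t\<bar> < d \<longrightarrow> \<bar>R n s - R n t\<bar> < \<kappa>" for n
  proof -
    have "uniformly_continuous_on {0..M+1} (R n)"
      by (intro compact_uniformly_continuous continuous_laguerre_poly_normalized) auto
    from uniformly_continuous_onE[OF this \<kappa>] show ?thesis by (auto simp: dist_real_def) metis
  qed
  then obtain d where d: "\<And>n. d n > 0" "\<And>n t s. 0 \<le> t \<and> t \<le> M + 1 \<and> 0 \<le> s \<and> s \<le> M + 1 \<and> \<bar>s - t\<bar> < d n \<Longrightarrow> \<bar>R n s - R n t\<bar> < \<kappa>"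
    by metis
  define dm where "dm = Min (insert 1 (d ` {..<N}))"
  define \<delta> where "\<delta> = dm / 2"
  have "dm \<le> 1" unfolding dm_def by (intro Min_le) auto
  moreover have "0 < dm" using d(1) unfolding dm_def by (subst Min_gr_iff) auto
  ultimately have \<delta>: "\<delta> > 0" "\<delta> \<le> 1" by (auto simp: \<delta>_def)
  have \<delta>d: "\<delta> < d n" if "n < N" for n
  proof -
    have "dm \<le> d n" using that unfolding dm_def by (intro Min_le) auto
    moreover have "\<delta> < dm" using \<delta> by (simp add: \<delta>_def)
    ultimately show ?thesis by simp
  qed
  have "L2_norm (\<lambda>x. T (t + h) g x - T t g x) < \<epsilon>"
    if th: "0 \<le> t" "t \<le> M" "0 \<le> h" "h \<le> \<delta>" for t h
  proof -
    define u where "u x = T (t + h) g x - T t g x" for x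
    have sT: "L2 (T (t + h) g)" "L2 (T t g)"
      using th by (auto intro!: square_integrable_translation g)
    have su: "L2 u" unfolding u_def[abs_def] by (rule square_integrable_diff[OF sT])
    have cu: "coefficient u n = (R n (t + h) - R n t) * a n" for n
      unfolding u_def[abs_def] coefficient_diff[OF sT] using th g
      by (simp add: coefficient_translation a_def left_diff_distrib)
    have r1: "0 \<le> t + h" "t + h \<le> M + 1" "t \<le> M + 1" using th \<delta> by auto
    have big: "(R n (t + h) - R n t)\<^sup>2 \<le> (2 * E)\<^sup>2" for n
    proof -
      have "\<bar>R n (t + h) - R n t\<bar> \<le> 2 * E" using RE[of "t + h" n] RE[of t n] r1 th by linarith
      then have "\<bar>R n (t + h) - R n t\<bar>\<^sup>2 \<le> (2 * E)\<^sup>2" by (intro power_mono) auto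
      then show ?thesis by simp
    qed
    have small: "(R n (t + h) - R n t)\<^sup>2 \<le> \<kappa>\<^sup>2" if "n < N" for n
    proof -
      have "\<bar>R n (t + h) - R n t\<bar> < \<kappa>" using d(2)[of t "t + h" n] r1 th \<delta>d[OF that] by auto
      then have "\<bar>R n (t + h) - R n t\<bar>\<^sup>2 \<le> \<kappa>\<^sup>2" by (intro power_mono) auto
      then show ?thesis by simp
    qed
    have "(L2_norm u)\<^sup>2 \<le> \<kappa>\<^sup>2 * G + (2 * E)\<^sup>2 * \<eta>\<^sup>2"
    proof (rule norm_squared_le_of_partial_sums[OF su])
      fix N'
      have "(\<Sum>n<N. (coefficient u n)\<^sup>2) \<le> (\<Sum>n<N. \<kappa>\<^sup>2 * (a n)\<^sup>2)"
        unfolding cu power_mult_distrib by (intro sum_mono mult_right_mono small) auto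
      also have "\<dots> = \<kappa>\<^sup>2 * (\<Sum>n<N. (a n)\<^sup>2)" by (simp add: sum_distrib_left)
      also have "\<dots> \<le> \<kappa>\<^sup>2 * G" unfolding G_def a_def by (intro mult_left_mono bessel_inequality g) auto
      finally have head: "(\<Sum>n<N. (coefficient u n)\<^sup>2) \<le> \<kappa>\<^sup>2 * G" .
      have "(\<Sum>n<N. (a n)\<^sup>2) + (\<Sum>n\<in>{N..<N'}. (a n)\<^sup>2) = (\<Sum>n\<in>{..<N} \<union> {N..<N'}. (a n)\<^sup>2)"
        by (rule sum.union_disjoint[symmetric]) auto
      also have "\<dots> \<le> G" unfolding G_def a_def by (intro bessel_inequality g) auto
      finally have ta: "(\<Sum>n\<in>{N..<N'}. (a n)\<^sup>2) \<le> \<eta>\<^sup>2" using tail by (simp add: G_def)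
      have "(\<Sum>n\<in>{N..<N'}. (coefficient u n)\<^sup>2) \<le> (\<Sum>n\<in>{N..<N'}. (2 * E)\<^sup>2 * (a n)\<^sup>2)"
        unfolding cu power_mult_distrib[of "R _ _ - _"] by (intro sum_mono mult_right_mono big) auto
      also have "\<dots> = (2 * E)\<^sup>2 * (\<Sum>n\<in>{N..<N'}. (a n)\<^sup>2)" by (simp add: sum_distrib_left)
      also have "\<dots> \<le> (2 * E)\<^sup>2 * \<eta>\<^sup>2" by (intro mult_left_mono ta) auto
      finally have rest: "(\<Sum>n\<in>{N..<N'}. (coefficient u n)\<^sup>2) \<le> (2 * E)\<^sup>2 * \<eta>\<^sup>2" .
      have "(\<Sum>n<N'. (coefficient u n)\<^sup>2) \<le> (\<Sum>n\<in>{..<N} \<union> {N..<N'}. (coefficient u n)\<^sup>2)"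
        by (intro sum_mono2) auto
      also have "\<dots> = (\<Sum>n<N. (coefficient u n)\<^sup>2) + (\<Sum>n\<in>{N..<N'}. (coefficient u n)\<^sup>2)"
        by (rule sum.union_disjoint) auto
      finally show "(\<Sum>n<N'. (coefficient u n)\<^sup>2) \<le> \<kappa>\<^sup>2 * G + (2 * E)\<^sup>2 * \<eta>\<^sup>2" using head rest by linarith
    qed
    also have "(2 * E)\<^sup>2 * \<eta>\<^sup>2 = \<epsilon>\<^sup>2 / 4" using E0 by (simp add: \<eta>_def power_divide power_mult_distrib)
    also have "\<kappa>\<^sup>2 * G \<le> \<epsilon>\<^sup>2 / 4"
    proof -
      have "G \<le> (G + 1)\<^sup>2" using G0 by (simp add: power2_eq_square algebra_simps)
      then have "G / (G + 1)\<^sup>2 \<le> 1" using G0 by simp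
      then have "\<epsilon>\<^sup>2 / 4 * (G / (G + 1)\<^sup>2) \<le> \<epsilon>\<^sup>2 / 4 * 1" by (intro mult_left_mono) auto
      moreover have "\<kappa>\<^sup>2 * G = \<epsilon>\<^sup>2 / 4 * (G / (G + 1)\<^sup>2)"
        unfolding \<kappa>_def power_divide power_mult_distrib by simp
      ultimately show ?thesis by simp
    qed
    finally have "(L2_norm u)\<^sup>2 \<le> \<epsilon>\<^sup>2 / 4 + \<epsilon>\<^sup>2 / 4" by simp
    also have "\<dots> < \<epsilon>\<^sup>2" using e by simp
    finally have "L2_norm u < \<epsilon>" by (rule power2_less_imp_less) (use e in simp)
    then show ?thesis unfolding u_def[abs_def] .
  qed
  then show ?thesis using \<delta>(1) by blast
qed

text \<open>
  The normalized Laguerre polynomials have bounded norms and are orthogonal, so by Bessel's inequality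
  their integrals over $[0,\delta]$ tend to $0$. Therefore the mean of $1-R_n$ over that interval is
  eventually at least $\frac12$, and the mean of its square at least $\frac14$. Pointwise asymptotics of $R_n$ are
  avoided by averaging in the shift.
\<close>

lemma averaged_multiplier_gap:
  assumes \<delta>: "\<delta> > 0"
  shows "\<exists>N. \<forall>n\<ge>N. measure \<mu> {0..\<delta>} / 4 \<le> (LINT h|\<mu>. indicator {0..\<delta>} h * (R n h - 1)\<^sup>2)"
    and "measure \<mu> {0..\<delta>} > 0"
proof -
  let ?A = "indicator {0..\<delta>} :: real \<Rightarrow> real"
  define m where "m = measure \<mu> {0..\<delta>}"
  define b where "b n = ((real n + \<alpha>) gchoose n)" for n
  have b1: "b n \<ge> 1" for n
  proof -
    have "fact n \<le> pochhammer (\<alpha> + 1) n" unfolding pochhammer_fact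
      using \<alpha> by (simp add: pochhammer_prod) (intro prod_mono, auto)
    then show ?thesis unfolding b_def by (subst gbinomial_pochhammer') simp
  qed
  have sA: "L2 (?A)"
    by (rule square_integrable_bounded[where C = 1]) (auto simp: indicator_def)
  have hb: "laguerre_norm_sq n = Gamma (\<alpha> + 1) * b n" for n
    using laguerre_weight_Gamma[of 0 n] by (simp add: laguerre_norm_sq_def b_def mult.commute)
  have G: "Gamma (\<alpha> + 1) > 0" using \<alpha> by (intro Gamma_real_pos) auto
  have cR: "(LINT h|\<mu>. ?A h * R n h) = coefficient (?A) n * (sqrt (laguerre_norm_sq n) / b n)" for n
    using laguerre_norm_sq_pos[of n] b1[of n]
    by (simp add: coefficient_def laguerre_function_def laguerre_poly_normalized_def b_def)
  have sb: "\<bar>sqrt (laguerre_norm_sq n) / b n\<bar> \<le> sqrt (Gamma (\<alpha> + 1))" for n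
  proof -
    \<comment> \<open>The norm of R n is at most that of R 0.\<close>
    have "sqrt (b n) \<le> b n" using b1[of n] by (intro real_le_lsqrt) (auto simp: power2_eq_square)
    then have "sqrt (b n) / b n \<le> 1" using b1[of n] by simp
    then have "sqrt (Gamma (\<alpha> + 1)) * (sqrt (b n) / b n) \<le> sqrt (Gamma (\<alpha> + 1)) * 1" using G by (intro mult_left_mono) auto
    then show ?thesis using b1[of n] G unfolding hb real_sqrt_mult by (simp add: abs_mult)
  qed
  have lim: "(\<lambda>n. LINT h|\<mu>. ?A h * R n h) \<longlonglongrightarrow> 0"
  proof (rule Lim_null_comparison)
    show "\<forall>\<^sub>F n in sequentially. norm (LINT h|\<mu>. ?A h * R n h) \<le> \<bar>coefficient (?A) n\<bar> * sqrt (Gamma (\<alpha> + 1))"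
      unfolding cR real_norm_def abs_mult by (intro always_eventually allI mult_left_mono sb) auto
    show "(\<lambda>n. \<bar>coefficient (?A) n\<bar> * sqrt (Gamma (\<alpha> + 1))) \<longlonglongrightarrow> 0"
      using coefficient_tendsto_0[OF sA] by (auto intro!: tendsto_eq_intros simp: tendsto_rabs_zero_iff)
  qed
  show mp: "measure \<mu> {0..\<delta>} > 0"
  proof (rule ccontr)
    assume "\<not> measure \<mu> {0..\<delta>} > 0"
    then have "measure \<mu> {0..\<delta>} = 0" using measure_nonneg[of \<mu> "{0..\<delta>}"] by linarith
    then have "{0..\<delta>} \<in> null_sets \<mu>" by (intro null_setsI) (simp_all add: emeasure_eq_measure)
    then have "AE x in \<mu>. x \<notin> {0..\<delta>}" by (rule AE_not_in)
    then have "AE x in lborel. 0 < ennreal (indicator {0<..} x * x powr \<alpha>) \<longrightarrow> x \<notin> {0..\<delta>}"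
      unfolding AE_laguerre_iff_radial unfolding radial_measure_def by (subst (asm) AE_density) auto
    then have "AE x in lborel. x \<notin> {0<..\<delta>}" by eventually_elim auto
    then have "emeasure lborel {0<..\<delta>} = 0"
      by (subst (asm) AE_iff_null_sets[symmetric]) auto
    then show False using \<delta> by simp
  qed
  have sR: "L2 (R n)" for n
    unfolding laguerre_poly_normalized_def
    using square_integrable_cmult[OF square_integrable_laguerre_poly[of n], of "1 / b n"] by (simp add: b_def)
  have sone: "L2 (\<lambda>_. 1)" by (rule square_integrable_bounded[where C = 1]) auto
  have sg: "L2 (\<lambda>h. ?A h * (1 - R n h))" for n
  proof -
    have s1: "L2 (\<lambda>h. 1 - R n h)" by (rule square_integrable_diff[OF sone sR])
    have [measurable]: "R n \<in> borel_measurable borel" using sR[of n] by (simp add: square_integrable_laguerre_iff)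
    show ?thesis unfolding square_integrable_def
    proof
      show "integrable \<mu> (\<lambda>h. (?A h * (1 - R n h))\<^sup>2)"
        by (rule Bochner_Integration.integrable_bound[where f = "\<lambda>h. (1 - R n h)\<^sup>2"])
           (use s1 in \<open>auto simp: square_integrable_def indicator_def\<close>)
    qed measurable
  qed
  have "m / 2 > 0" using mp by (simp add: m_def)
  then obtain N where N: "\<And>n. n \<ge> N \<Longrightarrow> \<bar>LINT h|\<mu>. ?A h * R n h\<bar> < m / 2"
    using LIMSEQ_D[OF lim, of "m / 2"] by auto
  have "m / 4 \<le> (LINT h|\<mu>. ?A h * (R n h - 1)\<^sup>2)" if n: "n \<ge> N" for n
  proof -
    define v where "v = (LINT h|\<mu>. ?A h * (R n h - 1)\<^sup>2)"
    have v: "(L2_norm (\<lambda>h. ?A h * (1 - R n h)))\<^sup>2 = v"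
      unfolding L2_norm_on_squared v_def
      by (intro Bochner_Integration.integral_cong) (auto simp: indicator_def power2_commute)
    have mA: "(L2_norm (?A))\<^sup>2 = m"
    proof -
      have "(L2_norm (?A))\<^sup>2 = (LINT h|\<mu>. ?A h)"
        unfolding L2_norm_on_squared by (intro Bochner_Integration.integral_cong) (auto simp: indicator_def)
      then show ?thesis by (simp add: m_def)
    qed
    have iA: "integrable \<mu> (\<lambda>h. ?A h :: real)"
      using square_integrable_mult_integrable[OF sA sone] by simp
    have iR: "integrable \<mu> (\<lambda>h. ?A h * R n h)"
      by (rule square_integrable_mult_integrable[OF sA sR])
    have "(LINT h|\<mu>. ?A h * (?A h * (1 - R n h)))
      = (LINT h|\<mu>. ?A h - ?A h * R n h)"
      by (intro Bochner_Integration.integral_cong) (auto simp: indicator_def)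
    also have "\<dots> = m - (LINT h|\<mu>. ?A h * R n h)"
      using iA iR by (simp add: m_def)
    also have "\<dots> \<ge> m / 2" using N[OF n] by linarith
    finally have "m / 2 \<le> L2_norm (?A) * L2_norm (\<lambda>h. ?A h * (1 - R n h))"
      using L2_Cauchy_Schwarz[OF sA sg[of n]] by linarith
    then have "(m / 2)\<^sup>2 \<le> (L2_norm (?A) * L2_norm (\<lambda>h. ?A h * (1 - R n h)))\<^sup>2"
      using \<open>m / 2 > 0\<close> by (intro power_mono) auto
    then have "m * (m / 4) \<le> m * v" unfolding power_mult_distrib v mA by (simp add: power2_eq_square)
    then show ?thesis using \<open>m / 2 > 0\<close> unfolding v_def by simp
  qed
  then show "\<exists>N. \<forall>n\<ge>N. measure \<mu> {0..\<delta>} / 4 \<le> (LINT h|\<mu>. ?A h * (R n h - 1)\<^sup>2)"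
    unfolding m_def by blast
qed

text \<open>
  The coefficients of $T_hf-f$ are those of $f$ multiplied by $R_n(h)-1$. Averaging their squares over
  $h\in[0,\delta]$ and applying \<open>averaged_multiplier_gap\<close> bounds the tail of $f$. The index \<open>N\<close> does not
  depend on $f$.
\<close>

lemma uniform_tails:
  assumes \<delta>: "\<delta> > 0" and \<epsilon>: "\<epsilon> > 0"
  shows "\<exists>N. \<forall>f. L2 f \<and>
     (\<forall>h. 0 \<le> h \<and> h \<le> \<delta> \<longrightarrow> L2_norm (\<lambda>x. T h f x - f x) < \<epsilon>) \<longrightarrow>
     L2_norm (\<lambda>x. f x - partial_sum N f x) \<le> 2 * \<epsilon>"
proof -
  let ?A = "indicator {0..\<delta>} :: real \<Rightarrow> real"
  define m where "m = measure \<mu> {0..\<delta>}"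
  have m: "m > 0" unfolding m_def by (rule averaged_multiplier_gap[OF \<delta>])
  obtain N where N: "\<And>n. n \<ge> N \<Longrightarrow> m / 4 \<le> (LINT h|\<mu>. ?A h * (R n h - 1)\<^sup>2)"
    using averaged_multiplier_gap(1)[OF \<delta>] unfolding m_def by blast
  have iv: "integrable \<mu> (\<lambda>h. ?A h * (R n h - 1)\<^sup>2)" for n
  proof -
    have "L2 (\<lambda>h. 1 / ((real n + \<alpha>) gchoose n) * L n h - 1)"
      by (intro square_integrable_diff square_integrable_cmult square_integrable_laguerre_poly square_integrable_bounded[where C = 1]) auto
    then have s: "L2 (\<lambda>h. R n h - 1)" by (simp add: laguerre_poly_normalized_def)
    then have [measurable]: "(\<lambda>h. R n h - 1) \<in> borel_measurable borel" by (simp add: square_integrable_laguerre_iff)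
    show ?thesis
      by (rule Bochner_Integration.integrable_bound[where f = "\<lambda>h. (R n h - 1)\<^sup>2"])
         (use s in \<open>auto simp: square_integrable_def indicator_def\<close>)
  qed
  show ?thesis
  proof (intro exI[of _ N] allI impI, elim conjE)
    fix f assume f: "L2 f"
      and T: "\<forall>h. 0 \<le> h \<and> h \<le> \<delta> \<longrightarrow> L2_norm (\<lambda>x. T h f x - f x) < \<epsilon>"
    define a where "a = coefficient f"
    have key: "(\<Sum>n\<in>{N..<N'}. (a n)\<^sup>2) \<le> (2 * \<epsilon>)\<^sup>2" for N'
    proof -
      have pt: "?A h * (\<Sum>n\<in>{N..<N'}. (a n)\<^sup>2 * (R n h - 1)\<^sup>2) \<le> ?A h * \<epsilon>\<^sup>2" for h
      proof (cases "h \<in> {0..\<delta>}")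
        case True
        then have h: "0 \<le> h" "h \<le> \<delta>" by auto
        have sT: "L2 (T h f)"
          by (rule square_integrable_translation[OF h(1) f])
        have "coefficient (\<lambda>x. T h f x - f x) n = (R n h - 1) * a n" for n
          unfolding coefficient_diff[OF sT f] using h f
          by (simp add: coefficient_translation a_def left_diff_distrib)
        then have "(\<Sum>n\<in>{N..<N'}. (a n)\<^sup>2 * (R n h - 1)\<^sup>2) \<le> (L2_norm (\<lambda>x. T h f x - f x))\<^sup>2"
          using bessel_inequality[OF square_integrable_diff[OF sT f], of "{N..<N'}"] by (simp add: power_mult_distrib mult.commute)
        also have "\<dots> \<le> \<epsilon>\<^sup>2" using T h by (intro power_mono) (auto intro: less_imp_le)
        finally show ?thesis using True by simp
      qed simp
      have "(m / 4) * (\<Sum>n\<in>{N..<N'}. (a n)\<^sup>2) \<le> (\<Sum>n\<in>{N..<N'}. (a n)\<^sup>2 * (LINT h|\<mu>. ?A h * (R n h - 1)\<^sup>2))"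
        unfolding sum_distrib_left
      proof (rule sum_mono)
        fix n assume "n \<in> {N..<N'}"
        then have "(a n)\<^sup>2 * (m / 4) \<le> (a n)\<^sup>2 * (LINT h|\<mu>. ?A h * (R n h - 1)\<^sup>2)"
          by (intro mult_left_mono N) auto
        then show "m / 4 * (a n)\<^sup>2 \<le> (a n)\<^sup>2 * (LINT h|\<mu>. ?A h * (R n h - 1)\<^sup>2)"
          by (simp only: mult.commute)
      qed
      also have "\<dots> = (LINT h|\<mu>. (\<Sum>n\<in>{N..<N'}. (a n)\<^sup>2 * (?A h * (R n h - 1)\<^sup>2)))"
        using iv by (subst Bochner_Integration.integral_sum) auto
      also have "\<dots> \<le> (LINT h|\<mu>. ?A h * \<epsilon>\<^sup>2)"
      proof (rule integral_mono)
        show "integrable \<mu> (\<lambda>h. \<Sum>n\<in>{N..<N'}. (a n)\<^sup>2 * (?A h * (R n h - 1)\<^sup>2))"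
          using iv by auto
        show "integrable \<mu> (\<lambda>h. ?A h * \<epsilon>\<^sup>2)"
          by (intro integrable_mult_left integrable_const_bound[of _ 1]) (auto simp: indicator_def)
        show "(\<Sum>n\<in>{N..<N'}. (a n)\<^sup>2 * (?A h * (R n h - 1)\<^sup>2)) \<le> ?A h * \<epsilon>\<^sup>2" for h
          using pt[of h] by (simp add: sum_distrib_left mult_ac)
      qed
      also have "\<dots> = m * \<epsilon>\<^sup>2" by (simp add: m_def)
      finally have "m * (\<Sum>n\<in>{N..<N'}. (a n)\<^sup>2) \<le> m * (2 * \<epsilon>)\<^sup>2" by (simp add: power_mult_distrib)
      then show ?thesis using m by simp
    qed
    have "(L2_norm f)\<^sup>2 \<le> (\<Sum>n<N. (a n)\<^sup>2) + (2 * \<epsilon>)\<^sup>2"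
    proof (rule norm_squared_le_of_partial_sums[OF f])
      fix N'
      have "(\<Sum>n<N'. (coefficient f n)\<^sup>2) \<le> (\<Sum>n\<in>{..<N} \<union> {N..<N'}. (a n)\<^sup>2)"
        unfolding a_def by (intro sum_mono2) auto
      also have "\<dots> = (\<Sum>n<N. (a n)\<^sup>2) + (\<Sum>n\<in>{N..<N'}. (a n)\<^sup>2)" by (rule sum.union_disjoint) auto
      finally show "(\<Sum>n<N'. (coefficient f n)\<^sup>2) \<le> (\<Sum>n<N. (a n)\<^sup>2) + (2 * \<epsilon>)\<^sup>2" using key[of N'] by simp
    qed
    then have "(L2_norm (\<lambda>x. f x - partial_sum N f x))\<^sup>2 \<le> (2 * \<epsilon>)\<^sup>2"
      unfolding norm_diff_partial_sum[OF f] a_def by simp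
    then show "L2_norm (\<lambda>x. f x - partial_sum N f x) \<le> 2 * \<epsilon>"
      by (rule power2_le_imp_le) (use \<epsilon> in simp)
  qed
qed

section \<open>Compactness\<close>

lemma agrees_borel_version: "f \<in> laguerre_L2 \<alpha> \<Longrightarrow> agrees_on_halfline f (borel_version f)"
  unfolding borel_version_def using ex_agrees by (rule someI_ex)

lemma square_integrable_borel_version:
  "f \<in> laguerre_L2 \<alpha> \<Longrightarrow> L2 (borel_version f)"
  using agrees_laguerre_L2(1)[OF agrees_borel_version] by blast

lemma laguerre_norm_diff_borel_version:
  "f \<in> laguerre_L2 \<alpha> \<Longrightarrow> g \<in> laguerre_L2 \<alpha> \<Longrightarrow>
    laguerre_norm \<alpha> (\<lambda>x. f x - g x) = L2_norm (\<lambda>x. borel_version f x - borel_version g x)"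
  by (intro agrees_laguerre_L2(2) agrees_diff agrees_borel_version)

lemma translation_difference_borel_version:
  assumes s: "s \<ge> 0" and t: "t \<ge> 0" and f: "f \<in> laguerre_L2 \<alpha>"
  shows "(\<lambda>x. T s f x - T t f x) \<in> laguerre_L2 \<alpha>"
    and "laguerre_norm \<alpha> (\<lambda>x. T s f x - T t f x) =
      L2_norm (\<lambda>x. T s (borel_version f) x - T t (borel_version f) x)"
proof -
  have a: "agrees_on_halfline (\<lambda>x. T s f x - T t f x)
     (\<lambda>x. T s (borel_version f) x - T t (borel_version f) x)"
    by (intro agrees_diff agrees_translation s t agrees_borel_version[OF f])
  show "laguerre_norm \<alpha> (\<lambda>x. T s f x - T t f x) =
      L2_norm (\<lambda>x. T s (borel_version f) x - T t (borel_version f) x)"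
    by (rule agrees_laguerre_L2(2)[OF a])
  show "(\<lambda>x. T s f x - T t f x) \<in> laguerre_L2 \<alpha>"
    unfolding agrees_laguerre_L2(1)[OF a]
    by (intro square_integrable_diff square_integrable_translation s t square_integrable_borel_version f)
qed

lemma property_Pb_borel_version:
  assumes "K \<subseteq> laguerre_L2 \<alpha>"
  shows "property_Pb \<alpha> K \<longleftrightarrow> (\<forall>\<epsilon>>0. \<forall>M>0. \<exists>\<delta>>0. \<forall>t h. \<forall>f\<in>K. 0 \<le> t \<and> t \<le> M \<and> 0 \<le> h \<and> h \<le> \<delta> \<longrightarrow>
     L2_norm (\<lambda>x. T (t + h) (borel_version f) x - T t (borel_version f) x) < \<epsilon>)"
proof -
  have "(0 \<le> t \<and> t \<le> M \<and> 0 \<le> h \<and> h \<le> \<delta> \<longrightarrow>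
        (\<lambda>x. T (t + h) f x - T t f x) \<in> laguerre_L2 \<alpha> \<and>
        laguerre_norm \<alpha> (\<lambda>x. T (t + h) f x - T t f x) < \<epsilon>) \<longleftrightarrow>
    (0 \<le> t \<and> t \<le> M \<and> 0 \<le> h \<and> h \<le> \<delta> \<longrightarrow>
     L2_norm (\<lambda>x. T (t + h) (borel_version f) x - T t (borel_version f) x) < \<epsilon>)"
    if "f \<in> K" for f t h M \<delta> \<epsilon>
    using translation_difference_borel_version[of "t + h" t f] that assms by auto
  then show ?thesis unfolding property_Pb_def by (simp cong: ball_cong)
qed

lemma laguerre_coeff_borel_version:
  assumes "f \<in> laguerre_L2 \<alpha>"
  shows "laguerre_coeff \<alpha> f n = sqrt (laguerre_norm_sq n) / ((real n + \<alpha>) gchoose n) * coefficient (borel_version f) n"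
  unfolding agrees_laguerre_L2(3)[OF agrees_borel_version[OF assms]]
  using laguerre_norm_sq_pos[of n]
  by (simp add: coefficient_def laguerre_function_def laguerre_poly_normalized_def)

text \<open>
  Three terms: the translations are uniformly bounded on a bounded range of shifts, and the finitely
  many centres of the net are translated continuously.
\<close>

lemma totally_bounded_imp_Pb:
  assumes K: "K \<subseteq> laguerre_L2 \<alpha>" and tb: "laguerre_totally_bounded \<alpha> K"
  shows "property_Pb \<alpha> K"
  unfolding property_Pb_borel_version[OF K]
proof (intro allI impI)
  fix \<epsilon> M :: real assume \<epsilon>: "\<epsilon> > 0" and M: "M > 0"
      define E where "E = exp ((M + 1) / 2)"
  have E: "E > 0" by (simp add: E_def)
  \<comment> \<open>Translation enlarges the distance to the centre at most E times, and this happens twice.\<close>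
  define \<eta> where "\<eta> = \<epsilon> / (4 * E)"
  have \<eta>: "\<eta> > 0" using \<epsilon> E by (simp add: \<eta>_def)
  obtain F where F: "finite F" "F \<subseteq> laguerre_L2 \<alpha>" "\<forall>f\<in>K. \<exists>g\<in>F. laguerre_norm \<alpha> (\<lambda>x. f x - g x) < \<eta>"
    using tb[unfolded laguerre_totally_bounded_def, rule_format, OF \<eta>] by blast
  have "\<forall>g\<in>F. \<exists>\<delta>>0. \<forall>t h. 0 \<le> t \<and> t \<le> M \<and> 0 \<le> h \<and> h \<le> \<delta> \<longrightarrow>
     L2_norm (\<lambda>x. T (t + h) (borel_version g) x - T t (borel_version g) x) < \<epsilon> / 2"
    using F \<epsilon> by (intro ballI translation_continuous square_integrable_borel_version) auto
  from bchoice[OF this] obtain d where "\<forall>g\<in>F. d g > 0 \<and> (\<forall>t h. 0 \<le> t \<and> t \<le> M \<and> 0 \<le> h \<and> h \<le> d g \<longrightarrow>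
     L2_norm (\<lambda>x. T (t + h) (borel_version g) x - T t (borel_version g) x) < \<epsilon> / 2)" ..
  then have d: "\<And>g. g \<in> F \<Longrightarrow> d g > 0"
    "\<And>g t h. g \<in> F \<Longrightarrow> 0 \<le> t \<and> t \<le> M \<and> 0 \<le> h \<and> h \<le> d g \<Longrightarrow>
     L2_norm (\<lambda>x. T (t + h) (borel_version g) x - T t (borel_version g) x) < \<epsilon> / 2"
    by blast+
  define \<delta> where "\<delta> = Min (insert 1 (d ` F))"
  have \<delta>: "\<delta> > 0" "\<delta> \<le> 1" "\<And>g. g \<in> F \<Longrightarrow> \<delta> \<le> d g"
    using F(1) d(1) by (auto simp: \<delta>_def Min_gr_iff)
  have "L2_norm (\<lambda>x. T (t + h) (borel_version f) x - T t (borel_version f) x) < \<epsilon>"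
    if f: "f \<in> K" and th: "0 \<le> t" "t \<le> M" "0 \<le> h" "h \<le> \<delta>" for f t h
  proof -
    obtain g where g: "g \<in> F" "laguerre_norm \<alpha> (\<lambda>x. f x - g x) < \<eta>" using F(3) f by blast
    define f' where "f' = borel_version f"
    define g' where "g' = borel_version g"
    have fL: "f \<in> laguerre_L2 \<alpha>" and gL: "g \<in> laguerre_L2 \<alpha>" using f g K F by auto
    have sf: "L2 f'" and sg: "L2 g'"
      unfolding f'_def g'_def using fL gL by (auto intro: square_integrable_borel_version)
    have n: "L2_norm (\<lambda>x. f' x - g' x) < \<eta>"
      using g(2) laguerre_norm_diff_borel_version[OF fL gL] by (simp add: f'_def g'_def)
    have close: "L2_norm (\<lambda>x. T s f' x - T s g' x) \<le> \<epsilon> / 4" if s: "0 \<le> s" "s \<le> M + 1" for s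
    proof -
      have "L2_norm (\<lambda>x. T s f' x - T s g' x) = L2_norm (T s (\<lambda>x. f' x - g' x))"
      proof (rule L2_norm_on_cong_AE)
        show "AE x in \<mu>. T s f' x - T s g' x = T s (\<lambda>x. f' x - g' x) x"
          using AE_translation_diff[OF s(1) sf sg] by eventually_elim simp
        show "T s (\<lambda>x. f' x - g' x) \<in> borel_measurable \<mu>"
          using square_integrable_translation(1)[OF s(1) square_integrable_diff[OF sf sg]]
          by (simp add: square_integrable_def)
        show "(\<lambda>x. T s f' x - T s g' x) \<in> borel_measurable \<mu>"
          using square_integrable_diff[OF square_integrable_translation(1)[OF s(1) sf] square_integrable_translation(1)[OF s(1) sg]]
          by (simp add: square_integrable_def)
      qed
      also have "\<dots> \<le> exp (s / 2) * L2_norm (\<lambda>x. f' x - g' x)"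
        by (rule translation_norm_le[OF s(1) square_integrable_diff[OF sf sg]])
      also have "\<dots> \<le> E * \<eta>" using s n by (intro mult_mono) (auto simp: E_def)
      also have "\<dots> = \<epsilon> / 4" using E by (simp add: \<eta>_def)
      finally show ?thesis .
    qed
    have th': "0 \<le> t + h" "t + h \<le> M + 1" "t \<le> M + 1" "h \<le> d g" using th \<delta>(2) \<delta>(3)[OF g(1)] by auto
    have sT: "L2 (T s f')" "L2 (T s g')" if "0 \<le> s" for s
      using square_integrable_translation(1)[OF that] sf sg by blast+
    have "L2_norm (\<lambda>x. T (t + h) f' x - T t f' x) \<le> L2_norm (\<lambda>x. T (t + h) f' x - T (t + h) g' x) + L2_norm (\<lambda>x. T (t + h) g' x - T t f' x)"
      by (rule L2_norm_on_triangle3[OF sT(1)[OF th'(1)] sT(2)[OF th'(1)] sT(1)[OF th(1)]])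
    also have "L2_norm (\<lambda>x. T (t + h) g' x - T t f' x) \<le> L2_norm (\<lambda>x. T (t + h) g' x - T t g' x) + L2_norm (\<lambda>x. T t g' x - T t f' x)"
      by (rule L2_norm_on_triangle3[OF sT(2)[OF th'(1)] sT(2)[OF th(1)] sT(1)[OF th(1)]])
    also have "L2_norm (\<lambda>x. T t g' x - T t f' x) = L2_norm (\<lambda>x. T t f' x - T t g' x)" by (rule L2_norm_on_minus_commute)
    finally have "L2_norm (\<lambda>x. T (t + h) f' x - T t f' x) \<le> \<epsilon> / 4 + (L2_norm (\<lambda>x. T (t + h) g' x - T t g' x) + \<epsilon> / 4)"
      using close[of "t + h"] close[of t] th th' by linarith
    also have "\<dots> < \<epsilon>" using d(2)[OF g(1), of t h] th th' by (simp add: g'_def)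
    finally show ?thesis by (simp add: f'_def)
  qed
  then show "\<exists>\<delta>>0. \<forall>t h. \<forall>f\<in>K. 0 \<le> t \<and> t \<le> M \<and> 0 \<le> h \<and> h \<le> \<delta> \<longrightarrow>
     L2_norm (\<lambda>x. T (t + h) (borel_version f) x - T t (borel_version f) x) < \<epsilon>"
    using \<delta>(1) by blast
qed

lemma totally_bounded_imp_coeff_bounded:
  assumes K: "K \<subseteq> laguerre_L2 \<alpha>" and tb: "laguerre_totally_bounded \<alpha> K"
  shows "pointwise_bounded (laguerre_coeff \<alpha> ` K)"
proof -
    obtain F where F: "finite F" "F \<subseteq> laguerre_L2 \<alpha>" "\<forall>f\<in>K. \<exists>g\<in>F. laguerre_norm \<alpha> (\<lambda>x. f x - g x) < 1"
    using tb[unfolded laguerre_totally_bounded_def, rule_format, OF zero_less_one] by blast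
  define C where "C = Max (insert 0 ((\<lambda>g. L2_norm (borel_version g)) ` F)) + 1"
  have C: "L2_norm (borel_version f) \<le> C" if f: "f \<in> K" for f
  proof -
    obtain g where g: "g \<in> F" "laguerre_norm \<alpha> (\<lambda>x. f x - g x) < 1" using F(3) f by blast
    have fL: "f \<in> laguerre_L2 \<alpha>" and gL: "g \<in> laguerre_L2 \<alpha>" using f g K F by auto
    have "L2_norm (borel_version f) = L2_norm (\<lambda>x. (borel_version f x - borel_version g x) + borel_version g x)" by simp
    also have "\<dots> \<le> L2_norm (\<lambda>x. borel_version f x - borel_version g x) + L2_norm (borel_version g)"
      using fL gL by (intro L2_norm_on_triangle square_integrable_diff square_integrable_borel_version)
    also have "L2_norm (\<lambda>x. borel_version f x - borel_version g x) < 1"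
      using g(2) laguerre_norm_diff_borel_version[OF fL gL] by simp
    also have "L2_norm (borel_version g) \<le> Max (insert 0 ((\<lambda>g. L2_norm (borel_version g)) ` F))"
      using F(1) g(1) by (intro Max_ge) auto
    finally show ?thesis by (simp add: C_def)
  qed
  show ?thesis unfolding pointwise_bounded_def
  proof (intro allI exI ballI)
    fix n s
    assume "s \<in> laguerre_coeff \<alpha> ` K"
    then obtain f where f: "f \<in> K" "s = laguerre_coeff \<alpha> f" by blast
    then have fL: "f \<in> laguerre_L2 \<alpha>" using K by auto
    have "(coefficient (borel_version f) n)\<^sup>2 \<le> (L2_norm (borel_version f))\<^sup>2"
      using bessel_inequality[OF square_integrable_borel_version[OF fL], of "{n}"] by simp
    then have "\<bar>coefficient (borel_version f) n\<bar> \<le> L2_norm (borel_version f)"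
      by (simp add: abs_le_square_iff[symmetric])
    also have "\<dots> \<le> C" by (rule C[OF f(1)])
    finally have "\<bar>sqrt (laguerre_norm_sq n) / ((real n + \<alpha>) gchoose n)\<bar> * \<bar>coefficient (borel_version f) n\<bar>
      \<le> \<bar>sqrt (laguerre_norm_sq n) / ((real n + \<alpha>) gchoose n)\<bar> * C"
      by (intro mult_left_mono) auto
    then show "\<bar>s n\<bar> \<le> \<bar>sqrt (laguerre_norm_sq n) / ((real n + \<alpha>) gchoose n)\<bar> * C"
      unfolding f(2) laguerre_coeff_borel_version[OF fL] abs_mult .
  qed
qed

text \<open>
  Up to the tail, $K$ is a bounded subset of a space of finite dimension, and the combinations whose
  coefficients lie on a bounded grid form a finite net.
\<close>

lemma small_tails_bounded_coeffs_imp_totally_bounded: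
  assumes K: "K \<subseteq> laguerre_L2 \<alpha>"
    and tail: "\<And>\<epsilon>. \<epsilon> > 0 \<Longrightarrow> \<exists>N. \<forall>f\<in>K. L2_norm (\<lambda>x. borel_version f x - partial_sum N (borel_version f) x) \<le> \<epsilon>"
    and bdd: "\<And>n. \<exists>C. \<forall>f\<in>K. \<bar>coefficient (borel_version f) n\<bar> \<le> C"
  shows "laguerre_totally_bounded \<alpha> K"
  unfolding laguerre_totally_bounded_def
proof (intro allI impI)
  fix \<epsilon> :: real assume \<epsilon>: "\<epsilon> > 0"
    obtain N where N: "\<And>f. f \<in> K \<Longrightarrow> L2_norm (\<lambda>x. borel_version f x - partial_sum N (borel_version f) x) \<le> \<epsilon> / 3"
    using tail[of "\<epsilon> / 3"] \<epsilon> by auto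
  obtain C where C: "\<And>n f. f \<in> K \<Longrightarrow> \<bar>coefficient (borel_version f) n\<bar> \<le> C n" using bdd by metis
  \<comment> \<open>With N coordinates, each off by at most the mesh, the distance to the grid is at most $\epsilon/3$.\<close>
  define \<eta> where "\<eta> = \<epsilon> / (3 * (real N + 1))"
  have \<eta>: "\<eta> > 0" using \<epsilon> by (simp add: \<eta>_def)
  define grid where "grid n = (\<lambda>i. \<eta> * real_of_int i) ` {- (\<lceil>C n / \<eta>\<rceil> + 1) .. \<lceil>C n / \<eta>\<rceil> + 1}" for n
  define comb where "comb c x = (\<Sum>n<N. c n * laguerre_function n x)" for c x
  define F where "F = comb ` (\<Pi>\<^sub>E n\<in>{..<N}. grid n)"
  have "finite F" unfolding F_def by (intro finite_imageI finite_PiE) (auto simp: grid_def)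
  have sc: "L2 (comb c)" for c
    unfolding comb_def[abs_def] by (rule square_integrable_combination)
  have ac: "agrees_on_halfline (comb c) (comb c)" for c
    using sc[of c] by (intro agrees_refl) (simp add: square_integrable_laguerre_iff)
  have FL: "F \<subseteq> laguerre_L2 \<alpha>"
    unfolding F_def using agrees_laguerre_L2(1)[OF ac] sc by auto
  moreover have "\<exists>g\<in>F. laguerre_norm \<alpha> (\<lambda>x. f x - g x) < \<epsilon>" if f: "f \<in> K" for f
  proof -
    have fL: "f \<in> laguerre_L2 \<alpha>" using f K by auto
    define a where "a = coefficient (borel_version f)"
    define c where "c = restrict (\<lambda>n. \<eta> * real_of_int \<lfloor>a n / \<eta>\<rfloor>) {..<N}"
    have ca: "(c n - a n)\<^sup>2 \<le> \<eta>\<^sup>2" if "n < N" for n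
    proof -
      have "real_of_int \<lfloor>a n / \<eta>\<rfloor> * \<eta> \<le> a n"
        using of_int_floor_le[of "a n / \<eta>"] unfolding pos_le_divide_eq[OF \<eta>] .
      moreover have "a n \<le> (real_of_int \<lfloor>a n / \<eta>\<rfloor> + 1) * \<eta>"
        unfolding pos_divide_le_eq[OF \<eta>, symmetric] by linarith
      ultimately have "\<bar>c n - a n\<bar> \<le> \<eta>" using that by (simp add: c_def algebra_simps)
      then have "\<bar>c n - a n\<bar>\<^sup>2 \<le> \<eta>\<^sup>2" by (intro power_mono) auto
      then show ?thesis by simp
    qed
    have "c n \<in> grid n" if "n < N" for n
    proof -
      have "\<bar>a n\<bar> \<le> C n" using C[OF f] by (simp add: a_def)
      then have "\<bar>a n / \<eta>\<bar> \<le> C n / \<eta>" using \<eta> by (simp add: abs_divide divide_right_mono)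
      then have "\<lfloor>a n / \<eta>\<rfloor> \<in> {- (\<lceil>C n / \<eta>\<rceil> + 1) .. \<lceil>C n / \<eta>\<rceil> + 1}"
        unfolding atLeastAtMost_iff by linarith
      then show ?thesis using that by (auto simp: grid_def c_def)
    qed
    then have "comb c \<in> F" unfolding F_def by (intro imageI PiE_I) (auto simp: c_def)
    have "laguerre_norm \<alpha> (\<lambda>x. f x - comb c x) = L2_norm (\<lambda>x. borel_version f x - comb c x)"
      by (intro agrees_laguerre_L2(2) agrees_diff agrees_borel_version[OF fL] ac)
    also have "\<dots> \<le> L2_norm (\<lambda>x. borel_version f x - partial_sum N (borel_version f) x) + L2_norm (\<lambda>x. partial_sum N (borel_version f) x - comb c x)"
      by (intro L2_norm_on_triangle3 square_integrable_borel_version[OF fL] square_integrable_partial_sum sc)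
    also have "L2_norm (\<lambda>x. partial_sum N (borel_version f) x - comb c x) \<le> \<epsilon> / 3"
    proof (rule power2_le_imp_le)
      have "(\<lambda>x. partial_sum N (borel_version f) x - comb c x) = (\<lambda>x. \<Sum>n<N. (a n - c n) * laguerre_function n x)"
        by (simp add: fun_eq_iff partial_sum_def comb_def a_def left_diff_distrib sum_subtractf)
      then have "(L2_norm (\<lambda>x. partial_sum N (borel_version f) x - comb c x))\<^sup>2 = (\<Sum>n<N. (a n - c n)\<^sup>2)"
        by (simp add: norm_squared_combination)
      also have "\<dots> \<le> (\<Sum>n<N. \<eta>\<^sup>2)" using ca by (intro sum_mono) (simp add: power2_commute)
      also have "\<dots> = real N * \<eta>\<^sup>2" by simp
      also have "\<dots> \<le> (real N + 1)\<^sup>2 * \<eta>\<^sup>2" by (intro mult_right_mono) (auto simp: power2_eq_square algebra_simps)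
      also have "\<dots> = ((real N + 1) * \<eta>)\<^sup>2" by (simp add: power_mult_distrib)
      also have "(real N + 1) * \<eta> = \<epsilon> / 3" by (simp add: \<eta>_def field_simps)
      finally show "(L2_norm (\<lambda>x. partial_sum N (borel_version f) x - comb c x))\<^sup>2 \<le> (\<epsilon> / 3)\<^sup>2" .
    qed (use \<epsilon> in simp)
    also have "L2_norm (\<lambda>x. borel_version f x - partial_sum N (borel_version f) x) \<le> \<epsilon> / 3" by (rule N[OF f])
    finally have "laguerre_norm \<alpha> (\<lambda>x. f x - comb c x) < \<epsilon>" using \<epsilon> by linarith
    then show ?thesis using \<open>comb c \<in> F\<close> by blast
  qed
  ultimately show "\<exists>F. finite F \<and> F \<subseteq> laguerre_L2 \<alpha> \<and> (\<forall>f\<in>K. \<exists>g\<in>F. laguerre_norm \<alpha> (\<lambda>x. f x - g x) < \<epsilon>)"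
    using \<open>finite F\<close> by blast
qed

text \<open>
  Property $\mathbf{P_b}$ at $t=0$, where \<open>T 0 f = f\<close>, is what \<open>uniform_tails\<close> turns into smallness of
  the tails.
\<close>

lemma Pb_coeff_bounded_imp_totally_bounded:
  assumes K: "K \<subseteq> laguerre_L2 \<alpha>" and Pb: "property_Pb \<alpha> K" and pb: "pointwise_bounded (laguerre_coeff \<alpha> ` K)"
  shows "laguerre_totally_bounded \<alpha> K"
proof (rule small_tails_bounded_coeffs_imp_totally_bounded[OF K])
    fix \<epsilon> :: real assume \<epsilon>: "\<epsilon> > 0"
  then have e2: "\<epsilon> / 2 > 0" by simp
  obtain \<delta> where \<delta>: "\<delta> > 0" and P: "\<And>t h f. f \<in> K \<Longrightarrow> 0 \<le> t \<and> t \<le> 1 \<and> 0 \<le> h \<and> h \<le> \<delta> \<Longrightarrow>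
     L2_norm (\<lambda>x. T (t + h) (borel_version f) x - T t (borel_version f) x) < \<epsilon> / 2"
    using Pb[unfolded property_Pb_borel_version[OF K], rule_format, OF e2 zero_less_one] by blast
  have P0: "L2_norm (\<lambda>x. T h (borel_version f) x - borel_version f x) < \<epsilon> / 2" if "f \<in> K" "0 \<le> h" "h \<le> \<delta>" for f h
    using P[OF that(1), of 0 h] that by (simp add: laguerre_translation_0)
  obtain N where N: "\<And>f. L2 f \<Longrightarrow>
     (\<forall>h. 0 \<le> h \<and> h \<le> \<delta> \<longrightarrow> L2_norm (\<lambda>x. T h f x - f x) < \<epsilon> / 2) \<Longrightarrow>
     L2_norm (\<lambda>x. f x - partial_sum N f x) \<le> 2 * (\<epsilon> / 2)"
    using uniform_tails[OF \<delta> e2] by blast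
  have "L2_norm (\<lambda>x. borel_version f x - partial_sum N (borel_version f) x) \<le> \<epsilon>" if "f \<in> K" for f
    using N[of "borel_version f"] P0[OF that] square_integrable_borel_version K that by auto
  then show "\<exists>N. \<forall>f\<in>K. L2_norm (\<lambda>x. borel_version f x - partial_sum N (borel_version f) x) \<le> \<epsilon>" by blast
next
  fix n
  define k where "k = sqrt (laguerre_norm_sq n) / ((real n + \<alpha>) gchoose n)"
  have k: "k > 0" unfolding k_def using laguerre_norm_sq_pos[of n] gbinomial_laguerre_pos[of n] by simp
  obtain B where B: "\<And>f. f \<in> K \<Longrightarrow> \<bar>laguerre_coeff \<alpha> f n\<bar> \<le> B" using pb unfolding pointwise_bounded_def by blast
  have "\<bar>coefficient (borel_version f) n\<bar> \<le> B / k" if "f \<in> K" for f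
  proof -
    have "laguerre_coeff \<alpha> f n = k * coefficient (borel_version f) n"
      using laguerre_coeff_borel_version[of f n] that K by (auto simp: k_def)
    then show ?thesis using B[OF that] k by (simp add: abs_mult field_simps)
  qed
  then show "\<exists>C. \<forall>f\<in>K. \<bar>coefficient (borel_version f) n\<bar> \<le> C" by blast
qed

end

theorem corollary1:
  fixes \<alpha> :: real and K :: "(real \<Rightarrow> real) set"
  assumes "\<alpha> \<ge> 0" and "K \<subseteq> laguerre_L2 \<alpha>"
  shows "laguerre_totally_bounded \<alpha> K \<longleftrightarrow>
           property_Pb \<alpha> K \<and> pointwise_bounded (laguerre_coeff \<alpha> ` K)"
proof -
  interpret nonneg_laguerre_parameter \<alpha> by unfold_locales (use assms(1) in auto)
  show ?thesis
    using totally_bounded_imp_Pb[OF assms(2)] totally_bounded_imp_coeff_bounded[OF assms(2)]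
      Pb_coeff_bounded_imp_totally_bounded[OF assms(2)] by blast
qed

end
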